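(* Let $\chi\in\{0,1\}$ and let $M$ be a non-negative integer with $2M+\chi\ge1$. Let $g_\chi$ be a cyclic Pólya frequency function of order $2M+\chi$ (odd order for $\chi=1$, even order for $\chi=0$) which is $(2M+\chi-1)$-times differentiable with $\partial^jg_\chi\in L^1(\mathbb S_1)$ for $j=0,\ldots,2M+\chi-1$. Then $\omega_{2M+\chi}(z')={z'}^{-M-\chi+1}g_\chi(z')$ is a weight associated to a cyclic Pólya ensemble on $\mathrm U(2M+\chi)$.
   Context: $\mathbb S_1=\{z\in\mathbb C: |z|=1\}$ carries the normalised Haar measure $\frac{dz'}{2\pi i z'}$ (i.e. $\frac{d\theta}{2\pi}$ for $z'=e^{i\theta}$). A star denotes complex conjugation. $\Delta_n(z)=\prod_{1\le a<b\le n}(z_b-z_a)$. For $w\in L^1(\mathbb S_1)$ and $s\in\mathbb Z$, $\mathcal Sw(s)=\int_{\mathbb S_1}\frac{dz'}{2\pi i z'}{z'}^{s}w(z')$. For $x,y\in\mathbb S_1^{n}$: $y^{-1}=(y_1^{-1},\ldots,y_n^{-1})$ and $\det(xy^{-1})=\prod_{j=1}^nx_jy_j^{-1}$. Cyclic Pólya frequency functions (Pólya frequency functions on $\mathbb S_1$). (i) A function $g:\mathbb S_1\to\mathbb R_+$ is a Pólya frequency function of odd order $2M+1$ if $$\frac{\Delta_{2m+1}(x)\Delta_{2m+1}(y^{-1})}{[\det(xy^{-1})]^m}\det[g(x_ay_b^{-1})]_{a,b=1,\ldots,2m+1}\ge0$$ for all $x,y\in\mathbb S_1^{2m+1}$ and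 $m=0,1,\ldots,M$. (ii) A function $g:\mathbb S_1\to\mathbb C$ satisfying $[g(z)]^*=zg(z)$ is a Pólya frequency function of even order $2M$ if $$\frac{\Delta_{2m}(x)\Delta_{2m}(y^{-1})}{[\det(xy^{-1})]^{m-1}}\det[g(x_ay_b^{-1})]_{a,b=1,\ldots,2m}\ge0$$ for all $x,y\in\mathbb S_1^{2m}$ and $m=1,\ldots,M$. $L_N^1(\mathbb S_1)=\{w\in L^1(\mathbb S_1): [w(z)]^*=z^{N-1}w(z)\}$. $\widetilde L_N^1(\mathbb S_1)$ is the set of $w\in L_N^1(\mathbb S_1)$ that are $(N-1)$-times differentiable with $\partial^jw\in L^1(\mathbb S_1)$ for all $j=0,\ldots,N-1$. Here and for $g_\chi$ (with $N=2M+\chi$), $(N-1)$-times differentiable means $(N-2)$-times continuously differentiable, while the $(N-1)$-th derivative needs only to exist almost everywhere. A unitarily invariant random matrix $U\in\mathrm U(N)$ (distribution invariant under $U\mapsto VUV^\dagger$ for all $V\in\mathrm U(N)$) is drawn from a cyclic Pólya ensemble on $\mathrm U(N)$ associated to the weight $\omega\in\widetilde L_N^1(\mathbb S_1)$ iff the joint probability density of its eigenvalues $z\in\mathbb S_1^N$, with respect to $\prod_{j=1}^N\frac{dz_j}{2\pi i z_j}$, can be written as $$p_N^{(U)}(z)=\frac{1}{N!\prod_{j=0}^{N-1}[j!\,\mathcal S\omega(j)]}\,\Delta_N(z)\det[(-z_a\partial_{z_a})^{b-1}\omega(z_a)]_{a,b=1,\ldots,N}\ge0 ,$$ with positive normalisation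 $\prod_{j=0}^{N-1}j!\,\mathcal S\omega(j)>0$.
   Formalization: Adds the hypothesis that det[g(x_a y_b^{-1})] of size 2M+χ is not almost everywhere zero; without it the claim fails (g = 0, or g = 1 with M = χ = 1, gives zero normalisation), and the conclusion itself implies it. *)

theory Defs
  imports
    "HOL-Probability.Probability"
    "HOL-Combinatorics.Permutations"
    "Jordan_Normal_Form.Char_Poly"
    "Jordan_Normal_Form.Schur_Decomposition"
begin

text \<open>
  Functions on the unit circle are functions on the complex numbers of which only the values on
  the circle are used.  Points of the torus are functions on the naturals of which
  the entries with index below \<open>N\<close> are used; indices start at 0.
\<close>

abbreviation unit_circle :: "complex set" where
  "unit_circle \<equiv> sphere 0 1"

text \<open>Normalised Haar measure on the Borel sets of the circle.\<close>

definition circle :: "complex measure" where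
  "circle = distr (uniform_measure lborel {0..2 * pi}) (restrict_space borel unit_circle) cis"

definition torus :: "nat \<Rightarrow> (nat \<Rightarrow> complex) measure" where
  "torus N = Pi\<^sub>M {..<N} (\<lambda>_. circle)"

lemma space_circle [simp]: "space circle = unit_circle"
  by (simp add: circle_def space_restrict_space)

lemma prob_space_circle: "prob_space circle"
proof -
  have "prob_space (uniform_measure lborel {0..2 * pi})"
    by (rule prob_space_uniform_measure) (auto simp: emeasure_lborel_Icc)
  moreover have "cis \<in> measurable (uniform_measure lborel {0..2 * pi}) (restrict_space borel unit_circle)"
  proof (rule measurable_restrict_space2)
    have "cis \<in> borel_measurable borel"
      by (intro borel_measurable_continuous_onI continuous_intros)
    then show "cis \<in> borel_measurable (uniform_measure lborel {0..2 * pi})"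
      by (subst measurable_cong_sets [of _ borel _ borel]) auto
  qed auto
  ultimately show ?thesis
    unfolding circle_def by (rule prob_space.prob_space_distr)
qed

text \<open>Integrability is with respect to Lebesgue measurable functions, hence the completion.\<close>

definition L1_circle :: "(complex \<Rightarrow> complex) \<Rightarrow> bool" where
  "L1_circle w \<longleftrightarrow> integrable (completion circle) w"

definition spherical_transform :: "(complex \<Rightarrow> complex) \<Rightarrow> int \<Rightarrow> complex" where
  "spherical_transform w s = (LINT z|completion circle. z powi s * w z)"

text \<open>
  The derivative along the circle.  It satisfies
  \<open>z * circle_deriv f z = - \<i> * (d/dt) f (cis t)\<close> at \<open>z = cis t\<close>, and is an unspecified constant
  where \<open>f\<close> is not differentiable along the circle.
\<close>

definition circle_deriv :: "(complex \<Rightarrow> complex) \<Rightarrow> complex \<Rightarrow> complex" where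
  "circle_deriv f z = (SOME D. (f has_field_derivative D) (at z within unit_circle))"

text \<open>
  \<open>n\<close>-times differentiable: \<open>(n - 1)\<close>-times continuously differentiable, with the \<open>n\<close>-th derivative
  existing almost everywhere.  There is no condition for \<open>n = 0\<close>.
\<close>

definition times_differentiable :: "nat \<Rightarrow> (complex \<Rightarrow> complex) \<Rightarrow> bool" where
  "times_differentiable n f \<longleftrightarrow>
     (\<forall>j<n. continuous_on unit_circle ((circle_deriv ^^ j) f)) \<and>
     (\<forall>j. Suc j < n \<longrightarrow> (\<forall>z\<in>unit_circle.
        (circle_deriv ^^ j) f field_differentiable (at z within unit_circle))) \<and>
     (\<forall>j. Suc j = n \<longrightarrow> (AE z in circle.
        (circle_deriv ^^ j) f field_differentiable (at z within unit_circle)))"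

definition L1N :: "nat \<Rightarrow> (complex \<Rightarrow> complex) set" where
  "L1N N = {w. L1_circle w \<and> (\<forall>z\<in>unit_circle. cnj (w z) = z ^ (N - 1) * w z)}"

definition L1N_tilde :: "nat \<Rightarrow> (complex \<Rightarrow> complex) set" where
  "L1N_tilde N = {w \<in> L1N N. times_differentiable (N - 1) w \<and>
     (\<forall>j\<le>N - 1. L1_circle ((circle_deriv ^^ j) w))}"

definition vandermonde :: "nat \<Rightarrow> (nat \<Rightarrow> complex) \<Rightarrow> complex" where
  "vandermonde n z = (\<Prod>b<n. \<Prod>a<b. z b - z a)"

definition kernel_det :: "nat \<Rightarrow> (complex \<Rightarrow> complex) \<Rightarrow> (nat \<Rightarrow> complex) \<Rightarrow> (nat \<Rightarrow> complex) \<Rightarrow> complex" where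
  "kernel_det n g x y = Determinant.det (Matrix.mat n n (\<lambda>(a, b). g (x a * inverse (y b))))"

text \<open>The inequality of size \<open>n\<close> with exponent \<open>k\<close> in the denominator.\<close>

definition pf_inequality :: "nat \<Rightarrow> nat \<Rightarrow> (complex \<Rightarrow> complex) \<Rightarrow> bool" where
  "pf_inequality n k g \<longleftrightarrow>
     (\<forall>x y. (\<forall>a<n. x a \<in> unit_circle) \<longrightarrow> (\<forall>a<n. y a \<in> unit_circle) \<longrightarrow>
        vandermonde n x * vandermonde n (\<lambda>a. inverse (y a)) / (\<Prod>a<n. x a * inverse (y a)) ^ k
          * kernel_det n g x y \<in> \<real>\<^sub>\<ge>\<^sub>0)"

definition cyclic_pff_odd :: "nat \<Rightarrow> (complex \<Rightarrow> complex) \<Rightarrow> bool" where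
  "cyclic_pff_odd M g \<longleftrightarrow>
     (\<forall>z\<in>unit_circle. g z \<in> \<real>\<^sub>\<ge>\<^sub>0) \<and> (\<forall>m\<le>M. pf_inequality (2 * m + 1) m g)"

definition cyclic_pff_even :: "nat \<Rightarrow> (complex \<Rightarrow> complex) \<Rightarrow> bool" where
  "cyclic_pff_even M g \<longleftrightarrow>
     (\<forall>z\<in>unit_circle. cnj (g z) = z * g z) \<and> (\<forall>m\<in>{1..M}. pf_inequality (2 * m) (m - 1) g)"

definition unitary_mats :: "nat \<Rightarrow> complex mat set" where
  "unitary_mats N = {U \<in> carrier_mat N N. U * mat_adjoint U = 1\<^sub>m N}"

text \<open>The Borel \<open>\<sigma>\<close>-algebra on the unitary group, generated by the matrix entries.\<close>

definition unitary_space :: "nat \<Rightarrow> complex mat measure" where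
  "unitary_space N = vimage_algebra (unitary_mats N)
     (\<lambda>U. \<lambda>(i, j)\<in>{..<N} \<times> {..<N}. U $$ (i, j)) (Pi\<^sub>M ({..<N} \<times> {..<N}) (\<lambda>_. borel))"

text \<open>A unitarily invariant random matrix is represented by its distribution.\<close>

definition unitarily_invariant :: "nat \<Rightarrow> complex mat measure \<Rightarrow> bool" where
  "unitarily_invariant N \<mu> \<longleftrightarrow> prob_space \<mu> \<and> sets \<mu> = sets (unitary_space N) \<and>
     (\<forall>V\<in>unitary_mats N. distr \<mu> (unitary_space N) (\<lambda>U. V * U * mat_adjoint V) = \<mu>)"

text \<open>
  The eigenvalues, counted with multiplicity, carry no order.  A joint density (a symmetric
  function) therefore describes the probabilities of the events that the eigenvalue configuration
  lies in a permutation invariant Borel set.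
\<close>

definition joint_eigenvalue_density ::
    "nat \<Rightarrow> complex mat measure \<Rightarrow> ((nat \<Rightarrow> complex) \<Rightarrow> real) \<Rightarrow> bool" where
  "joint_eigenvalue_density N \<mu> p \<longleftrightarrow>
     (\<forall>B \<in> sets (torus N). (\<forall>z\<in>B. \<forall>\<sigma>. \<sigma> permutes {..<N} \<longrightarrow> z \<circ> \<sigma> \<in> B) \<longrightarrow>
        (let E = {U \<in> space \<mu>. \<exists>z\<in>B. char_poly U = (\<Prod>a<N. [:- z a, 1:])} in
           E \<in> sets \<mu> \<and>
           emeasure \<mu> E = (\<integral>\<^sup>+ z. ennreal (p z) * indicator B z \<partial>completion (torus N))))"

definition polya_normalisation :: "nat \<Rightarrow> (complex \<Rightarrow> complex) \<Rightarrow> complex" where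
  "polya_normalisation N w = (\<Prod>j<N. fact j * spherical_transform w (int j))"

definition polya_density :: "nat \<Rightarrow> (complex \<Rightarrow> complex) \<Rightarrow> (nat \<Rightarrow> complex) \<Rightarrow> complex" where
  "polya_density N w z =
     1 / (fact N * polya_normalisation N w) * vandermonde N z *
     Determinant.det (Matrix.mat N N (\<lambda>(a, b). ((\<lambda>f u. - u * circle_deriv f u) ^^ b) w (z a)))"

text \<open>The density is complex-valued by its formula, and defined only almost everywhere.\<close>

definition cyclic_polya_ensemble ::
    "nat \<Rightarrow> (complex \<Rightarrow> complex) \<Rightarrow> complex mat measure \<Rightarrow> bool" where
  "cyclic_polya_ensemble N w \<mu> \<longleftrightarrow>
     w \<in> L1N_tilde N \<and>
     polya_normalisation N w \<in> \<real> \<and> Re (polya_normalisation N w) > 0 \<and>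
     (AE z in torus N. polya_density N w z \<in> \<real>\<^sub>\<ge>\<^sub>0) \<and>
     unitarily_invariant N \<mu> \<and>
     joint_eigenvalue_density N \<mu> (\<lambda>z. Re (polya_density N w z))"

definition cyclic_polya_weight :: "nat \<Rightarrow> (complex \<Rightarrow> complex) \<Rightarrow> bool" where
  "cyclic_polya_weight N w \<longleftrightarrow> (\<exists>\<mu>. cyclic_polya_ensemble N w \<mu>)"

end

theory Submission
  imports Defs
begin

text \<open>
  Put \<open>h(t) = e^(i (N - 1) t / 2) w(e^(it))\<close>, a real function that is periodic up to the sign
  \<open>(-1)^(N - 1)\<close>.  In terms of \<open>h\<close> the total positivity of order \<open>N\<close> says that
  \<open>det h(s\<^sub>a + t\<^sub>b)\<close> has the sign of a product of two sine Vandermonde determinants, and letting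
  all \<open>t\<^sub>b\<close> coalesce gives the nonnegativity of the density, whose determinant is the Wronskian type
  determinant of \<open>h, h', \<dots>, h^(N - 1)\<close>.

  Integrating the kernel determinant against the Vandermonde determinants (Andreief) and using the
  rotation invariance of the Haar measure shows that the product of the moments \<open>S w (j)\<close>, \<open>j < N\<close>,
  is nonnegative; by nondegeneracy it is positive.  That the density has mass one then follows by
  Andreief and integration by parts, provided that \<open>h^(N - 2)\<close> is the integral of its derivative
  \<open>h^(N - 1)\<close>, which is only assumed to exist almost everywhere.  To rule out a singular part, keep
  one row of the coalescing determinant as an increment over an interval.  The result is monotone in
  the end point, hence at least the integral of its derivative, so the singular part on an interval
  has the sign of a Wronskian of the remaining rows.  This sign changes when one of the remaining
  arguments crosses the interval, which is impossible for a nonzero singular part because some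
  Wronskian does not vanish.

  The ensemble is realised as \<open>V diag(z) V*\<close> with \<open>z\<close> drawn from the density and an independent \<open>V\<close>
  obtained by the Gram--Schmidt process from a matrix that is uniform in a Frobenius ball.
\<close>

text \<open>The obstacle is the step from order N - 2 to N - 1. Existence of the last derivative
  almost everywhere is compatible with a Cantor-like part of h^(N - 2), and such a part would
  destroy the integration by parts that computes the top moments, hence the total mass. The
  inequality can be used there because a row of increments is a row of antiderivatives: it is one
  order smoother, so its end points may be arbitrary, while the other rows sit at points of
  differentiability. That some Wronskian of h, ..., h^(N - 2) does not vanish comes from the moments
  below the top order, for which integration by parts is classical: a suitable torus integral of
  these Wronskians is a product of factorials and moments. Nondegeneracy excludes functions such as
  g = 0, which satisfy every inequality although the normalisation vanishes. The event in the joint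
  density is existential over unordered eigenvalues. Sorting them by angle gives a measurable choice
  of order, which is enough because the test sets are permutation invariant.\<close>

hide_const (open) Determinants.det Finite_Cartesian_Product.vec Finite_Cartesian_Product.mat

section \<open>Determinants\<close>

text \<open>Entries as functions of two indices: a row is replaced by function update and no
  dimension conditions arise.\<close>

definition fdet :: "nat \<Rightarrow> (nat \<Rightarrow> nat \<Rightarrow> 'a::comm_ring_1) \<Rightarrow> 'a" where
  "fdet n F = Determinant.det (Matrix.mat n n (\<lambda>(a, b). F a b))"

lemma fdet_leibniz:
  "fdet n F = (\<Sum>\<sigma> | \<sigma> permutes {..<n}. signof \<sigma> * (\<Prod>a<n. F a (\<sigma> a)))"
proof -
  have *: "(\<Prod>i = 0..<n. Matrix.mat n n (\<lambda>(a, b). F a b) $$ (i, p i)) = (\<Prod>a<n. F a (p a))"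
    if "p permutes {..<n}" for p
  proof -
    have "p i < n" if "i < n" for i
      using permutes_in_image[OF \<open>p permutes {..<n}\<close>, of i] that by auto
    then show ?thesis by (simp add: lessThan_atLeast0)
  qed
  show ?thesis unfolding fdet_def
    by (subst det_def'[of _ n]) (auto simp: lessThan_atLeast0[symmetric] * intro!: sum.cong)
qed

lemma fdet_cong: "(\<And>a b. a < n \<Longrightarrow> b < n \<Longrightarrow> F a b = G a b) \<Longrightarrow> fdet n F = fdet n G"
  unfolding fdet_def by (rule arg_cong[of _ _ Determinant.det]) auto

lemma fdet_scale_rows: "fdet n (\<lambda>a b. c a * F a b) = (\<Prod>a<n. c a) * fdet n F"
  unfolding fdet_leibniz by (simp add: prod.distrib sum_distrib_left algebra_simps)

lemma fdet_transpose: "fdet n (\<lambda>a b. F b a) = fdet n F"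
proof -
  have "fdet n (\<lambda>a b. F b a) = Determinant.det (transpose_mat (Matrix.mat n n (\<lambda>(a, b). F a b)))"
    unfolding fdet_def by (rule arg_cong[of _ _ Determinant.det]) auto
  also have "\<dots> = fdet n F" unfolding fdet_def by (rule det_transpose[of _ n]) auto
  finally show ?thesis .
qed

lemma fdet_scale_cols: "fdet n (\<lambda>a b. c b * F a b) = (\<Prod>a<n. c a) * fdet n F"
proof -
  have "fdet n (\<lambda>a b. c b * F a b) = fdet n (\<lambda>b a. c b * F a b)"
    by (rule fdet_transpose[of n "\<lambda>b a. c b * F a b"])
  also have "\<dots> = (\<Prod>a<n. c a) * fdet n (\<lambda>b a. F a b)" by (rule fdet_scale_rows)
  also have "fdet n (\<lambda>b a. F a b) = fdet n F" by (rule fdet_transpose)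
  finally show ?thesis .
qed

lemma fdet_mult: "fdet n (\<lambda>a b. \<Sum>k<n. F a k * G k b) = fdet n F * fdet n G"
proof -
  have "fdet n (\<lambda>a b. \<Sum>k<n. F a k * G k b)
    = Determinant.det (Matrix.mat n n (\<lambda>(a, b). F a b) * Matrix.mat n n (\<lambda>(a, b). G a b))"
    unfolding fdet_def
    by (rule arg_cong[of _ _ Determinant.det])
      (auto simp: scalar_prod_def lessThan_atLeast0[symmetric] intro!: sum.cong)
  also have "\<dots> = fdet n F * fdet n G" unfolding fdet_def by (rule det_mult) auto
  finally show ?thesis .
qed

lemma fdet_upper_triangular:
  assumes "\<And>a b. b < a \<Longrightarrow> a < n \<Longrightarrow> F a b = 0"
  shows "fdet n F = (\<Prod>a<n. F a a)"
proof -
  have "fdet n F = prod_list (diag_mat (Matrix.mat n n (\<lambda>(a, b). F a b)))" unfolding fdet_def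
    by (rule det_upper_triangular) (auto simp: upper_triangular_def assms)
  also have "diag_mat (Matrix.mat n n (\<lambda>(a, b). F a b)) = map (\<lambda>a. F a a) [0..<n]"
    by (auto simp: diag_mat_def)
  also have "prod_list \<dots> = (\<Prod>a<n. F a a)" by (simp add: prod.list_conv_set_nth lessThan_atLeast0)
  finally show ?thesis .
qed

lemma fdet_lower_triangular:
  assumes "\<And>a b. a < b \<Longrightarrow> b < n \<Longrightarrow> F a b = 0"
  shows "fdet n F = (\<Prod>a<n. F a a)"
  using fdet_upper_triangular[of n "\<lambda>a b. F b a"] assms by (simp add: fdet_transpose[of n F])

text \<open>\<open>G\<close> is \<open>F\<close> times an upper triangular matrix with unit
  diagonal. This one principle serves the Vandermonde determinant, the change from one derivation to
  another, and the Gram-Schmidt process.\<close>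

lemma fdet_unitriangular_cols:
  assumes "\<And>a b. a < n \<Longrightarrow> b < n \<Longrightarrow> G a b = (\<Sum>l\<le>b. F a l * C l b)" and "\<And>b. b < n \<Longrightarrow> C b b = 1"
  shows "fdet n G = fdet n F"
proof -
  define C' where "C' l b = (if l \<le> b then C l b else 0)" for l b
  have "G a b = (\<Sum>k<n. F a k * C' k b)" if "a < n" "b < n" for a b
  proof -
    have "(\<Sum>k<n. F a k * C' k b) = (\<Sum>k\<le>b. F a k * C' k b)"
      using that by (intro sum.mono_neutral_right) (auto simp: C'_def)
    then show ?thesis using that assms(1) by (simp add: C'_def)
  qed
  then have "fdet n G = fdet n (\<lambda>a b. \<Sum>k<n. F a k * C' k b)" by (rule fdet_cong)
  also have "\<dots> = fdet n F * (\<Prod>a<n. C' a a)"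
    by (subst fdet_mult, subst fdet_upper_triangular[of n C']) (auto simp: C'_def)
  also have "(\<Prod>a<n. C' a a) = 1" by (intro prod.neutral) (auto simp: C'_def assms)
  finally show ?thesis by simp
qed

text \<open>Replacing the monomials by the monic polynomials vanishing at \<open>z 0, \<dots>, z (b - 1)\<close> makes the
  matrix triangular.\<close>

lemma fdet_vandermonde:
  fixes z :: "nat \<Rightarrow> 'a::idom"
  shows "fdet n (\<lambda>a b. z a ^ b) = (\<Prod>b<n. \<Prod>a<b. z b - z a)"
proof -
  define p where "p b = (\<Prod>c<b. [:- z c, 1:])" for b
  have deg: "Polynomial.degree (p b) = b" for b
    unfolding p_def by (simp add: degree_prod_eq_sum_degree)
  have lc: "lead_coeff (p b) = 1" for b
    unfolding p_def by (simp only: lead_coeff_prod) simp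
  have val: "poly (p b) x = (\<Prod>c<b. x - z c)" for b x
    unfolding p_def by (simp add: poly_prod algebra_simps)
  have "fdet n (\<lambda>a b. poly (p b) (z a)) = fdet n (\<lambda>a b. z a ^ b)"
  proof (rule fdet_unitriangular_cols[where C = "\<lambda>l b. coeff (p b) l"])
    show "poly (p b) (z a) = (\<Sum>l\<le>b. z a ^ l * coeff (p b) l)" for a b
      by (simp add: poly_altdef deg mult.commute)
    show "coeff (p b) b = 1" for b using lc[of b] by (simp add: deg)
  qed
  moreover have "fdet n (\<lambda>a b. poly (p b) (z a)) = (\<Prod>a<n. poly (p a) (z a))"
    by (rule fdet_lower_triangular) (auto simp: val)
  ultimately show ?thesis by (simp add: val)
qed

text \<open>The coefficients do not depend on the row \<open>r\<close>. Hence a determinant whose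
  row \<open>i\<close> depends on a parameter can be differentiated in that parameter term by
  term.\<close>

lemma fdet_row_expansion:
  fixes F :: "nat \<Rightarrow> nat \<Rightarrow> 'a::comm_ring_1"
  assumes "i < n"
  obtains c where "\<And>r. fdet n (F(i := r)) = (\<Sum>j<n. r j * c j)"
proof -
  define A where "A r = Matrix.mat n n (\<lambda>(a, b). (F(i := r)) a b)" for r
  have "mat_delete (A r) i j = mat_delete (A r') i j" for r r' j
    unfolding mat_delete_def A_def by (rule eq_matI) auto
  then have cof: "cofactor (A r) i j = cofactor (A (\<lambda>_. 0)) i j" for r j
    unfolding cofactor_def by metis
  define c where "c j = cofactor (A (\<lambda>_. 0)) i j" for j
  have "cofactor (A r) i j = c j" for r j unfolding c_def by (rule cof)
  moreover have "fdet n (F(i := r)) = (\<Sum>j<n. A r $$ (i, j) * cofactor (A r) i j)" for r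
    unfolding fdet_def A_def[symmetric] using assms
    by (intro laplace_expansion_row) (auto simp: A_def)
  moreover have "A r $$ (i, j) = r j" if "j < n" for r j using assms that by (simp add: A_def)
  ultimately have "fdet n (F(i := r)) = (\<Sum>j<n. r j * c j)" for r
    by simp
  with that show ?thesis by blast
qed

text \<open>The last cofactor is named explicitly because it is the only one that survives when the
  absolutely continuous columns are subtracted; it becomes a Wronskian of the remaining
  rows.\<close>

lemma fdet_row_0_cofactor:
  fixes F :: "nat \<Rightarrow> nat \<Rightarrow> 'a::comm_ring_1"
  obtains c where "\<And>r. fdet (Suc n) (F(0 := r)) = (\<Sum>j\<le>n. r j * c j)"
    "c n = (-1) ^ n * fdet n (\<lambda>a b. F (Suc a) b)"
proof -
  define A where "A r = Matrix.mat (Suc n) (Suc n) (\<lambda>(a, b). (F(0 := r)) a b)" for r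
  have "mat_delete (A r) 0 j = mat_delete (A r') 0 j" for r r' j
    unfolding mat_delete_def A_def by (rule eq_matI) auto
  then have cof: "cofactor (A r) 0 j = cofactor (A (\<lambda>_. 0)) 0 j" for r j
    unfolding cofactor_def by metis
  define c where "c j = cofactor (A (\<lambda>_. 0)) 0 j" for j
  have "cofactor (A r) 0 j = c j" for r j unfolding c_def by (rule cof)
  moreover have "fdet (Suc n) (F(0 := r)) = (\<Sum>j<Suc n. A r $$ (0, j) * cofactor (A r) 0 j)" for r
    unfolding fdet_def A_def[symmetric] by (intro laplace_expansion_row) (auto simp: A_def)
  moreover have "A r $$ (0, j) = r j" if "j < Suc n" for r j using that by (simp add: A_def)
  ultimately have 1: "fdet (Suc n) (F(0 := r)) = (\<Sum>j\<le>n. r j * c j)" for r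
    by (simp add: lessThan_Suc_atMost)
  have "mat_delete (A (\<lambda>_. 0)) 0 n = Matrix.mat n n (\<lambda>(a, b). F (Suc a) b)"
    unfolding mat_delete_def A_def by (rule eq_matI) auto
  then have "c n = (-1) ^ n * fdet n (\<lambda>a b. F (Suc a) b)"
    by (simp add: c_def cofactor_def fdet_def)
  with 1 that show ?thesis by blast
qed

text \<open>Cramer's rule: the vector \<open>r\<close> is orthogonal to the rows of the adjugate.\<close>

lemma fdet_replace_rows_eq_0:
  fixes F :: "nat \<Rightarrow> nat \<Rightarrow> 'a::idom"
  assumes "fdet n F \<noteq> 0" and "\<And>i. i < n \<Longrightarrow> fdet n (F(i := r)) = 0" and k: "k < n"
  shows "r k = 0"
proof -
  define A where "A = Matrix.mat n n (\<lambda>(a, b). F a b)"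
  have A: "A \<in> carrier_mat n n" by (simp add: A_def)
  have *: "(\<Sum>j<n. cofactor A i j * r j) = 0" if "i < n" for i
  proof -
    define B where "B = Matrix.mat n n (\<lambda>(a, b). (F(i := r)) a b)"
    have "mat_delete A i j = mat_delete B i j" for j
      unfolding mat_delete_def A_def B_def by (rule eq_matI) auto
    then have "cofactor A i j = cofactor B i j" for j
      unfolding cofactor_def by metis
    moreover have "fdet n (F(i := r)) = (\<Sum>j<n. B $$ (i, j) * cofactor B i j)"
      unfolding fdet_def B_def[symmetric] using that
      by (intro laplace_expansion_row) (auto simp: B_def)
    ultimately show ?thesis
      using assms(2)[OF that] that by (simp add: B_def mult.commute)
  qed
  have adj: "(\<Sum>i<n. cofactor A i j * F i k) = (if j = k then fdet n F else 0)" if "j < n" for j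
  proof -
    have "(adj_mat A * A) $$ (j, k) = (Determinant.det A \<cdot>\<^sub>m 1\<^sub>m n) $$ (j, k)" using adj_mat(3)[OF A] by simp
    then show ?thesis
      using that k by (simp add: adj_mat_def scalar_prod_def A_def fdet_def lessThan_atLeast0 if_distrib cong: if_cong)
  qed
  have "r k * fdet n F = (\<Sum>j<n. r j * (if j = k then fdet n F else 0))"
    using k by (simp add: if_distrib cong: if_cong)
  also have "\<dots> = (\<Sum>j<n. \<Sum>i<n. r j * (cofactor A i j * F i k))"
    using adj by (simp add: sum_distrib_left[symmetric])
  also have "\<dots> = (\<Sum>i<n. F i k * (\<Sum>j<n. cofactor A i j * r j))"
    by (subst sum.swap) (simp add: sum_distrib_left algebra_simps)
  also have "\<dots> = 0" using * by simp
  finally show ?thesis using assms(1) by simp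
qed

lemma fdet_proportional_rows:
  fixes F :: "nat \<Rightarrow> nat \<Rightarrow> 'a::comm_ring_1"
  assumes "i < n" "j < n" "i \<noteq> j" "\<And>b. b < n \<Longrightarrow> F i b = c * F j b"
  shows "fdet n F = 0"
proof -
  let ?F = "F(i := F j)"
  have "fdet n F = fdet n (\<lambda>a b. (if a = i then c else 1) * ?F a b)"
    by (rule fdet_cong) (use assms in auto)
  also have "\<dots> = (\<Prod>a<n. if a = i then c else 1) * fdet n ?F" by (rule fdet_scale_rows)
  also have "fdet n ?F = 0" unfolding fdet_def
    by (rule det_identical_rows[of _ n i j]) (use assms in \<open>auto simp: Matrix.row_def\<close>)
  finally show ?thesis by simp
qed

lemma tendsto_fdet:
  fixes F :: "'b \<Rightarrow> nat \<Rightarrow> nat \<Rightarrow> 'a::real_normed_field"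
  assumes "\<And>a b. a < n \<Longrightarrow> b < n \<Longrightarrow> ((\<lambda>x. F x a b) \<longlongrightarrow> G a b) L"
  shows "((\<lambda>x. fdet n (F x)) \<longlongrightarrow> fdet n G) L"
  unfolding fdet_leibniz
proof (intro tendsto_sum tendsto_mult tendsto_const tendsto_prod)
  fix \<sigma> a assume "\<sigma> \<in> {\<sigma>. \<sigma> permutes {..<n}}" "a \<in> {..<n}"
  then show "((\<lambda>x. F x a (\<sigma> a)) \<longlongrightarrow> G a (\<sigma> a)) L"
    using permutes_in_image[of \<sigma> "{..<n}" a] by (intro assms) auto
qed

lemma of_real_fdet: "fdet n (\<lambda>a b. of_real (F a b)) = of_real (fdet n F)"
  unfolding fdet_leibniz by (simp add: sign_def)

lemma borel_measurable_fdet: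
  fixes F :: "'b \<Rightarrow> nat \<Rightarrow> nat \<Rightarrow> complex"
  assumes "\<And>a b. a < n \<Longrightarrow> b < n \<Longrightarrow> (\<lambda>x. F x a b) \<in> borel_measurable M"
  shows "(\<lambda>x. fdet n (F x)) \<in> borel_measurable M"
  unfolding fdet_leibniz
proof (intro borel_measurable_sum borel_measurable_times borel_measurable_const borel_measurable_prod)
  fix \<sigma> a assume "\<sigma> \<in> {\<sigma>. \<sigma> permutes {..<n}}" "a \<in> {..<n}"
  then show "(\<lambda>x. F x a (\<sigma> a)) \<in> borel_measurable M"
    using permutes_in_image[of \<sigma> "{..<n}" a] by (intro assms) auto
qed

lemma fdet_left_inverse:
  fixes F :: "nat \<Rightarrow> nat \<Rightarrow> 'a::field"
  assumes "fdet n F \<noteq> 0"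
  obtains C where "\<And>a b. a < n \<Longrightarrow> b < n \<Longrightarrow> (\<Sum>k<n. C a k * F k b) = (if a = b then 1 else 0)"
proof -
  define A where "A = Matrix.mat n n (\<lambda>(a, b). F a b)"
  have A: "A \<in> carrier_mat n n" by (simp add: A_def)
  have det: "Determinant.det A = fdet n F" by (simp add: A_def fdet_def)
  have "(\<Sum>k<n. adj_mat A $$ (a, k) / fdet n F * F k b) = (if a = b then 1 else 0)"
    if "a < n" "b < n" for a b
  proof -
    have "(adj_mat A * A) $$ (a, b) = (Determinant.det A \<cdot>\<^sub>m 1\<^sub>m n) $$ (a, b)" using adj_mat(3)[OF A] by simp
    moreover have "(adj_mat A * A) $$ (a, b) = (\<Sum>k<n. adj_mat A $$ (a, k) * F k b)"
    proof -
      have "(adj_mat A * A) $$ (a, b) = (\<Sum>k\<in>{0..<n}. adj_mat A $$ (a, k) * A $$ (k, b))"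
        using that A adj_mat(1)[OF A] by (subst index_mult_mat) (auto simp: scalar_prod_def)
      also have "\<dots> = (\<Sum>k\<in>{0..<n}. adj_mat A $$ (a, k) * F k b)"
        by (intro sum.cong refl arg_cong2[where f = "(*)"]) (use that in \<open>auto simp: A_def\<close>)
      finally show ?thesis by (simp add: lessThan_atLeast0)
    qed
    ultimately have "(\<Sum>k<n. adj_mat A $$ (a, k) * F k b) = (if a = b then fdet n F else 0)"
      using that det by simp
    then show ?thesis using assms by (simp add: sum_divide_distrib[symmetric])
  qed
  then show ?thesis by (rule that)
qed

section \<open>Limits of coalescing arguments\<close>

lemma peano_remainder:
  fixes f :: "nat \<Rightarrow> real \<Rightarrow> real"
  assumes "n \<ge> 1"
    and "\<And>j s. Suc j < n \<Longrightarrow> (f j has_real_derivative f (Suc j) s) (at s)"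
    and "(f (n - 1) has_real_derivative f n x) (at x)"
  shows "((\<lambda>e. (f 0 (x + e) - (\<Sum>j\<le>n. f j x * e ^ j / fact j)) / e ^ n) \<longlongrightarrow> 0) (at_right 0)"
  using assms
proof (induction n arbitrary: f rule: nat_induct_at_least)
  case base
  have "((\<lambda>e. (f 0 (x + e) - f 0 x) / e) \<longlongrightarrow> f 1 x) (at 0)"
    using base by (simp add: DERIV_def)
  then have "((\<lambda>e. (f 0 (x + e) - f 0 x) / e - f 1 x) \<longlongrightarrow> f 1 x - f 1 x) (at 0)"
    by (intro tendsto_diff tendsto_const)
  then have "((\<lambda>e. (f 0 (x + e) - f 0 x) / e - f 1 x) \<longlongrightarrow> 0) (at_right 0)"
    by (simp add: filterlim_at_split)
  moreover have "\<forall>\<^sub>F e in at_right 0. (f 0 (x + e) - f 0 x) / e - f 1 x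
      = (f 0 (x + e) - (\<Sum>j\<le>1. f j x * e ^ j / fact j)) / e ^ 1"
    using eventually_at_right_less[of 0]
  proof eventually_elim
    case (elim e)
    have "(\<Sum>j\<le>1. f j x * e ^ j / fact j) = f 0 x + f 1 x * e"
      by simp
    then show ?case using elim by (simp add: field_simps)
  qed
  ultimately show ?case by (rule Lim_transform_eventually)
next
  case (Suc n)
  define R where "R e = f 0 (x + e) - (\<Sum>j\<le>Suc n. f j x * e ^ j / fact j)" for e
  define R' where "R' e = f 1 (x + e) - (\<Sum>j\<le>n. f (Suc j) x * e ^ j / fact j)" for e
  have "((\<lambda>e. R' e / e ^ n) \<longlongrightarrow> 0) (at_right 0)"
    unfolding R'_def using Suc.IH[of "\<lambda>j. f (Suc j)"] Suc.prems Suc.hyps by simp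
  have der: "(R has_real_derivative R' e) (at e)" for e
  proof -
    have "((\<lambda>e. f 0 (x + e)) has_real_derivative f 1 (x + e)) (at e)"
      using Suc.prems(1)[of 0 "x + e"] Suc.hyps DERIV_shift[of "f 0" "f 1 (x + e)" e x] by (simp add: add.commute)
    moreover have "((\<lambda>e. \<Sum>j\<le>Suc n. f j x * e ^ j / fact j) has_real_derivative (\<Sum>j\<le>n. f (Suc j) x * e ^ j / fact j)) (at e)"
    proof -
      have "((\<lambda>e. f (Suc j) x * e ^ Suc j / fact (Suc j)) has_real_derivative f (Suc j) x * e ^ j / fact j) (at e)" for j
        by (rule derivative_eq_intros refl | simp add: field_simps del: of_nat_Suc)+
      then show ?thesis
        unfolding sum.atMost_Suc_shift[of "\<lambda>j. f j x * _ ^ j / fact j"]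
        by (intro DERIV_add[where D = 0, simplified] DERIV_sum) auto
    qed
    ultimately show ?thesis unfolding R_def R'_def by (intro DERIV_diff)
  qed
  have R0: "R 0 = 0" unfolding R_def by (subst sum.atMost_Suc_shift) simp
  show ?case unfolding R_def[symmetric]
  proof (rule tendstoI)
    fix \<epsilon> :: real assume "\<epsilon> > 0"
    with \<open>((\<lambda>e. R' e / e ^ n) \<longlongrightarrow> 0) (at_right 0)\<close>
    have "\<forall>\<^sub>F e in at_right 0. \<bar>R' e / e ^ n\<bar> < \<epsilon>" by (auto dest: tendstoD)
    then obtain d where d: "d > 0" "\<And>e. 0 < e \<Longrightarrow> e < d \<Longrightarrow> \<bar>R' e / e ^ n\<bar> < \<epsilon>"
      by (auto simp: eventually_at_right_field)
    have "\<bar>R e / e ^ Suc n\<bar> < \<epsilon>" if e: "0 < e" "e < d" for e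
    proof -
      obtain z where z: "0 < z" "z < e" "R e - R 0 = (e - 0) * R' z"
        using MVT2[of 0 e R R'] e der by auto
      have "\<bar>R e / e ^ Suc n\<bar> = \<bar>R' z\<bar> / e ^ n" using z e R0 by (simp add: abs_mult)
      also have "\<dots> \<le> \<bar>R' z\<bar> / z ^ n" using z e by (intro divide_left_mono power_mono mult_pos_pos) auto
      also have "\<dots> < \<epsilon>" using d(2)[of z] z e by (simp add: abs_divide)
      finally show ?thesis .
    qed
    then show "\<forall>\<^sub>F e in at_right 0. dist (R e / e ^ Suc n) 0 < \<epsilon>"
      using d(1) by (auto simp: eventually_at_right_field)
  qed
qed

text \<open>The matrix of samples factors as (Taylor coefficients plus an error vanishing in the limit)
  times a matrix of positive determinant.\<close>

lemma coalescence:
  fixes f :: "nat \<Rightarrow> nat \<Rightarrow> real \<Rightarrow> real"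
  assumes "\<And>a j s. a \<le> n \<Longrightarrow> Suc j < n \<Longrightarrow> (f a j has_real_derivative f a (Suc j) s) (at s)"
    and "\<And>a. a \<le> n \<Longrightarrow> (f a (n - 1) has_real_derivative f a n 0) (at 0)" and n: "n \<ge> 1"
    and ev: "\<forall>\<^sub>F e in at_right 0. s * fdet (Suc n) (\<lambda>a b. f a 0 (real b * e)) \<ge> 0"
  shows "s * fdet (Suc n) (\<lambda>a j. f a j 0) \<ge> 0"
proof -
  define P where "P j b = real b ^ j / fact j" for j b
  have "fdet (Suc n) P = (\<Prod>j<Suc n. 1 / fact j) * fdet (Suc n) (\<lambda>j b. real b ^ j)"
    unfolding P_def by (subst fdet_scale_rows[symmetric]) simp
  also have "fdet (Suc n) (\<lambda>j b. real b ^ j) = (\<Prod>b<Suc n. \<Prod>a<b. real b - real a)"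
    by (subst fdet_transpose) (rule fdet_vandermonde)
  finally have "fdet (Suc n) P = (\<Prod>j<Suc n. 1 / fact j) * (\<Prod>b<Suc n. \<Prod>a<b. real b - real a)" .
  also have "\<dots> > 0" by (intro mult_pos_pos prod_pos) auto
  finally have Ppos: "fdet (Suc n) P > 0" .
  then obtain C where C: "\<And>a b. a < Suc n \<Longrightarrow> b < Suc n \<Longrightarrow> (\<Sum>k<Suc n. C a k * P k b) = (if a = b then 1 else 0)"
    using fdet_left_inverse[of "Suc n" P] by (metis less_irrefl)
  define R where "R a e = f a 0 e - (\<Sum>j\<le>n. f a j 0 * e ^ j / fact j)" for a e
  have R: "((\<lambda>e. R a e / e ^ n) \<longlongrightarrow> 0) (at_right 0)" if "a \<le> n" for a
    unfolding R_def using peano_remainder[of n "f a" 0] assms that by simp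
  \<comment> \<open>Taylor coefficients corrected so that the factorisation is exact:
    \<open>C\<close> inverts \<open>P\<close>, hence the remainders at the sample points are
    combinations of the rows of \<open>P\<close>. Dividing by \<open>e ^ j\<close> is harmless
    because the remainders are of smaller order than \<open>e ^ n\<close> and
    \<open>j \<le> n\<close>.\<close>
  define T where "T e a j = f a j 0 + (\<Sum>b<Suc n. C b j * (R a (real b * e) / e ^ j))" for e a j
  have Rb: "((\<lambda>e. R a (real b * e) / e ^ j) \<longlongrightarrow> 0) (at_right 0)" if "a \<le> n" "j \<le> n" for a b j
  proof (cases "b = 0")
    case True
    have "R a 0 = 0" unfolding R_def by (subst sum.atMost_shift) simp
    then show ?thesis using True by simp
  next
    case False
    have "filterlim (\<lambda>e. real b * e) (at_right 0) (at_right 0)"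
      using False by (intro filterlim_times_pos[of _ 0]) (auto simp: filterlim_ident)
    from filterlim_compose[OF R[OF \<open>a \<le> n\<close>] this]
    have "((\<lambda>e. R a (real b * e) / (real b * e) ^ n * (real b ^ n * e ^ (n - j))) \<longlongrightarrow> 0 * (real b ^ n * 0 ^ (n - j))) (at_right 0)"
      by (intro tendsto_intros) auto
    moreover have "\<forall>\<^sub>F e in at_right 0. R a (real b * e) / (real b * e) ^ n * (real b ^ n * e ^ (n - j)) = R a (real b * e) / e ^ j"
      using eventually_at_right_less[of 0]
    proof eventually_elim
      case (elim e)
      have "e ^ n = e ^ j * e ^ (n - j)" using that by (simp add: power_add[symmetric])
      then show ?case using elim False by (simp add: power_mult_distrib)
    qed
    ultimately show ?thesis by (simp add: Lim_transform_eventually)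
  qed
  have "((\<lambda>e. T e a j) \<longlongrightarrow> f a j 0 + (\<Sum>b<Suc n. C b j * 0)) (at_right 0)" if "a \<le> n" "j \<le> n" for a j
    unfolding T_def by (intro tendsto_intros Rb that)
  then have "((\<lambda>e. s * fdet (Suc n) (T e)) \<longlongrightarrow> s * fdet (Suc n) (\<lambda>a j. f a j 0)) (at_right 0)"
    by (intro tendsto_mult tendsto_const tendsto_fdet) auto
  moreover have "\<forall>\<^sub>F e in at_right 0. 0 \<le> s * fdet (Suc n) (T e)"
    using ev eventually_at_right_less[of 0]
  proof eventually_elim
    case (elim e)
    have "f a 0 (real b * e) = (\<Sum>j<Suc n. T e a j * (e ^ j * P j b))" if "a < Suc n" "b < Suc n" for a b
    proof -
      have "(\<Sum>j<Suc n. T e a j * (e ^ j * P j b)) =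
        (\<Sum>j<Suc n. f a j 0 * (real b * e) ^ j / fact j) + (\<Sum>j<Suc n. \<Sum>b'<Suc n. R a (real b' * e) * (C b' j * P j b))"
      proof -
        have "(\<Sum>b'<Suc n. C b' j * (R a (real b' * e) / e ^ j)) * (e ^ j * P j b) = (\<Sum>b'<Suc n. R a (real b' * e) * (C b' j * P j b))" for j
          unfolding sum_distrib_right using elim by (intro sum.cong refl) simp
        then show ?thesis
          unfolding T_def sum.distrib[symmetric] distrib_right
          by (intro sum.cong refl) (simp add: P_def power_mult_distrib del: sum.lessThan_Suc)
      qed
      also have "(\<Sum>j<Suc n. \<Sum>b'<Suc n. R a (real b' * e) * (C b' j * P j b)) = (\<Sum>b'<Suc n. R a (real b' * e) * (\<Sum>j<Suc n. C b' j * P j b))"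
        by (subst sum.swap) (simp add: sum_distrib_left del: sum.lessThan_Suc)
      also have "\<dots> = (\<Sum>b'<Suc n. if b' = b then R a (real b * e) else 0)"
        by (intro sum.cong refl) (use C that in \<open>simp del: sum.lessThan_Suc\<close>)
      also have "\<dots> = R a (real b * e)" using that by (simp del: sum.lessThan_Suc)
      finally show ?thesis by (simp add: R_def lessThan_Suc_atMost)
    qed
    then have "fdet (Suc n) (\<lambda>a b. f a 0 (real b * e)) = fdet (Suc n) (\<lambda>a b. \<Sum>j<Suc n. T e a j * (e ^ j * P j b))"
      by (rule fdet_cong)
    also have "\<dots> = fdet (Suc n) (T e) * ((\<Prod>j<Suc n. e ^ j) * fdet (Suc n) P)"
      by (simp only: fdet_mult fdet_scale_rows)
    finally have eq: "s * fdet (Suc n) (\<lambda>a b. f a 0 (real b * e)) = s * fdet (Suc n) (T e) * ((\<Prod>j<Suc n. e ^ j) * fdet (Suc n) P)" by simp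
    have "(\<Prod>j<Suc n. e ^ j) * fdet (Suc n) P > 0" using elim Ppos by (intro mult_pos_pos prod_pos) auto
    then show ?case using elim(1) unfolding eq by (intro mult_right_le_imp_le[of 0 "(\<Prod>j<Suc n. e ^ j) * fdet (Suc n) P"]) (simp_all only: mult_zero_left)
  qed
  ultimately show ?thesis by (intro tendsto_lowerbound) auto
qed

text \<open>Lebesgue's inequality for monotone functions: Fatou's lemma applied to forward
  difference quotients. The defect between the two sides is the mass of the singular part.\<close>

lemma integral_deriv_le_monotone:
  fixes E e :: "real \<Rightarrow> real"
  assumes ab: "a \<le> b" and cont: "continuous_on {a..b} E"
    and mono: "\<And>x y. a \<le> x \<Longrightarrow> x \<le> y \<Longrightarrow> y \<le> b \<Longrightarrow> E x \<le> E y"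
    and der: "AE x in lborel. a < x \<and> x < b \<longrightarrow> (E has_real_derivative e x) (at x)"
    and int: "e integrable_on {a..b}"
  shows "integral {a..b} e \<le> E b - E a"
proof -
  \<comment> \<open>Constant continuation of \<open>E\<close> beyond the interval, so that forward
    difference quotients are defined and nonnegative everywhere and the values stay between
    \<open>E a\<close> and \<open>E b\<close>.\<close>
  define F where "F x = E (max a (min x b))" for x
  have Fcont: "continuous_on UNIV F" unfolding F_def
    by (intro continuous_on_compose2[OF cont] continuous_intros) (use ab in auto)
  have Fmono: "F x \<le> F y" if "x \<le> y" for x y unfolding F_def using that ab by (intro mono) auto
  have Fb: "E a \<le> F x" "F x \<le> E b" for x unfolding F_def using ab by (auto intro!: mono)
  \<comment> \<open>With an antiderivative of \<open>F\<close>, the integral of a difference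
    quotient is a difference of two averages of \<open>F\<close> over intervals of length
    \<open>1 / Suc n\<close>, one starting at \<open>b\<close> and one at \<open>a\<close>.\<close>
  have "\<exists>G. \<forall>x. - \<infinity> < ereal x \<longrightarrow> ereal x < \<infinity> \<longrightarrow> (G has_vector_derivative F x) (at x)"
    using Fcont by (intro einterval_antiderivative) (auto simp: continuous_on_eq_continuous_at)
  then obtain G where G: "\<And>x. (G has_real_derivative F x) (at x)"
    by (auto simp: has_real_derivative_iff_has_vector_derivative)
  define D where "D n x = real (Suc n) * (F (x + 1 / real (Suc n)) - F x)" for n x
  have D0: "D n x \<ge> 0" for n x unfolding D_def by (intro mult_nonneg_nonneg) (auto intro!: Fmono)
  have Fm: "F \<in> borel_measurable borel" by (rule borel_measurable_continuous_onI[OF Fcont])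
  have Dm: "D n \<in> borel_measurable borel" for n unfolding D_def using Fm by measurable
  have D: "(\<integral>\<^sup>+x. ennreal (D n x) * indicator {a..b} x \<partial>lborel) \<le> ennreal (E b - E a)" for n
  proof -
    define h where "h = 1 / real (Suc n)"
    have h: "h > 0" by (simp add: h_def)
    define K where "K x = real (Suc n) * (G (x + h) - G x)" for x
    have "((\<lambda>x. G (x + h)) has_real_derivative F (x + h)) (at x)" for x
      using G[of "x + h"] by (simp add: DERIV_shift)
    then have "(K has_real_derivative D n x) (at x)" for x
      unfolding K_def D_def h_def[symmetric] using G by (intro DERIV_cmult DERIV_diff)
    then have "(D n has_integral (K b - K a)) {a..b}"
      using ab by (intro fundamental_theorem_of_calculus)
        (auto simp: has_real_derivative_iff_has_vector_derivative[symmetric] intro: has_field_derivative_at_within)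
    then have "(\<integral>\<^sup>+x. ennreal (D n x) * indicator {a..b} x \<partial>lborel) = ennreal (K b - K a)"
      by (intro nn_integral_has_integral_lebesgue') (auto simp: D0)
    moreover have "K b \<le> E b"
    proof -
      obtain z where "G (b + h) - G b = (b + h - b) * F z" using MVT2[of b "b + h" G F] G h by auto
      then have "K b = F z" by (simp add: K_def h_def)
      then show ?thesis using Fb by simp
    qed
    moreover have "E a \<le> K a"
    proof -
      obtain z where "G (a + h) - G a = (a + h - a) * F z" using MVT2[of a "a + h" G F] G h by auto
      then have "K a = F z" by (simp add: K_def h_def)
      then show ?thesis using Fb by simp
    qed
    ultimately show ?thesis by (auto intro: ennreal_leI)
  qed
  have lim: "AE x in lborel. a < x \<and> x < b \<longrightarrow> (\<lambda>n. D n x) \<longlonglongrightarrow> e x"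
    using der
  proof eventually_elim
    case (elim x)
    show ?case
    proof
      assume x: "a < x \<and> x < b"
      have "(F has_real_derivative e x) (at x)"
      proof (rule has_field_derivative_transform_within_open[of E _ _ "{a<..<b}"])
        show "(E has_real_derivative e x) (at x)" using elim x by blast
      qed (use x in \<open>auto simp: F_def\<close>)
      then have "((\<lambda>h. (F (x + h) - F x) / h) \<longlongrightarrow> e x) (at 0)" by (simp add: DERIV_def)
      moreover have "filterlim (\<lambda>n. 1 / real (Suc n)) (at 0) sequentially"
        using LIMSEQ_Suc[OF lim_1_over_n] by (auto simp: filterlim_at)
      ultimately have "(\<lambda>n. (F (x + 1 / real (Suc n)) - F x) / (1 / real (Suc n))) \<longlonglongrightarrow> e x"
        by (rule filterlim_compose)
      then show "(\<lambda>n. D n x) \<longlonglongrightarrow> e x" by (simp add: D_def mult.commute)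
    qed
  qed
  \<comment> \<open>The limit of the nonnegative quotients equals \<open>e\<close> only almost
    everywhere; truncating at 0 allows nonnegative integrals without changing the integral of
    \<open>e\<close>.\<close>
  define e' where "e' x = max 0 (e x)" for x
  have ne: "AE x in lborel. x \<noteq> a \<and> x \<noteq> b"
    using AE_lborel_singleton[of a] AE_lborel_singleton[of b] by eventually_elim auto
  have e0: "AE x in lborel. x \<in> {a..b} \<longrightarrow> e' x = e x"
    using lim ne
  proof eventually_elim
    case (elim x)
    have "0 \<le> e x" if "x \<in> {a..b}"
      by (rule LIMSEQ_le_const[of "\<lambda>n. D n x"]) (use elim that D0 in auto)
    then show ?case by (simp add: e'_def)
  qed
  have "(e' has_integral (integral {a..b} e)) {a..b}"
    using has_integral_AE[OF e0] integrable_integral[OF int] by blast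
  then have "ennreal (integral {a..b} e) = (\<integral>\<^sup>+x. ennreal (e' x) * indicator {a..b} x \<partial>lborel)"
    by (intro nn_integral_has_integral_lebesgue'[symmetric]) (simp add: e'_def)
  also have "\<dots> \<le> (\<integral>\<^sup>+x. liminf (\<lambda>n. ennreal (D n x) * indicator {a..b} x) \<partial>lborel)"
  proof (rule nn_integral_mono_AE)
    show "AE x in lborel. ennreal (e' x) * indicator {a..b} x \<le> liminf (\<lambda>n. ennreal (D n x) * indicator {a..b} x)"
      using lim ne e0
    proof eventually_elim
      case (elim x)
      show ?case
      proof (cases "x \<in> {a..b}")
        case True
        then have "(\<lambda>n. ennreal (D n x)) \<longlonglongrightarrow> ennreal (e' x)" using elim by (intro tendsto_ennrealI) auto
        then show ?thesis using True by (simp add: lim_imp_Liminf)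
      qed auto
    qed
  qed
  also have "\<dots> \<le> liminf (\<lambda>n. \<integral>\<^sup>+x. ennreal (D n x) * indicator {a..b} x \<partial>lborel)"
    using Dm by (intro nn_integral_liminf borel_measurable_times_ennreal borel_measurable_indicator) auto
  also have "\<dots> \<le> ennreal (E b - E a)"
    by (rule order_trans[OF Liminf_le_Limsup Limsup_bounded]) (auto intro!: always_eventually D)
  finally show ?thesis using mono[of a b] ab by (simp add: ennreal_le_iff)
qed

section \<open>Absolute continuity of the penultimate derivative\<close>

text \<open>The Vandermonde determinant of the points \<open>cis (x a)\<close> without its phase and
  its powers of \<open>2 * \<i>\<close>; see \<open>vandermonde_cis\<close>.\<close>

definition sine_vandermonde :: "nat \<Rightarrow> (nat \<Rightarrow> real) \<Rightarrow> real" where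
  "sine_vandermonde n x = (\<Prod>b<n. \<Prod>a<b. sin ((x b - x a) / 2))"

lemma sine_vandermonde_Suc_case_nat:
  "sine_vandermonde (Suc n) (case_nat t x) = (\<Prod>b<n. sin ((x b - t) / 2)) * sine_vandermonde n x"
  unfolding sine_vandermonde_def prod.lessThan_Suc_shift by (simp add: prod.distrib)

lemma sine_vandermonde_equispaced_pos:
  assumes "0 < e" "real n * e < 2 * pi"
  shows "sine_vandermonde n (\<lambda>b. real b * e) > 0"
  unfolding sine_vandermonde_def
proof (intro prod_pos sin_gt_zero)
  fix b a assume ab: "b \<in> {..<n}" "a \<in> {..<b}"
  then show "0 < (real b * e - real a * e) / 2" using assms by simp
  have "real b * e \<le> real n * e" "0 \<le> real a * e" using ab assms by (auto intro!: mult_right_mono)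
  then show "(real b * e - real a * e) / 2 < pi" using assms(2) by argo
qed

section \<open>Zeros of sine factors, constancy of sign and local constancy\<close>

lemma AE_lborel_open_empty:
  fixes S :: "'a::euclidean_space set"
  assumes "open S" "AE x in lborel. x \<notin> S"
  shows "S = {}"
proof (rule ccontr)
  assume "S \<noteq> {}"
  then have "\<not> negligible S" using open_not_negligible assms by blast
  moreover have "S \<in> null_sets lborel" using assms by (subst AE_iff_null_sets) auto
  ultimately show False by (simp add: negligible_iff_null_sets null_sets_completionI)
qed

lemma finite_zeros_sin_shift: "finite {t \<in> {p..q::real}. sin ((c - t) / 2) = 0}"
proof -
  have "{t \<in> {p..q}. sin ((c - t) / 2) = 0} \<subseteq> (\<lambda>k::int. c - 2 * pi * k) ` {\<lfloor>(c - q) / (2 * pi)\<rfloor>..\<lceil>(c - p) / (2 * pi)\<rceil>}"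
  proof safe
    fix t assume t: "t \<in> {p..q}" "sin ((c - t) / 2) = 0"
    then obtain k :: int where k: "(c - t) / 2 = k * pi" by (auto simp: sin_zero_iff_int2)
    then have tk: "t = c - 2 * pi * k" by (simp add: field_simps)
    have "k = (c - t) / (2 * pi)" by (simp add: tk)
    then have "(c - q) / (2 * pi) \<le> k" "k \<le> (c - p) / (2 * pi)" using t by (auto intro!: divide_right_mono)
    then have "k \<in> {\<lfloor>(c - q) / (2 * pi)\<rfloor>..\<lceil>(c - p) / (2 * pi)\<rceil>}" by (auto simp: floor_le_iff le_ceiling_iff)
    then show "t \<in> (\<lambda>k::int. c - 2 * pi * k) ` {\<lfloor>(c - q) / (2 * pi)\<rfloor>..\<lceil>(c - p) / (2 * pi)\<rceil>}"
      using tk by blast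
  qed
  then show ?thesis by (rule finite_subset) simp
qed

lemma continuous_nonvanishing_same_sign:
  fixes f :: "real \<Rightarrow> real"
  assumes "continuous_on {a..b} f" "\<And>t. t \<in> {a..b} \<Longrightarrow> f t \<noteq> 0" "t \<in> {a..b}" "a \<le> b"
  shows "f a * f t > 0"
proof (rule ccontr)
  assume "\<not> f a * f t > 0"
  moreover have "f a \<noteq> 0" "f t \<noteq> 0" using assms by auto
  ultimately have "f a < 0 \<and> 0 < f t \<or> f t < 0 \<and> 0 < f a" by (auto simp: zero_less_mult_iff not_less)
  moreover have "continuous_on {a..t} f" using assms by (auto intro: continuous_on_subset)
  ultimately have "\<exists>z\<in>{a..t}. f z = 0"
    using IVT'[of f a 0 t] IVT2'[of f t 0 a] assms(3) by (auto simp: Bex_def)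
  then show False using assms(2,3) by auto
qed

text \<open>Otherwise \<open>f\<close> is locally constant off the finite set, and the fundamental
  theorem of calculus with finitely many exceptions makes its total increment vanish. It places the
  singular part on an interval on which the relevant sine factors have no zeros.\<close>

lemma exists_nonconstant_interval_avoiding_finite:
  fixes f :: "real \<Rightarrow> real"
  assumes "finite X" "p \<le> q" "continuous_on {p..q} f" "f p \<noteq> f q"
  obtains a b where "p < a" "a < b" "b < q" "{a..b} \<inter> X = {}" "f a \<noteq> f b"
proof (rule ccontr)
  assume contra: "\<not> thesis"
  note witness = that
  have const: "f a = f b" if "p < a" "a < b" "b < q" "{a..b} \<inter> X = {}" for a b
    using that contra witness by blast
  have "((\<lambda>_. 0) has_integral (f q - f p)) {p..q}"
  proof (rule fundamental_theorem_of_calculus_interior_strong[OF assms(1,2) _ assms(3)])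
    fix t assume t: "t \<in> {p<..<q} - X"
    have "open ({p<..<q} - X)" using assms(1) by (intro open_Diff finite_imp_closed) auto
    then obtain e where e: "e > 0" "ball t e \<subseteq> {p<..<q} - X" using t by (meson openE)
    have eq: "f s = f t" if "s \<in> ball t e" for s
    proof -
      have sub: "{min s t..max s t} \<subseteq> ball t e" using that by (auto simp: dist_real_def min_def max_def split: if_splits)
      then have sub': "{min s t..max s t} \<subseteq> {p<..<q} - X" using e(2) by blast
      then have "min s t \<in> {p<..<q} - X" "max s t \<in> {p<..<q} - X"
        by (rule subsetD; simp)+
      moreover have "{min s t..max s t} \<inter> X = {}" using sub' by blast
      ultimately show ?thesis
        using const[of "min s t" "max s t"] by (cases s t rule: linorder_cases) (auto simp: min_def max_def)
    qed
    have "(f has_real_derivative 0) (at t)"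
      by (rule has_field_derivative_transform_within_open[of "\<lambda>_. f t" 0 t "ball t e"])
        (use e(1) in \<open>auto intro: eq[symmetric]\<close>)
    then show "(f has_vector_derivative 0) (at t)" by (simp add: has_real_derivative_iff_has_vector_derivative)
  qed
  then show False using assms(4) has_integral_0 has_integral_unique by force
qed

text \<open>\<open>m + 2\<close> is the size of the determinants, so \<open>h m\<close> is the last
  continuous member of the chain and \<open>h (Suc m)\<close> its derivative almost everywhere. Sums
  \<open>\<alpha> a + \<tau> b\<close> replace quotients on the circle, and \<open>sg\<close> is a
  constant of fixed sign from the powers of \<open>\<i>\<close>. The antiperiodicity in
  \<open>period\<close> has the sign \<open>(-1) ^ (N - 1)\<close>.\<close>

locale polya_chain =
  fixes m :: nat and h :: "nat \<Rightarrow> real \<Rightarrow> real" and sg :: real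
  assumes deriv: "j < m \<Longrightarrow> (h j has_real_derivative h (Suc j) t) (at t)"
    and cont: "continuous_on UNIV (h m)"
    and diff_AE: "AE t in lborel. t \<in> {0..2 * pi} \<longrightarrow> (h m has_real_derivative h (Suc m) t) (at t)"
    and period: "j \<le> m \<Longrightarrow> h j (t + 2 * pi) = (-1) ^ Suc m * h j t"
    and int: "h (Suc m) integrable_on {0..2 * pi}"
    and sg: "sg \<noteq> 0"
    and pf: "sg * sine_vandermonde (m + 2) \<alpha> * sine_vandermonde (m + 2) \<tau> * fdet (m + 2) (\<lambda>a b. h 0 (\<alpha> a + \<tau> b)) \<ge> 0"
begin

definition Diff :: "real set" where
  "Diff = {t. (h m has_real_derivative h (Suc m) t) (at t)}"

lemma h_cont: "j \<le> m \<Longrightarrow> continuous_on UNIV (h j)"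
  using deriv[of j] cont by (cases "j = m") (auto intro!: continuous_at_imp_continuous_on DERIV_isCont)

lemma eventually_sine_vandermonde_pos: "\<forall>\<^sub>F e in at_right 0. sine_vandermonde n (\<lambda>b. real b * e) > 0"
proof -
  have "((\<lambda>e. real n * e) \<longlongrightarrow> real n * 0) (at_right 0)" by (intro tendsto_intros)
  then have "\<forall>\<^sub>F e in at_right 0. real n * e < 2 * pi" by (rule order_tendstoD) simp
  with eventually_at_right_less[of 0] show ?thesis
    by eventually_elim (rule sine_vandermonde_equispaced_pos)
qed

lemma density_nonneg:
  assumes "\<And>a. a < m + 2 \<Longrightarrow> x a \<in> Diff"
  shows "sg * sine_vandermonde (m + 2) x * fdet (m + 2) (\<lambda>a j. h j (x a)) \<ge> 0"
proof -
  have shift: "(h j has_real_derivative c) (at (t + s)) \<Longrightarrow> ((\<lambda>e. h j (t + e)) has_real_derivative c) (at s)" for j c t s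
    using DERIV_shift[of "h j" c s t] by (simp add: add.commute)
  have "sg * sine_vandermonde (m + 2) x * fdet (Suc (Suc m)) (\<lambda>a j. h j (x a + 0)) \<ge> 0"
  proof (rule coalescence[where f = "\<lambda>a j e. h j (x a + e)" and n = "Suc m"])
    show "((\<lambda>e. h j (x a + e)) has_real_derivative h (Suc j) (x a + s)) (at s)"
      if "a \<le> Suc m" "Suc j < Suc m" for a j s
      using that by (intro shift deriv) auto
    show "((\<lambda>e. h (Suc m - 1) (x a + e)) has_real_derivative h (Suc m) (x a + 0)) (at 0)" if "a \<le> Suc m" for a
      using assms[of a] that by (intro shift) (auto simp: Diff_def)
    show "\<forall>\<^sub>F e in at_right 0. sg * sine_vandermonde (m + 2) x * fdet (Suc (Suc m)) (\<lambda>a b. h 0 (x a + real b * e)) \<ge> 0"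
      using eventually_sine_vandermonde_pos[of "m + 2"]
    proof eventually_elim
      case (elim e)
      have "0 \<le> (sg * sine_vandermonde (m + 2) x * fdet (m + 2) (\<lambda>a b. h 0 (x a + real b * e))) * sine_vandermonde (m + 2) (\<lambda>b. real b * e)"
        using pf[of x "\<lambda>b. real b * e"] by (simp add: mult_ac)
      with elim show ?case by (simp add: zero_le_mult_iff)
    qed
  qed simp
  then show ?thesis by simp
qed

text \<open>Integrating the determinant inequality over its first argument puts antiderivatives into
  the first row; the sign stays fixed as long as that argument does not change the sign of the sine
  Vandermonde determinant. As \<open>U\<close> has one derivative more than \<open>h\<close>,
  coalescence applies to this row for arbitrary \<open>u\<close> and \<open>v\<close>, also where
  \<open>h m\<close> is not differentiable.\<close>

lemma first_row_increment_nonneg: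
  assumes U: "\<And>j t. j \<le> m \<Longrightarrow> (U j has_real_derivative U (Suc j) t) (at t)" "\<And>j. U (Suc j) = h j"
    and x: "\<And>a. a \<le> m \<Longrightarrow> x a \<in> Diff"
    and uv: "u \<le> v" and s: "\<And>t. t \<in> {u..v} \<Longrightarrow> s * sine_vandermonde (m + 2) (case_nat t x) > 0"
  shows "s * sg * fdet (m + 2) ((\<lambda>a j. h j (x (a - 1)))(0 := \<lambda>j. U j v - U j u)) \<ge> 0"
proof -
  have shift: "(h j has_real_derivative c) (at (t + s)) \<Longrightarrow> ((\<lambda>e. h j (t + e)) has_real_derivative c) (at s)" for j c t s
    using DERIV_shift[of "h j" c s t] by (simp add: add.commute)
  have shiftU: "j \<le> m \<Longrightarrow> ((\<lambda>e. U j (t + e)) has_real_derivative U (Suc j) (t + s)) (at s)" for j t s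
    using DERIV_shift[of "U j" "U (Suc j) (t + s)" s t] U(1)[of j "t + s"] by (simp add: add.commute)
  define f where "f a j e = (if a = 0 then U j (v + e) - U j (u + e) else h j (x (a - 1) + e))" for a j e
  have f0: "f 0 = (\<lambda>j e. U j (v + e) - U j (u + e))" by (intro ext) (simp add: f_def)
  have f1: "f (Suc a) = (\<lambda>j e. h j (x a + e))" for a by (intro ext) (simp add: f_def)
  have "s * sg * fdet (Suc (Suc m)) (\<lambda>a j. f a j 0) \<ge> 0"
  proof (rule coalescence[where f = f and n = "Suc m"])
    show "(f a j has_real_derivative f a (Suc j) s) (at s)" if "a \<le> Suc m" "Suc j < Suc m" for a j s
      using that by (cases a) (auto simp: f0 f1 intro!: DERIV_diff shiftU shift deriv)
    show "(f a (Suc m - 1) has_real_derivative f a (Suc m) 0) (at 0)" if "a \<le> Suc m" for a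
      using that x shiftU[of m _ 0] by (cases a) (auto simp: f0 f1 Diff_def intro!: DERIV_diff shift)
    show "\<forall>\<^sub>F e in at_right 0. 0 \<le> s * sg * fdet (Suc (Suc m)) (\<lambda>a b. f a 0 (real b * e))"
      using eventually_sine_vandermonde_pos[of "m + 2"]
    proof eventually_elim
      case (elim e)
      define G where "G a b = h 0 (x (a - 1) + real b * e)" for a b :: nat
      obtain c where c: "\<And>r. fdet (m + 2) (G(0 := r)) = (\<Sum>j<m + 2. r j * c j)"
        using fdet_row_expansion[of 0 "m + 2" G] by auto
      \<comment> \<open>The determinant before coalescence as a function of the end point of the
        first row. Its derivative is the kernel determinant with first argument \<open>t\<close>,
        whose sign is known.\<close>
      define \<phi> where "\<phi> t = s * sg * (\<Sum>b<m + 2. U 0 (t + real b * e) * c b)" for t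
      have \<phi>1: "(\<phi> has_real_derivative s * sg * (\<Sum>b<m + 2. h 0 (t + real b * e) * c b)) (at t)" for t
        unfolding \<phi>_def
      proof (intro DERIV_cmult DERIV_sum DERIV_cmult_right)
        fix b show "((\<lambda>t. U 0 (t + real b * e)) has_real_derivative h 0 (t + real b * e)) (at t)"
          using shiftU[of 0 "real b * e" t] U(2)[of 0] by (simp add: add.commute)
      qed
      have \<phi>2: "s * sg * (\<Sum>b<m + 2. h 0 (t + real b * e) * c b) \<ge> 0" if t: "u \<le> t" "t \<le> v" for t
      proof -
        let ?V = "sine_vandermonde (m + 2) (case_nat t x)" and ?V' = "sine_vandermonde (m + 2) (\<lambda>b. real b * e)"
        let ?D = "fdet (m + 2) (\<lambda>a b. h 0 (case_nat t x a + real b * e))"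
        have "(\<Sum>b<m + 2. h 0 (t + real b * e) * c b) = fdet (m + 2) (G(0 := \<lambda>b. h 0 (t + real b * e)))"
          by (rule c[symmetric])
        also have "\<dots> = ?D" by (rule fdet_cong) (auto simp: G_def split: nat.split)
        finally have D: "(\<Sum>b<m + 2. h 0 (t + real b * e) * c b) = ?D" .
        have V: "s * ?V > 0" using s t by auto
        then have V2: "?V\<^sup>2 * ?V' > 0" using elim by (intro mult_pos_pos) (auto simp: zero_less_power2)
        have "0 \<le> (s * ?V) * (sg * ?V * ?V' * ?D)" by (rule mult_nonneg_nonneg[OF less_imp_le[OF V] pf])
        also have "\<dots> = (s * sg * ?D) * (?V\<^sup>2 * ?V')" by (simp add: power2_eq_square)
        finally have "0 \<le> s * sg * ?D" using V2 by (intro mult_right_le_imp_le[of 0 "?V\<^sup>2 * ?V'"]) (simp_all only: mult_zero_left)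
        then show ?thesis by (simp only: D)
      qed
      have "\<phi> u \<le> \<phi> v"
        by (rule DERIV_nonneg_imp_nondecreasing[OF uv]) (intro exI conjI, rule \<phi>1, rule \<phi>2)
      moreover have "s * sg * fdet (Suc (Suc m)) (\<lambda>a b. f a 0 (real b * e)) = \<phi> v - \<phi> u"
      proof -
        have "fdet (Suc (Suc m)) (\<lambda>a b. f a 0 (real b * e)) = fdet (m + 2) (G(0 := \<lambda>b. U 0 (v + real b * e) - U 0 (u + real b * e)))"
          by (simp, rule fdet_cong) (auto simp: f_def G_def)
        then show ?thesis unfolding c \<phi>_def by (simp only: left_diff_distrib sum_subtractf right_diff_distrib)
      qed
      ultimately show ?case by linarith
    qed
  qed simp
  moreover have "fdet (Suc (Suc m)) (\<lambda>a j. f a j 0) = fdet (m + 2) ((\<lambda>a j. h j (x (a - 1)))(0 := \<lambda>j. U j v - U j u))"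
    by (simp, rule fdet_cong) (auto simp: f_def)
  ultimately show ?thesis by simp
qed

text \<open>The first row contributes to the monotone function \<open>E\<close> the functions \<open>U j\<close>, of which only the
  last can fail to be the integral of its derivative.\<close>

lemma singular_part_sign:
  assumes x: "\<And>a. a \<le> m \<Longrightarrow> x a \<in> Diff"
    and uv: "0 \<le> u" "u \<le> v" "v \<le> 2 * pi" and s: "\<And>t. t \<in> {u..v} \<Longrightarrow> s * sine_vandermonde (m + 2) (case_nat t x) > 0"
  shows "s * sg * ((-1) ^ Suc m * fdet (Suc m) (\<lambda>a j. h j (x a))) *
    (h m v - h m u - integral {u..v} (h (Suc m))) \<ge> 0"
proof -
  have "\<exists>G. \<forall>x. - \<infinity> < ereal x \<longrightarrow> ereal x < \<infinity> \<longrightarrow> (G has_vector_derivative h 0 x) (at x)"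
    using h_cont[of 0] by (intro einterval_antiderivative) (auto simp: continuous_on_eq_continuous_at)
  then obtain G where G: "\<And>x. (G has_real_derivative h 0 x) (at x)"
    by (auto simp: has_real_derivative_iff_has_vector_derivative)
  define U where "U = case_nat G h"
  have U: "(U j has_real_derivative U (Suc j) t) (at t)" if "j \<le> m" for j t
  proof (cases j)
    case 0
    then show ?thesis using G by (simp add: U_def)
  next
    case (Suc i)
    then show ?thesis using deriv[of i t] that by (simp add: U_def)
  qed
  have US: "U (Suc j) = h j" for j by (simp add: U_def)
  obtain c where c: "\<And>r. fdet (Suc (Suc m)) ((\<lambda>a j. h j (x (a - 1)))(0 := r)) = (\<Sum>j\<le>Suc m. r j * c j)"
    "c (Suc m) = (-1) ^ Suc m * fdet (Suc m) (\<lambda>a b. h b (x (Suc a - 1)))"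
    by (rule fdet_row_0_cofactor[of "Suc m" "\<lambda>a j. h j (x (a - 1))"], rule that)
  define k where "k = s * sg"
  \<comment> \<open>Up to a constant, the increment determinant as a function of its upper end
    point. It is monotone by \<open>first_row_increment_nonneg\<close>, and \<open>e\<close> is its
    derivative wherever \<open>h m\<close> is differentiable.\<close>
  define E where "E t = k * (\<Sum>j\<le>Suc m. U j t * c j)" for t
  define e where "e t = k * (\<Sum>j\<le>Suc m. U (Suc j) t * c j)" for t
  have mono: "E t \<le> E t'" if "u \<le> t" "t \<le> t'" "t' \<le> v" for t t'
  proof -
    have "0 \<le> k * fdet (m + 2) ((\<lambda>a j. h j (x (a - 1)))(0 := \<lambda>j. U j t' - U j t))"
      unfolding k_def using that s by (intro first_row_increment_nonneg U US x) auto
    also have "\<dots> = E t' - E t"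
      unfolding E_def using c(1)[of "\<lambda>j. U j t' - U j t"] by (simp add: left_diff_distrib sum_subtractf right_diff_distrib)
    finally show ?thesis by simp
  qed
  have Ucont: "continuous_on UNIV (U j)" if "j \<le> Suc m" for j
  proof (cases "j = Suc m")
    case True
    then show ?thesis using cont by (simp add: US)
  next
    case False
    then show ?thesis using that U[of j] by (auto intro!: continuous_at_imp_continuous_on DERIV_isCont)
  qed
  have Uint: "U (Suc j) integrable_on {u..v}" if "j \<le> Suc m" for j
  proof (cases "j = Suc m")
    case True
    then show ?thesis using uv by (auto simp: US intro: integrable_on_subinterval[OF int])
  next
    case False
    then show ?thesis using that Ucont[of "Suc j"]
      by (intro integrable_continuous_real) (auto intro: continuous_on_subset)
  qed
  have Uftc: "integral {u..v} (U (Suc j)) = U j v - U j u" if "j \<le> m" for j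
    using uv(2) U[OF that]
    by (intro integral_unique fundamental_theorem_of_calculus)
      (auto simp: has_real_derivative_iff_has_vector_derivative[symmetric] intro: has_field_derivative_at_within)
  have "integral {u..v} e \<le> E v - E u"
  proof (rule integral_deriv_le_monotone[OF uv(2) _ mono])
    show "continuous_on {u..v} E" unfolding E_def
      by (intro continuous_intros continuous_on_subset[OF Ucont]) auto
    show "e integrable_on {u..v}" unfolding e_def
      by (intro integrable_on_mult_right integrable_sum integrable_on_mult_left Uint) auto
    show "AE t in lborel. u < t \<and> t < v \<longrightarrow> (E has_real_derivative e t) (at t)"
      using diff_AE
    proof eventually_elim
      case (elim t)
      show ?case
      proof
        assume t: "u < t \<and> t < v"
        have "(U j has_real_derivative U (Suc j) t) (at t)" if "j \<le> Suc m" for j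
          using elim U[of j t] that t uv by (cases "j = Suc m") (auto simp: US)
        then show "(E has_real_derivative e t) (at t)" unfolding E_def e_def
          by (intro DERIV_cmult DERIV_sum DERIV_cmult_right) auto
      qed
    qed
  qed auto
  moreover have "integral {u..v} e = k * (\<Sum>j\<le>Suc m. integral {u..v} (U (Suc j)) * c j)"
    unfolding e_def using Uint by (subst integral_mult_right, subst integral_sum) (auto intro!: integrable_on_mult_left)
  ultimately have "0 \<le> k * (\<Sum>j\<le>Suc m. (U j v - U j u - integral {u..v} (U (Suc j))) * c j)"
    unfolding E_def by (simp only: left_diff_distrib sum_subtractf right_diff_distrib)
  also have "(\<Sum>j\<le>Suc m. (U j v - U j u - integral {u..v} (U (Suc j))) * c j)
    = (h m v - h m u - integral {u..v} (h (Suc m))) * c (Suc m)"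
  proof -
    \<comment> \<open>By the fundamental theorem of calculus the columns below the last one
      contribute no defect.\<close>
    have "(\<Sum>j\<le>m. (U j v - U j u - integral {u..v} (U (Suc j))) * c j) = 0"
      by (intro sum.neutral ballI) (use Uftc in simp)
    then show ?thesis unfolding sum.atMost_Suc US by simp
  qed
  finally show ?thesis by (simp add: k_def c(2) mult_ac)
qed

lemma period_nat: "j \<le> m \<Longrightarrow> h j (t + 2 * pi * real k) = ((-1) ^ Suc m) ^ k * h j t"
proof (induction k)
  case (Suc k)
  have "h j (t + 2 * pi * real (Suc k)) = h j ((t + 2 * pi * real k) + 2 * pi)" by (simp add: algebra_simps)
  also have "\<dots> = (-1) ^ Suc m * h j (t + 2 * pi * real k)" by (rule period[OF Suc.prems])
  finally show ?case using Suc by simp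
qed simp

text \<open>Two of the arguments are congruent modulo \<open>2 * pi\<close>, and antiperiodicity
  makes their rows equal up to sign.\<close>

lemma wronskian_eq_0_if_sine_vandermonde_eq_0:
  assumes "sine_vandermonde (Suc m) x = 0"
  shows "fdet (Suc m) (\<lambda>a j. h j (x a)) = 0"
proof -
  from assms obtain a b where ab: "b < Suc m" "a < b" "sin ((x b - x a) / 2) = 0"
    unfolding sine_vandermonde_def prod_zero_iff[OF finite_lessThan] by blast
  then obtain k :: int where "(x b - x a) / 2 = k * pi" by (auto simp: sin_zero_iff_int2)
  then have k: "x b = x a + 2 * pi * k" by (simp add: field_simps)
  show ?thesis
  proof (cases "k \<ge> 0")
    case True
    then have "x b = x a + 2 * pi * real (nat k)" using k by simp
    then show ?thesis using ab period_nat
      by (intro fdet_proportional_rows[of b _ a _ "((-1) ^ Suc m) ^ nat k"]) (auto simp del: power_Suc)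
  next
    case False
    then have "x a = x b + 2 * pi * real (nat (- k))" using k by simp
    then show ?thesis using ab period_nat
      by (intro fdet_proportional_rows[of a _ b _ "((-1) ^ Suc m) ^ nat (- k)"]) (auto simp del: power_Suc)
  qed
qed

text \<open>If \<open>h m\<close> had a singular part, two adjacent intervals could be chosen that carry singular
  parts of the same sign and are separated by an interval \<open>(t1, t2)\<close> which carries it, too.  Replacing
  a row of a nonvanishing Wronskian by the one at \<open>y \<in> (t1, t2)\<close> gives both signs, hence 0.\<close>

theorem indefinite_integral:
  assumes x: "\<And>a. a \<le> m \<Longrightarrow> x a \<in> Diff" and W: "fdet (Suc m) (\<lambda>a j. h j (x a)) \<noteq> 0"
    and pq: "0 \<le> p" "p \<le> q" "q \<le> 2 * pi"
  shows "integral {p..q} (h (Suc m)) = h m q - h m p"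
proof (rule ccontr)
  assume neq: "integral {p..q} (h (Suc m)) \<noteq> h m q - h m p"
  have intg: "h (Suc m) integrable_on {u..v}" if "0 \<le> u" "v \<le> 2 * pi" for u v
    using that by (auto intro: integrable_on_subinterval[OF int])
  \<comment> \<open>The singular part of \<open>h m\<close>, up to an additive constant.\<close>
  define F where "F t = h m t - integral {0..t} (h (Suc m))" for t
  have Fdiff: "F v - F u = h m v - h m u - integral {u..v} (h (Suc m))" if "0 \<le> u" "u \<le> v" "v \<le> 2 * pi" for u v
    using Henstock_Kurzweil_Integration.integral_combine[of 0 u v "h (Suc m)"] intg[of 0 v] that by (simp add: F_def)
  have Fcont: "continuous_on {0..2 * pi} F" unfolding F_def
    by (intro continuous_intros indefinite_integral_continuous_1 int continuous_on_subset[OF cont]) auto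
  \<comment> \<open>Points congruent modulo \<open>2 * pi\<close> to one of the given arguments,
    where a sine factor vanishes.\<close>
  define X where "X = (\<Union>i\<le>m. {t \<in> {0..2 * pi}. sin ((x i - t) / 2) = 0})"
  have "finite X" unfolding X_def by (intro finite_UN_I finite_zeros_sin_shift) auto
  moreover have "F p \<noteq> F q" using Fdiff[of p q] pq neq by auto
  moreover have "continuous_on {p..q} F" using pq by (intro continuous_on_subset[OF Fcont]) auto
  ultimately obtain a b where ab: "p < a" "a < b" "b < q" "{a..b} \<inter> X = {}" "F a \<noteq> F b"
    using exists_nonconstant_interval_avoiding_finite[of X p q F] pq by blast
  define d where "d = F b - F a"
  have d: "d \<noteq> 0" using ab by (simp add: d_def)
  define \<psi> where "\<psi> t = (F t - F a) / d" for t
  have \<psi>cont: "continuous_on {u..v} \<psi>" if "0 \<le> u" "v \<le> 2 * pi" for u v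
    unfolding \<psi>_def using d that by (intro continuous_intros continuous_on_subset[OF Fcont]) auto
  have \<psi>ab: "\<psi> a = 0" "\<psi> b = 1" using d by (auto simp: \<psi>_def d_def)
  \<comment> \<open>The points \<open>t1\<close> and \<open>t2\<close> cut the singular mass
    \<open>d\<close> on \<open>{a..b}\<close> into thirds; \<open>y\<close> will move in the middle
    one and the outer ones supply the two opposite inequalities.\<close>
  obtain t1 where t1: "a \<le> t1" "t1 \<le> b" "\<psi> t1 = 1 / 3"
    using IVT'[of \<psi> a "1/3" b] \<psi>ab ab pq \<psi>cont[of a b] by auto
  obtain t2 where t2: "t1 \<le> t2" "t2 \<le> b" "\<psi> t2 = 2 / 3"
    using IVT'[of \<psi> t1 "2/3" b] \<psi>ab t1 ab pq \<psi>cont[of t1 b] by auto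
  have "t1 \<noteq> t2" using t1 t2 by auto
  then have t12: "t1 < t2" using t2 by simp
  have F1: "F t1 - F a = d / 3" and F2: "F b - F t2 = d / 3" and F3: "F t2 - F t1 = d / 3"
    using t1(3) t2(3) d by (auto simp: \<psi>_def d_def field_simps)
  have W0: "fdet (Suc m) ((\<lambda>a j. h j (x a))(i := \<lambda>j. h j y)) = 0" if y: "y \<in> Diff" "t1 < y" "y < t2" and i: "i < Suc m" for y i
  proof (cases "sine_vandermonde (Suc m) (x(i := y)) = 0")
    case True
    have "fdet (Suc m) ((\<lambda>a j. h j (x a))(i := \<lambda>j. h j y)) = fdet (Suc m) (\<lambda>a j. h j ((x(i := y)) a))"
      by (rule fdet_cong) auto
    then show ?thesis using wronskian_eq_0_if_sine_vandermonde_eq_0[OF True] by simp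
  next
    case False
    define x' where "x' = x(i := y)"
    \<comment> \<open>The sine factors that join \<open>t\<close> to the unchanged arguments. They
      keep their sign on \<open>{a..b}\<close> because that interval avoids \<open>X\<close>; only
      the factor with \<open>y\<close> can change sign.\<close>
    define R where "R t = (\<Prod>b\<in>{..<Suc m} - {i}. sin ((x b - t) / 2))" for t
    have sv: "sine_vandermonde (m + 2) (case_nat t x') = sin ((y - t) / 2) * R t * sine_vandermonde (Suc m) x'" for t
    proof -
      have "(\<Prod>b<Suc m. sin ((x' b - t) / 2)) = sin ((x' i - t) / 2) * (\<Prod>b\<in>{..<Suc m} - {i}. sin ((x' b - t) / 2))"
        using i by (intro prod.remove) auto
      also have "(\<Prod>b\<in>{..<Suc m} - {i}. sin ((x' b - t) / 2)) = R t"
        unfolding R_def by (intro prod.cong) (auto simp: x'_def)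
      finally show ?thesis using sine_vandermonde_Suc_case_nat[of "Suc m" t x'] by (simp add: x'_def)
    qed
    have R0: "R t \<noteq> 0" if "t \<in> {a..b}" for t
    proof -
      have "t \<notin> X" using that ab by auto
      then have "sin ((x j - t) / 2) \<noteq> 0" if "j \<le> m" for j
        using that \<open>t \<in> {a..b}\<close> ab pq unfolding X_def by auto
      then show ?thesis unfolding R_def by auto
    qed
    have RR: "R a * R t > 0" if "t \<in> {a..b}" for t
      using that R0 ab by (intro continuous_nonvanishing_same_sign[of a b]) (auto simp: R_def intro!: continuous_intros)
    \<comment> \<open>Chosen with the sign of all factors except \<open>sin ((y - t) / 2)\<close>:
      then \<open>s\<close> is the sign needed to the left of \<open>y\<close> and
      \<open>- s\<close> the one needed to the right.\<close>
    define s where "s = R a * sine_vandermonde (Suc m) x'"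
    have s0: "s \<noteq> 0" using R0[of a] ab False by (simp add: s_def x'_def)
    have ssv: "s * sine_vandermonde (m + 2) (case_nat t x') = (R a * R t) * (sine_vandermonde (Suc m) x')\<^sup>2 * sin ((y - t) / 2)" for t
      unfolding s_def sv by (simp add: power2_eq_square)
    have sq: "(sine_vandermonde (Suc m) x')\<^sup>2 > 0" using False by (simp add: x'_def)
    have x'D: "x' j \<in> Diff" if "j \<le> m" for j using x that y by (auto simp: x'_def)
    define W' where "W' = (-1) ^ Suc m * fdet (Suc m) (\<lambda>a j. h j (x' a))"
    have "s * sg * W' * (h m t1 - h m a - integral {a..t1} (h (Suc m))) \<ge> 0" unfolding W'_def
    proof (rule singular_part_sign[OF x'D])
      fix t assume t: "t \<in> {a..t1}"
      have "sin ((y - t) / 2) > 0" using t y t2 ab pq by (intro sin_gt_zero) auto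
      then show "s * sine_vandermonde (m + 2) (case_nat t x') > 0"
        unfolding ssv using t t1 by (intro mult_pos_pos RR sq) auto
    qed (use t1 ab pq in auto)
    moreover have "(- s) * sg * W' * (h m b - h m t2 - integral {t2..b} (h (Suc m))) \<ge> 0" unfolding W'_def
    proof (rule singular_part_sign[OF x'D])
      fix t assume t: "t \<in> {t2..b}"
      have "sin ((t - y) / 2) > 0" using t y t1 ab pq by (intro sin_gt_zero) auto
      then have "sin ((y - t) / 2) < 0" using sin_minus[of "(t - y) / 2"] by (simp add: minus_divide_left)
      moreover have "(R a * R t) * (sine_vandermonde (Suc m) x')\<^sup>2 > 0" using t t1 t2 by (intro mult_pos_pos RR sq) auto
      ultimately have "s * sine_vandermonde (m + 2) (case_nat t x') < 0"
        unfolding ssv by (simp add: mult_less_0_iff)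
      then show "(- s) * sine_vandermonde (m + 2) (case_nat t x') > 0" by simp
    qed (use t1 t2 ab pq in auto)
    moreover have "h m t1 - h m a - integral {a..t1} (h (Suc m)) = d / 3"
      "h m b - h m t2 - integral {t2..b} (h (Suc m)) = d / 3"
      using Fdiff[of a t1] Fdiff[of t2 b] F1 F2 t1 t2 ab pq by linarith+
    ultimately have "s * sg * W' * (d / 3) \<ge> 0" "(- s) * sg * W' * (d / 3) \<ge> 0" by simp_all
    then have "s * sg * W' * (d / 3) = 0" by simp
    then have "W' = 0" using s0 sg d by simp
    then have "fdet (Suc m) (\<lambda>a j. h j (x' a)) = 0" by (simp add: W'_def)
    moreover have "fdet (Suc m) ((\<lambda>a j. h j (x a))(i := \<lambda>j. h j y)) = fdet (Suc m) (\<lambda>a j. h j (x' a))"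
      by (rule fdet_cong) (auto simp: x'_def)
    ultimately show ?thesis by simp
  qed
  \<comment> \<open>Cramer's rule: the row at \<open>y\<close> vanishes if putting it in place of
    any row of a nonsingular matrix gives determinant 0. Its last entry is
    \<open>h m y\<close>.\<close>
  have hm0: "h m y = 0" if "y \<in> Diff" "t1 < y" "y < t2" for y
    using fdet_replace_rows_eq_0[OF W W0[OF that], of m] by simp
  have "{y \<in> {t1<..<t2}. h m y \<noteq> 0} = {}"
  proof (rule AE_lborel_open_empty)
    have "open ({t1<..<t2} \<inter> h m -` (- {0}))"
      using continuous_on_subset[OF cont] by (intro continuous_open_preimage) auto
    also have "{t1<..<t2} \<inter> h m -` (- {0}) = {y \<in> {t1<..<t2}. h m y \<noteq> 0}" by auto
    finally show "open {y \<in> {t1<..<t2}. h m y \<noteq> 0}" .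
    show "AE y in lborel. y \<notin> {y \<in> {t1<..<t2}. h m y \<noteq> 0}"
      using diff_AE by eventually_elim (use hm0 t1 t2 ab pq in \<open>auto simp: Diff_def\<close>)
  qed
  then have z: "h m y = 0" if "t1 < y" "y < t2" for y using that by auto
  have "h m y = 0" if "y \<in> {t1..t2}" for y
    using continuous_constant_on_closure[of "{t1<..<t2}" "h m" 0 y] continuous_on_subset[OF cont] z that t12 by auto
  then have hm12: "h m t1 = 0" "h m t2 = 0" using t12 by auto
  \<comment> \<open>As \<open>h m\<close> vanishes on the middle interval, so does its derivative,
    and no singular mass is left there; this contradicts the third \<open>d / 3\<close> that it
    carries.\<close>
  have "AE y in lborel. y \<in> {t1..t2} \<longrightarrow> h (Suc m) y = 0"
    using diff_AE AE_lborel_singleton[of t1] AE_lborel_singleton[of t2]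
  proof eventually_elim
    case (elim y)
    show ?case
    proof
      assume "y \<in> {t1..t2}"
      then have y: "y \<in> {t1<..<t2}" using elim by auto
      have "(h m has_real_derivative 0) (at y)"
        by (rule has_field_derivative_transform_within_open[of "\<lambda>_. 0" 0 y "{t1<..<t2}"]) (use y z in auto)
      moreover have "y \<in> {0..2 * pi}" using y t1 t2 ab pq by auto
      ultimately show "h (Suc m) y = 0" using elim(1) DERIV_unique by blast
    qed
  qed
  then have "integral {t1..t2} (h (Suc m)) = 0"
    using has_integral_AE[of "{t1..t2}" "h (Suc m)" "\<lambda>_. 0" 0] by (intro integral_unique) simp
  then show False using Fdiff[of t1 t2] F3 d hm12 t1 t2 ab pq by auto
qed

end

section \<open>Integration over the circle and the torus\<close>

lemma sets_circle [measurable_cong]: "sets circle = sets (restrict_space borel unit_circle)"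
  by (simp add: circle_def)

interpretation circle: prob_space circle by (rule prob_space_circle)

lemma borel_measurable_circleI: "f \<in> borel_measurable borel \<Longrightarrow> f \<in> borel_measurable circle"
  by (subst measurable_cong_sets[OF sets_circle refl]) (rule measurable_restrict_space1)

lemma continuous_on_borel_measurable_circle:
  fixes f :: "complex \<Rightarrow> 'a::topological_space"
  shows "continuous_on unit_circle f \<Longrightarrow> f \<in> borel_measurable circle"
  by (subst measurable_cong_sets[OF sets_circle refl]) (rule borel_measurable_continuous_on_restrict)

lemma continuous_on_integrable_circle:
  fixes f :: "complex \<Rightarrow> complex"
  assumes "continuous_on unit_circle f"
  shows "integrable circle f"
proof -
  have "bounded (f ` unit_circle)"
    using assms by (intro compact_imp_bounded compact_continuous_image) auto
  then obtain B where "\<forall>z\<in>unit_circle. norm (f z) \<le> B" by (auto simp: bounded_iff)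
  then show ?thesis
    using continuous_on_borel_measurable_circle[OF assms]
    by (intro circle.integrable_const_bound[of f B]) auto
qed

lemma AE_circle_unit_circle: "AE z in circle. z \<in> unit_circle"
  using AE_space[of circle] by simp

text \<open>The torus is a product of Borel measures, whereas weights and their derivatives are only
  Lebesgue measurable. Integrals over the torus are therefore computed with Borel representatives
  and transferred back almost everywhere.\<close>

lemma integrable_completion_representative:
  fixes f :: "'a \<Rightarrow> complex"
  assumes "integrable (completion M) f"
  obtains \<phi> where "integrable M \<phi>" "AE z in M. f z = \<phi> z"
proof -
  have m: "f \<in> borel_measurable (completion M)" using assms by auto
  then have "(\<lambda>z. Re (f z)) \<in> borel_measurable (completion M)" "(\<lambda>z. Im (f z)) \<in> borel_measurable (completion M)"
    by auto
  from this[THEN completion_ex_borel_measurable_real] obtain r i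
    where r: "r \<in> borel_measurable M" "AE z in M. Re (f z) = r z"
      and i: "i \<in> borel_measurable M" "AE z in M. Im (f z) = i z" by blast
  define \<phi> where "\<phi> z = Complex (r z) (i z)" for z
  have ae: "AE z in M. f z = \<phi> z"
    using r(2) i(2) by eventually_elim (auto simp: \<phi>_def complex_eq_iff)
  have "\<phi> = (\<lambda>z. complex_of_real (r z) + \<i> * complex_of_real (i z))"
    by (auto simp: \<phi>_def complex_eq_iff)
  then have \<phi>: "\<phi> \<in> borel_measurable M" using r(1) i(1) by simp
  have "integrable (completion M) \<phi>"
    using assms AE_completion[OF ae] \<phi> by (subst integrable_cong_AE[of _ _ f]) (auto simp: m intro: measurable_completion)
  then show ?thesis using that ae \<phi> by (simp add: integrable_completion)
qed

lemma borel_measurable_completion_cong_AE: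
  assumes \<phi>: "\<phi> \<in> borel_measurable M" and ae: "AE z in M. f z = \<phi> z"
  shows "f \<in> borel_measurable (completion M)"
proof (rule measurableI)
  fix A :: "'b set" assume A: "A \<in> sets borel"
  show "f -` A \<inter> space (completion M) \<in> sets (completion M)"
  proof (rule completion.in_sets_AE)
    show "AE z in completion M. (z \<in> \<phi> -` A \<inter> space M) = (z \<in> f -` A \<inter> space (completion M))"
      using AE_completion[OF ae] by eventually_elim simp
    show "\<phi> -` A \<inter> space M \<in> sets (completion M)"
      using measurable_sets[OF \<phi> A] by (rule sets_completionI_sets)
  qed simp
qed simp

lemma integral_completion_cong_AE:
  fixes f \<phi> :: "'a \<Rightarrow> complex"
  assumes "\<phi> \<in> borel_measurable M" "AE z in M. f z = \<phi> z"
  shows "integral\<^sup>L (completion M) f = integral\<^sup>L M \<phi>"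
proof -
  have ae: "AE z in completion M. f z = \<phi> z" using assms(2) by (rule AE_completion)
  have m: "\<phi> \<in> borel_measurable (completion M)" using assms(1) by (rule measurable_completion)
  moreover have "f \<in> borel_measurable (completion M)"
    by (rule borel_measurable_completion_cong_AE[OF assms])
  ultimately have "integral\<^sup>L (completion M) f = integral\<^sup>L (completion M) \<phi>"
    using ae by (intro integral_cong_AE) auto
  then show ?thesis using integral_completion[OF assms(1)] by simp
qed

section \<open>The Haar measure in the angle coordinate\<close>

lemma circle_eq_distr_density:
  "circle = distr (density lborel (\<lambda>t. ennreal (indicator {0..2 * pi} t / (2 * pi)))) (restrict_space borel unit_circle) cis"
proof -
  have "indicator {0..2 * pi} t / emeasure lborel {0..2 * pi} = ennreal (indicator {0..2 * pi} t / (2 * pi))" for t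
    by (auto simp: indicator_def divide_ennreal ennreal_1[symmetric] simp del: ennreal_1)
  then show ?thesis unfolding circle_def uniform_measure_def by simp
qed

lemma cis_measurable: "cis \<in> measurable borel (restrict_space borel unit_circle)"
  by (rule measurable_restrict_space2) (auto intro!: borel_measurable_continuous_onI continuous_intros)

lemma borel_measurable_circle_cis:
  "f \<in> borel_measurable circle \<Longrightarrow> (\<lambda>t. f (cis t)) \<in> borel_measurable borel"
  using measurable_compose[OF cis_measurable, of f borel] measurable_cong_sets[OF sets_circle refl, of borel] by blast

lemma
  fixes f :: "complex \<Rightarrow> complex"
  assumes f: "f \<in> borel_measurable circle"
  shows integral_circle: "integral\<^sup>L circle f = (LINT t:{0..2 * pi}|lborel. f (cis t)) / (2 * pi)"
    and integrable_circle: "integrable circle f \<longleftrightarrow> set_integrable lborel {0..2 * pi} (\<lambda>t. f (cis t))"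
proof -
  have f': "f \<in> borel_measurable (restrict_space borel unit_circle)"
    using f measurable_cong_sets[OF sets_circle refl, of borel] by blast
  note fc = borel_measurable_circle_cis[OF f]
  have c: "cis \<in> measurable (density lborel (\<lambda>t. ennreal (indicator {0..2 * pi} t / (2 * pi)))) (restrict_space borel unit_circle)"
    using cis_measurable by simp
  have eq: "(indicator {0..2 * pi} t / (2 * pi)) *\<^sub>R f (cis t) = (indicator {0..2 * pi} t *\<^sub>R f (cis t)) / (2 * pi)" for t :: real
    by (simp add: scaleR_conv_of_real)
  have eq': "(indicator {0..2 * pi} t / (2 * pi)) *\<^sub>R f (cis t) = (1 / (2 * pi)) * (indicator {0..2 * pi} t *\<^sub>R f (cis t))" for t :: real
    by (simp add: scaleR_conv_of_real)
  have "integral\<^sup>L circle f = (LINT t|density lborel (\<lambda>t. ennreal (indicator {0..2 * pi} t / (2 * pi))). f (cis t))"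
    unfolding circle_eq_distr_density by (rule integral_distr[OF c f'])
  also have "\<dots> = (LINT t|lborel. (indicator {0..2 * pi} t / (2 * pi)) *\<^sub>R f (cis t))"
    by (rule integral_density) (use fc in \<open>auto intro!: borel_measurable_divide\<close>)
  also have "\<dots> = (LINT t:{0..2 * pi}|lborel. f (cis t)) / (2 * pi)"
    unfolding eq set_lebesgue_integral_def by (rule integral_divide_zero)
  finally show "integral\<^sup>L circle f = (LINT t:{0..2 * pi}|lborel. f (cis t)) / (2 * pi)" .
  have "integrable circle f \<longleftrightarrow> integrable (density lborel (\<lambda>t. ennreal (indicator {0..2 * pi} t / (2 * pi)))) (\<lambda>t. f (cis t))"
    unfolding circle_eq_distr_density by (rule integrable_distr_eq[OF c f'])
  also have "\<dots> \<longleftrightarrow> integrable lborel (\<lambda>t. (indicator {0..2 * pi} t / (2 * pi)) *\<^sub>R f (cis t))"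
    by (rule integrable_density) (use fc in \<open>auto intro!: borel_measurable_divide\<close>)
  also have "\<dots> \<longleftrightarrow> set_integrable lborel {0..2 * pi} (\<lambda>t. f (cis t))"
    unfolding set_integrable_def eq'
  proof
    assume "integrable lborel (\<lambda>t. complex_of_real (1 / (2 * pi)) * (indicator {0..2 * pi} t *\<^sub>R f (cis t)))"
    from integrable_mult_right[OF this, of "complex_of_real (2 * pi)"]
    show "integrable lborel (\<lambda>t. indicator {0..2 * pi} t *\<^sub>R f (cis t))" by simp
  qed (rule integrable_mult_right)
  finally show "integrable circle f \<longleftrightarrow> set_integrable lborel {0..2 * pi} (\<lambda>t. f (cis t))" .
qed

lemma AE_circleD: "AE z in circle. P z \<Longrightarrow> AE t in lborel. t \<in> {0..2 * pi} \<longrightarrow> P (cis t)"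
proof -
  assume "AE z in circle. P z"
  then have "AE t in uniform_measure lborel {0..2 * pi}. P (cis t)"
    unfolding circle_def by (rule AE_distrD[rotated]) (use cis_measurable in \<open>simp add: measurable_def\<close>)
  then show ?thesis by (subst (asm) AE_uniform_measure) (auto simp: emeasure_lborel_Icc)
qed

lemma nn_integral_circle:
  assumes "f \<in> borel_measurable circle"
  shows "integral\<^sup>N circle f = (\<integral>\<^sup>+t. f (cis t) * indicator {0..2 * pi} t \<partial>lborel) / (2 * pi)"
proof -
  have f': "f \<in> borel_measurable (restrict_space borel unit_circle)"
    using assms measurable_cong_sets[OF sets_circle refl, of borel] by blast
  have "integral\<^sup>N circle f = (\<integral>\<^sup>+t. f (cis t) \<partial>uniform_measure lborel {0..2 * pi})"
    unfolding circle_def by (rule nn_integral_distr) (use f' cis_measurable in \<open>auto simp: measurable_def\<close>)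
  then show ?thesis using borel_measurable_circle_cis[OF assms]
    by (subst (asm) nn_integral_uniform_measure) auto
qed

section \<open>Rotation invariance of the Haar measure\<close>

lemma nn_integral_periodic_shift:
  fixes f :: "real \<Rightarrow> ennreal"
  assumes f[measurable]: "f \<in> borel_measurable borel" and per: "\<And>t. f (t + p) = f t" and s: "0 \<le> s" "s \<le> p"
  shows "(\<integral>\<^sup>+t. f (t + s) * indicator {0..p} t \<partial>lborel) = (\<integral>\<^sup>+t. f t * indicator {0..p} t \<partial>lborel)"
proof -
  have shift: "(\<integral>\<^sup>+t. g (t + c) \<partial>lborel) = integral\<^sup>N lborel g" if "g \<in> borel_measurable borel" for g :: "real \<Rightarrow> ennreal" and c
    using nn_integral_real_affine[OF that, of 1 c] by (simp add: add.commute)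
  have "(\<integral>\<^sup>+t. f (t + s) * indicator {0..p} t \<partial>lborel) = (\<integral>\<^sup>+t. (\<lambda>t. f t * indicator {s..p + s} t) (t + s) \<partial>lborel)"
    by (intro nn_integral_cong) (auto simp: indicator_def)
  also have "\<dots> = (\<integral>\<^sup>+t. f t * indicator {s..p + s} t \<partial>lborel)" by (rule shift) measurable
  also have "\<dots> = (\<integral>\<^sup>+t. f t * indicator {s..p} t + f t * indicator {p..p + s} t \<partial>lborel)"
    using AE_lborel_singleton[of p] s by (intro nn_integral_cong_AE) (auto elim!: eventually_mono simp: indicator_def)
  also have "\<dots> = (\<integral>\<^sup>+t. f t * indicator {s..p} t \<partial>lborel) + (\<integral>\<^sup>+t. f t * indicator {p..p + s} t \<partial>lborel)"
    by (rule nn_integral_add) auto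
  also have "(\<integral>\<^sup>+t. f t * indicator {p..p + s} t \<partial>lborel) = (\<integral>\<^sup>+t. (\<lambda>t. f t * indicator {p..p + s} t) (t + p) \<partial>lborel)"
    by (rule shift[symmetric]) measurable
  also have "\<dots> = (\<integral>\<^sup>+t. f t * indicator {0..s} t \<partial>lborel)"
    by (intro nn_integral_cong) (auto simp: indicator_def per)
  also have "(\<integral>\<^sup>+t. f t * indicator {s..p} t \<partial>lborel) + (\<integral>\<^sup>+t. f t * indicator {0..s} t \<partial>lborel)
    = (\<integral>\<^sup>+t. f t * indicator {s..p} t + f t * indicator {0..s} t \<partial>lborel)"
    by (rule nn_integral_add[symmetric]) auto
  also have "\<dots> = (\<integral>\<^sup>+t. f t * indicator {0..p} t \<partial>lborel)"
    using AE_lborel_singleton[of s] s by (intro nn_integral_cong_AE) (auto elim!: eventually_mono simp: indicator_def)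
  finally show ?thesis .
qed

lemma circle_rotation_measurable:
  assumes "c \<in> unit_circle"
  shows "(\<lambda>z. z * c) \<in> measurable circle circle"
proof -
  have "(\<lambda>z. z * c) \<in> measurable (restrict_space borel unit_circle) (restrict_space borel unit_circle)"
    by (rule measurable_restrict_space3) (use assms in \<open>auto simp: norm_mult\<close>)
  then show ?thesis using measurable_cong_sets[OF sets_circle sets_circle] by blast
qed

lemma circle_rotation_invariant:
  assumes "c \<in> unit_circle"
  shows "distr circle circle (\<lambda>z. z * c) = circle"
proof (rule measure_eqI)
  fix A assume "A \<in> sets (distr circle circle (\<lambda>z. z * c))"
  then have A: "A \<in> sets circle" by simp
  obtain s where s: "0 \<le> s" "s < 2 * pi" "c = cis s"
    using assms Arg2pi_ge_0 Arg2pi_lt_2pi Arg2pi_eq[of c] by (auto simp: cis_conv_exp)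
  define f where "f t = (indicator A (cis t) :: ennreal)" for t
  have iA: "(indicator A :: complex \<Rightarrow> ennreal) \<in> borel_measurable circle" using A by simp
  have f: "f \<in> borel_measurable borel" unfolding f_def using borel_measurable_circle_cis[OF iA] .
  have "emeasure (distr circle circle (\<lambda>z. z * c)) A = (\<integral>\<^sup>+z. indicator A (z * c) \<partial>circle)"
    using circle_rotation_measurable[OF assms] A
    by (subst nn_integral_indicator[symmetric]) (auto simp: nn_integral_distr simp del: nn_integral_indicator)
  also have "\<dots> = (\<integral>\<^sup>+t. f (t + s) * indicator {0..2 * pi} t \<partial>lborel) / (2 * pi)"
    using measurable_compose[OF circle_rotation_measurable[OF assms] iA]
    by (subst nn_integral_circle) (auto simp: f_def s(3) cis_mult)
  also have "\<dots> = (\<integral>\<^sup>+t. f t * indicator {0..2 * pi} t \<partial>lborel) / (2 * pi)"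
    by (subst nn_integral_periodic_shift[OF f]) (use s in \<open>auto simp: f_def cis_mult[symmetric]\<close>)
  also have "\<dots> = emeasure circle A"
    using nn_integral_circle[OF iA] A by (simp add: f_def)
  finally show "emeasure (distr circle circle (\<lambda>z. z * c)) A = emeasure circle A" .
qed simp

lemma integral_circle_rotation:
  fixes f :: "complex \<Rightarrow> complex"
  assumes "c \<in> unit_circle" "f \<in> borel_measurable circle"
  shows "(LINT z|circle. f (z * c)) = integral\<^sup>L circle f"
proof -
  have "(LINT z|circle. f (z * c)) = integral\<^sup>L (distr circle circle (\<lambda>z. z * c)) f"
    by (rule integral_distr[symmetric]) (use assms circle_rotation_measurable in auto)
  then show ?thesis by (simp add: circle_rotation_invariant[OF assms(1)])
qed

lemma AE_circle_rotation:
  assumes "c \<in> unit_circle" "AE z in circle. P z"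
  shows "AE z in circle. P (z * c)"
  by (rule AE_distrD[OF circle_rotation_measurable[OF assms(1)]])
    (subst circle_rotation_invariant[OF assms(1)], rule assms(2))

section \<open>Product measure on the torus and Andreief's identity\<close>

interpretation torus: product_prob_space "\<lambda>_::nat. circle" "{..<N}" for N
  by unfold_locales

lemma prob_space_torus: "prob_space (torus N)"
  unfolding torus_def by (intro prob_space_PiM prob_space_circle)

lemma space_torus: "space (torus N) = (\<Pi>\<^sub>E a\<in>{..<N}. unit_circle)"
  by (simp add: torus_def space_PiM)

lemma torus_component_measurable [measurable]: "a < N \<Longrightarrow> (\<lambda>z. z a) \<in> measurable (torus N) circle"
  unfolding torus_def by (rule measurable_component_singleton) simp

lemma AE_torus_component: "a < N \<Longrightarrow> AE z in circle. P z \<Longrightarrow> AE z in torus N. P (z a)"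
  unfolding torus_def by (intro AE_PiM_component) (auto intro: prob_space_circle)

lemma
  fixes G :: "nat \<Rightarrow> nat \<Rightarrow> complex \<Rightarrow> complex"
  assumes G: "\<And>a b. a < N \<Longrightarrow> b < N \<Longrightarrow> integrable circle (G a b)"
  shows integrable_torus_fdet: "integrable (torus N) (\<lambda>z. fdet N (\<lambda>a b. G a b (z a)))"
    and integral_torus_fdet: "(LINT z|torus N. fdet N (\<lambda>a b. G a b (z a))) = fdet N (\<lambda>a b. integral\<^sup>L circle (G a b))"
proof -
  have pn: "\<sigma> a < N" if "\<sigma> permutes {..<N}" "a < N" for \<sigma> a using permutes_in_image[OF that(1), of a] that by auto
  have I: "integrable (torus N) (\<lambda>z. \<Prod>a<N. G a (\<sigma> a) (z a))" if "\<sigma> permutes {..<N}" for \<sigma>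
    unfolding torus_def by (rule torus.product_integrable_prod) (auto intro!: G pn[OF that])
  show "integrable (torus N) (\<lambda>z. fdet N (\<lambda>a b. G a b (z a)))"
    unfolding fdet_leibniz using I by (intro Bochner_Integration.integrable_sum integrable_mult_right) auto
  have "(LINT z|torus N. fdet N (\<lambda>a b. G a b (z a))) =
    (\<Sum>\<sigma> | \<sigma> permutes {..<N}. LINT z|torus N. signof \<sigma> * (\<Prod>a<N. G a (\<sigma> a) (z a)))"
    unfolding fdet_leibniz using I by (intro Bochner_Integration.integral_sum integrable_mult_right) auto
  also have "\<dots> = (\<Sum>\<sigma> | \<sigma> permutes {..<N}. signof \<sigma> * (\<Prod>a<N. integral\<^sup>L circle (G a (\<sigma> a))))"
  proof (rule sum.cong[OF refl])
    fix \<sigma> assume "\<sigma> \<in> {\<sigma>. \<sigma> permutes {..<N}}"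
    then have \<sigma>: "\<sigma> permutes {..<N}" by simp
    have "(LINT z|torus N. (\<Prod>a<N. G a (\<sigma> a) (z a))) = (\<Prod>a<N. integral\<^sup>L circle (G a (\<sigma> a)))"
      unfolding torus_def by (intro torus.product_integral_prod) (auto intro!: G pn[OF \<sigma>])
    then show "(LINT z|torus N. signof \<sigma> * (\<Prod>a<N. G a (\<sigma> a) (z a))) = signof \<sigma> * (\<Prod>a<N. integral\<^sup>L circle (G a (\<sigma> a)))"
      by simp
  qed
  finally show "(LINT z|torus N. fdet N (\<lambda>a b. G a b (z a))) = fdet N (\<lambda>a b. integral\<^sup>L circle (G a b))"
    unfolding fdet_leibniz .
qed

lemma fdet_permute_rows:
  assumes "\<sigma> permutes {..<N}"
  shows "fdet N (\<lambda>a b. F (\<sigma> a) b) = signof \<sigma> * fdet N F"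
proof -
  have \<sigma>: "\<sigma> permutes {0..<N}" using assms by (simp add: lessThan_atLeast0)
  have lt: "\<sigma> i < N" if "i < N" for i using permutes_in_image[OF assms, of i] that by simp
  show ?thesis
    unfolding fdet_def by (subst det_permute_rows[OF _ \<sigma>, symmetric, of "Matrix.mat N N (\<lambda>(a, b). F a b)"])
      (auto intro!: arg_cong[of _ _ Determinant.det] eq_matI simp: lt)
qed

text \<open>Expand the first determinant over permutations and absorb each product into the rows of
  the second. Every row then depends on a single variable, Fubini applies, and sorting the rows back
  cancels the sign, so all \<open>fact N\<close> permutations contribute equally.\<close>

lemma
  fixes \<psi> \<phi> :: "nat \<Rightarrow> complex \<Rightarrow> complex"
  assumes int: "\<And>j b. j < N \<Longrightarrow> b < N \<Longrightarrow> integrable circle (\<lambda>z. \<psi> j z * \<phi> b z)"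
  shows andreief_integrable: "integrable (torus N) (\<lambda>z. fdet N (\<lambda>a j. \<psi> j (z a)) * fdet N (\<lambda>a b. \<phi> b (z a)))" (is ?I)
    and andreief: "(LINT z|torus N. fdet N (\<lambda>a j. \<psi> j (z a)) * fdet N (\<lambda>a b. \<phi> b (z a)))
      = fact N * fdet N (\<lambda>j b. LINT z|circle. \<psi> j z * \<phi> b z)" (is ?E)
proof -
  have pn: "\<sigma> a < N" if "\<sigma> permutes {..<N}" "a < N" for \<sigma> a using permutes_in_image[OF that(1), of a] that by auto
  have eq: "fdet N (\<lambda>a j. \<psi> j (z a)) * fdet N (\<lambda>a b. \<phi> b (z a)) =
    (\<Sum>\<sigma> | \<sigma> permutes {..<N}. signof \<sigma> * fdet N (\<lambda>a b. \<psi> (\<sigma> a) (z a) * \<phi> b (z a)))" for z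
    unfolding fdet_leibniz[of N "\<lambda>a j. \<psi> j (z a)"] fdet_scale_rows by (simp add: sum_distrib_right mult.assoc)
  have I: "integrable (torus N) (\<lambda>z. fdet N (\<lambda>a b. \<psi> (\<sigma> a) (z a) * \<phi> b (z a)))" if "\<sigma> permutes {..<N}" for \<sigma>
    by (rule integrable_torus_fdet[where G = "\<lambda>a b z. \<psi> (\<sigma> a) z * \<phi> b z"]) (auto intro!: int pn[OF that])
  show ?I unfolding eq using I by (intro Bochner_Integration.integrable_sum integrable_mult_right) auto
  have "(LINT z|torus N. fdet N (\<lambda>a j. \<psi> j (z a)) * fdet N (\<lambda>a b. \<phi> b (z a))) =
    (\<Sum>\<sigma> | \<sigma> permutes {..<N}. signof \<sigma> * (LINT z|torus N. fdet N (\<lambda>a b. \<psi> (\<sigma> a) (z a) * \<phi> b (z a))))"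
    unfolding eq using I by (subst Bochner_Integration.integral_sum) auto
  also have "\<dots> = (\<Sum>\<sigma> | \<sigma> permutes {..<N}. fdet N (\<lambda>j b. LINT z|circle. \<psi> j z * \<phi> b z))"
  proof (rule sum.cong[OF refl])
    fix \<sigma> assume "\<sigma> \<in> {\<sigma>. \<sigma> permutes {..<N}}"
    then have \<sigma>: "\<sigma> permutes {..<N}" by simp
    have "(LINT z|torus N. fdet N (\<lambda>a b. \<psi> (\<sigma> a) (z a) * \<phi> b (z a))) = fdet N (\<lambda>a b. LINT z|circle. \<psi> (\<sigma> a) z * \<phi> b z)"
      by (rule integral_torus_fdet[where G = "\<lambda>a b z. \<psi> (\<sigma> a) z * \<phi> b z"]) (auto intro!: int pn[OF \<sigma>])
    also have "\<dots> = signof \<sigma> * fdet N (\<lambda>j b. LINT z|circle. \<psi> j z * \<phi> b z)"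
      by (rule fdet_permute_rows[OF \<sigma>])
    finally show "signof \<sigma> * (LINT z|torus N. fdet N (\<lambda>a b. \<psi> (\<sigma> a) (z a) * \<phi> b (z a))) = fdet N (\<lambda>j b. LINT z|circle. \<psi> j z * \<phi> b z)"
      by (simp add: mult.assoc[symmetric] sign_def)
  qed
  also have "\<dots> = fact N * fdet N (\<lambda>j b. LINT z|circle. \<psi> j z * \<phi> b z)"
    by (simp add: card_permutations)
  finally show ?E .
qed

section \<open>Derivatives along the circle\<close>

text \<open>This makes limits along the circle unique, so that the choice in
  \<open>circle_deriv\<close> returns the derivative whenever there is one.\<close>

lemma unit_circle_at_within_neq_bot: "z \<in> unit_circle \<Longrightarrow> at z within unit_circle \<noteq> (bot :: complex filter)"
proof -
  assume z: "z \<in> unit_circle"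
  have "connected unit_circle" by (rule connected_sphere) simp
  moreover have "\<not> (\<exists>a. unit_circle = {a::complex})"
  proof
    assume "\<exists>a. unit_circle = {a::complex}"
    moreover have "1 \<in> unit_circle" "(-1::complex) \<in> unit_circle" by auto
    ultimately have "(1::complex) = -1" by (metis singletonD)
    then show False by simp
  qed
  ultimately have "z islimpt unit_circle" using z by (intro connected_imp_perfect) auto
  then show ?thesis by (simp add: trivial_limit_within)
qed

lemma circle_deriv_eqI:
  assumes "(f has_field_derivative D) (at z within unit_circle)" "z \<in> unit_circle"
  shows "circle_deriv f z = D"
  unfolding circle_deriv_def
proof (rule some_equality)
  show "(f has_field_derivative D) (at z within unit_circle)" by fact
  fix D' assume "(f has_field_derivative D') (at z within unit_circle)"
  with assms show "D' = D"
    unfolding has_field_derivative_iff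
    using tendsto_unique[OF unit_circle_at_within_neq_bot] by blast
qed

lemma has_field_derivative_circle_deriv:
  "f field_differentiable (at z within unit_circle) \<Longrightarrow>
    (f has_field_derivative circle_deriv f z) (at z within unit_circle)"
  unfolding circle_deriv_def field_differentiable_def by (rule someI_ex)

lemma has_field_derivative_circle_cong:
  assumes "\<And>w. w \<in> unit_circle \<Longrightarrow> f w = g w" "z \<in> unit_circle"
  shows "(f has_field_derivative D) (at z within unit_circle) \<longleftrightarrow> (g has_field_derivative D) (at z within unit_circle)"
  using has_field_derivative_transform_within[of f D z unit_circle 1 g]
    has_field_derivative_transform_within[of g D z unit_circle 1 f] assms by auto

lemma field_differentiable_circle_cong:
  assumes "\<And>w. w \<in> unit_circle \<Longrightarrow> f w = g w" "z \<in> unit_circle"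
  shows "f field_differentiable (at z within unit_circle) \<longleftrightarrow> g field_differentiable (at z within unit_circle)"
  unfolding field_differentiable_def using has_field_derivative_circle_cong[OF assms] by simp

lemma circle_deriv_cong:
  assumes "\<And>w. w \<in> unit_circle \<Longrightarrow> f w = g w" "z \<in> unit_circle"
  shows "circle_deriv f z = circle_deriv g z"
  unfolding circle_deriv_def using has_field_derivative_circle_cong[OF assms] by simp

lemma has_vector_derivative_cis_mult:
  "((\<lambda>t. cis (c * t)) has_vector_derivative \<i> * of_real c * cis (c * t)) (at t within S)"
proof -
  have "((\<lambda>z. exp (\<i> * of_real c * z)) has_field_derivative \<i> * of_real c * exp (\<i> * of_real c * of_real t)) (at (of_real t))"
    by (auto intro!: derivative_eq_intros)
  from has_vector_derivative_real_field[OF this] show ?thesis by (simp add: cis_conv_exp mult.assoc)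
qed

lemma has_vector_derivative_comp_cis:
  assumes "(f has_field_derivative D) (at (cis t) within unit_circle)"
  shows "((\<lambda>t. f (cis t)) has_vector_derivative \<i> * cis t * D) (at t)"
proof -
  have "cis ` UNIV = (unit_circle :: complex set)"
  proof
    show "unit_circle \<subseteq> range cis"
    proof
      fix z :: complex assume "z \<in> unit_circle"
      then have "z = cis (Arg2pi z)" using Arg2pi_eq[of z] by (simp add: cis_conv_exp)
      then show "z \<in> range cis" by blast
    qed
  qed auto
  moreover have "(cis has_vector_derivative \<i> * cis t) (at t within UNIV)"
    using has_vector_derivative_cis_mult[of 1] by simp
  ultimately have "((f \<circ> cis) has_vector_derivative \<i> * cis t * D) (at t within UNIV)"
    using assms by (intro field_vector_diff_chain_within) auto
  then show ?thesis by (simp add: o_def)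
qed

lemma continuous_on_circle_iff_cis: "continuous_on unit_circle f \<Longrightarrow> continuous_on UNIV (\<lambda>t. f (cis t))"
  by (rule continuous_on_compose2[of unit_circle f]) (auto intro!: continuous_intros)

lemma AE_circleI: "(\<And>z. z \<in> unit_circle \<Longrightarrow> P z) \<Longrightarrow> AE z in circle. P z"
  by (rule eventually_mono[OF AE_circle_unit_circle])

section \<open>Integrability and differentiability classes on the circle\<close>

lemma L1_circle_cong_AE:
  assumes "L1_circle f" "AE z in circle. g z = f z"
  shows "L1_circle g"
proof -
  obtain \<phi> where \<phi>: "integrable circle \<phi>" "AE z in circle. f z = \<phi> z"
    using assms(1) integrable_completion_representative unfolding L1_circle_def by blast
  have ae: "AE z in circle. g z = \<phi> z" using assms(2) \<phi>(2) by eventually_elim simp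
  have "\<phi> \<in> borel_measurable circle" using \<phi> by auto
  moreover have "integrable (completion circle) \<phi>" using \<phi>(1) by (simp add: integrable_completion calculation)
  ultimately show ?thesis unfolding L1_circle_def
    using integrable_cong_AE[of g "completion circle" \<phi>] AE_completion[OF ae]
      borel_measurable_completion_cong_AE[OF _ ae] by (auto intro: measurable_completion)
qed

lemma L1_circle_cong: "L1_circle f \<Longrightarrow> (\<And>z. z \<in> unit_circle \<Longrightarrow> g z = f z) \<Longrightarrow> L1_circle g"
  by (erule L1_circle_cong_AE) (rule AE_circleI)

lemma L1_circle_add: "L1_circle f \<Longrightarrow> L1_circle g \<Longrightarrow> L1_circle (\<lambda>z. f z + g z)"
  unfolding L1_circle_def by (rule Bochner_Integration.integrable_add)

lemma continuous_on_L1_circle: "continuous_on unit_circle f \<Longrightarrow> L1_circle f"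
  unfolding L1_circle_def
  by (simp add: integrable_completion continuous_on_integrable_circle continuous_on_borel_measurable_circle)

lemma continuous_on_circle_powi: "continuous_on unit_circle (\<lambda>z::complex. c * z powi k)"
  by (intro continuous_intros) auto

lemma L1_circle_powi:
  assumes "L1_circle f"
  shows "L1_circle (\<lambda>z. c * z powi k * f z)"
  unfolding L1_circle_def
proof (rule Bochner_Integration.integrable_bound[of _ "\<lambda>z. c * f z"])
  show "integrable (completion circle) (\<lambda>z. c * f z)" using assms unfolding L1_circle_def by simp
  show "(\<lambda>z. c * z powi k * f z) \<in> borel_measurable (completion circle)"
    using borel_measurable_times[OF measurable_completion[OF
        continuous_on_borel_measurable_circle[OF continuous_on_circle_powi]], of f] assms
    unfolding L1_circle_def by auto
  show "AE z in completion circle. norm (c * z powi k * f z) \<le> norm (c * f z)"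
    using AE_completion[OF AE_circle_unit_circle]
    by eventually_elim (simp add: norm_mult norm_power_int)
qed

text \<open>Differentiability and integrability in a form that peels off one derivative at a time,
  suited to induction. Integrability is demanded only at the end of the recursion, since continuity
  supplies it before; existence almost everywhere is allowed only for the last derivative.\<close>

fun circle_regular :: "nat \<Rightarrow> (complex \<Rightarrow> complex) \<Rightarrow> bool" where
  "circle_regular 0 f = L1_circle f"
| "circle_regular (Suc n) f = (continuous_on unit_circle f \<and>
    (if n = 0 then AE z in circle. f field_differentiable (at z within unit_circle)
     else \<forall>z\<in>unit_circle. f field_differentiable (at z within unit_circle)) \<and> circle_regular n (circle_deriv f))"

lemma times_differentiable_Suc:
  "times_differentiable (Suc n) f \<longleftrightarrow> continuous_on unit_circle f \<and>
    (if n = 0 then AE z in circle. f field_differentiable (at z within unit_circle)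
     else \<forall>z\<in>unit_circle. f field_differentiable (at z within unit_circle)) \<and>
    times_differentiable n (circle_deriv f)"
proof -
  have shift: "(\<forall>j. Suc j < Suc n \<longrightarrow> P j) \<longleftrightarrow> (n > 0 \<longrightarrow> P 0) \<and> (\<forall>j. Suc j < n \<longrightarrow> P (Suc j))" for P
    by (metis Suc_less_eq gr0_conv_Suc not0_implies_Suc)
  have comm: "(circle_deriv ^^ j) (circle_deriv f) = (circle_deriv ^^ Suc j) f" for j
    by (simp only: funpow_Suc_right o_apply)
  show ?thesis
  proof (cases n)
    case (Suc m)
    then have "(\<forall>j. Suc j = Suc n \<longrightarrow> P j) \<longleftrightarrow> (\<forall>j. Suc j = n \<longrightarrow> P (Suc j))" for P by auto
    then show ?thesis using Suc
      unfolding times_differentiable_def All_less_Suc2 shift comm by (simp add: conj_ac del: funpow.simps(2))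
  qed (auto simp: times_differentiable_def)
qed

lemma circle_regular_iff: "circle_regular n f \<longleftrightarrow> times_differentiable n f \<and> (\<forall>j\<le>n. L1_circle ((circle_deriv ^^ j) f))"
proof (induction n arbitrary: f)
  case 0
  then show ?case by (simp add: times_differentiable_def)
next
  case (Suc n)
  have "(\<forall>j\<le>Suc n. L1_circle ((circle_deriv ^^ j) f)) \<longleftrightarrow>
    L1_circle f \<and> (\<forall>j\<le>n. L1_circle ((circle_deriv ^^ j) (circle_deriv f)))"
    unfolding less_Suc_eq_le[symmetric] All_less_Suc2 by (auto simp: funpow_Suc_right simp del: funpow.simps)
  then show ?case
    unfolding times_differentiable_Suc circle_regular.simps Suc using continuous_on_L1_circle[of f] by auto
qed

lemma circle_regular_cong: "circle_regular n f \<Longrightarrow> (\<And>z. z \<in> unit_circle \<Longrightarrow> g z = f z) \<Longrightarrow> circle_regular n g"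
proof (induction n arbitrary: f g)
  case 0
  then show ?case by (auto intro: L1_circle_cong)
next
  case (Suc n)
  note gf = Suc.prems(2)
  have f: "continuous_on unit_circle f" "circle_regular n (circle_deriv f)"
    "if n = 0 then AE z in circle. f field_differentiable (at z within unit_circle)
     else \<forall>z\<in>unit_circle. f field_differentiable (at z within unit_circle)"
    using Suc.prems(1) by simp_all
  have "continuous_on unit_circle g"
    using f(1) by (subst continuous_on_cong[OF refl gf])
  moreover have "circle_regular n (circle_deriv g)"
    by (rule Suc.IH[OF f(2) circle_deriv_cong[OF gf]])
  moreover have d: "g field_differentiable (at z within unit_circle)"
    if "z \<in> unit_circle" "f field_differentiable (at z within unit_circle)" for z
    using that field_differentiable_circle_cong[of g f z, OF gf] by blast
  moreover have "AE z in circle. g field_differentiable (at z within unit_circle)" if "n = 0"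
  proof -
    have "AE z in circle. f field_differentiable (at z within unit_circle)" using that f(3) by simp
    with AE_circle_unit_circle show ?thesis by eventually_elim (rule d)
  qed
  ultimately show ?case using f(3) by simp
qed

text \<open>At order 0 the class does not see null sets, which absorbs the points where the last
  derivative fails to exist; at higher orders the equality must hold at every point of the
  circle.\<close>

lemma circle_regular_circle_derivI:
  assumes "circle_regular n G" and "if n = 0 then AE z in circle. circle_deriv F z = G z
    else \<forall>z\<in>unit_circle. circle_deriv F z = G z"
  shows "circle_regular n (circle_deriv F)"
  using assms by (cases "n = 0") (auto intro: L1_circle_cong_AE circle_regular_cong)

lemma circle_regular_add: "circle_regular n f \<Longrightarrow> circle_regular n g \<Longrightarrow> circle_regular n (\<lambda>z. f z + g z)"
proof (induction n arbitrary: f g)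
  case 0
  then show ?case by (simp add: L1_circle_add)
next
  case (Suc n)
  have d: "(\<lambda>z. f z + g z) field_differentiable (at z within unit_circle) \<and>
      circle_deriv (\<lambda>z. f z + g z) z = circle_deriv f z + circle_deriv g z"
    if "z \<in> unit_circle" "f field_differentiable (at z within unit_circle)" "g field_differentiable (at z within unit_circle)" for z
    using that by (auto intro!: field_differentiable_add circle_deriv_eqI DERIV_add has_field_derivative_circle_deriv)
  have "circle_regular n (circle_deriv (\<lambda>z. f z + g z))"
  proof (rule circle_regular_circle_derivI)
    show "circle_regular n (\<lambda>z. circle_deriv f z + circle_deriv g z)" using Suc.prems by (intro Suc.IH) auto
    show "if n = 0 then AE z in circle. circle_deriv (\<lambda>z. f z + g z) z = circle_deriv f z + circle_deriv g z
      else \<forall>z\<in>unit_circle. circle_deriv (\<lambda>z. f z + g z) z = circle_deriv f z + circle_deriv g z"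
    proof (cases "n = 0")
      case True
      then have "AE z in circle. f field_differentiable (at z within unit_circle)"
        "AE z in circle. g field_differentiable (at z within unit_circle)" using Suc.prems by auto
      with AE_circle_unit_circle have "AE z in circle. circle_deriv (\<lambda>z. f z + g z) z = circle_deriv f z + circle_deriv g z"
        by eventually_elim (use d in blast)
      then show ?thesis using True by simp
    qed (use Suc.prems d in auto)
  qed
  moreover have "AE z in circle. (\<lambda>z. f z + g z) field_differentiable (at z within unit_circle)" if "n = 0"
  proof -
    have "AE z in circle. f field_differentiable (at z within unit_circle)"
      "AE z in circle. g field_differentiable (at z within unit_circle)" using Suc.prems that by auto
    with AE_circle_unit_circle show ?thesis by eventually_elim (use d in blast)
  qed
  ultimately show ?case using Suc.prems d by (auto intro!: continuous_on_add)
qed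

lemma circle_regular_SucD: "circle_regular (Suc n) f \<Longrightarrow> circle_regular n f"
proof (induction n arbitrary: f)
  case 0
  then show ?case by (simp add: continuous_on_L1_circle)
next
  case (Suc n)
  have "\<forall>z\<in>unit_circle. f field_differentiable (at z within unit_circle)" using Suc.prems by simp
  then have "AE z in circle. f field_differentiable (at z within unit_circle)"
    by (intro AE_circleI) blast
  then show ?case using Suc.prems Suc.IH[of "circle_deriv f"] by simp
qed

text \<open>The constant and the exponent are generalised because the product rule returns a
  monomial multiple of \<open>f\<close> with other constants. It carries the regularity of
  \<open>g\<close> over to the weight.\<close>

lemma circle_regular_powi: "circle_regular n f \<Longrightarrow> circle_regular n (\<lambda>z. c * z powi k * f z)"
proof (induction n arbitrary: f c k)
  case 0
  then show ?case by (simp add: L1_circle_powi)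
next
  case (Suc n)
  define F where "F = (\<lambda>z. c * z powi k * f z)"
  define G where "G = (\<lambda>z. (c * of_int k) * z powi (k - 1) * f z + c * z powi k * circle_deriv f z)"
  have d: "F field_differentiable (at z within unit_circle) \<and> circle_deriv F z = G z"
    if z: "z \<in> unit_circle" and f: "f field_differentiable (at z within unit_circle)" for z
  proof -
    have "z \<noteq> 0" using z by auto
    then have "(F has_field_derivative G z) (at z within unit_circle)" unfolding F_def G_def
      by (auto intro!: derivative_eq_intros has_field_derivative_circle_deriv[OF f])
    then show ?thesis using circle_deriv_eqI[OF _ z] by (auto simp: field_differentiable_def)
  qed
  have "circle_regular n f" "circle_regular n (circle_deriv f)" using circle_regular_SucD[OF Suc.prems] Suc.prems by simp_all
  then have G: "circle_regular n G" unfolding G_def by (intro circle_regular_add Suc.IH)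
  show ?case unfolding F_def[symmetric]
  proof (cases "n = 0")
    case True
    then have ae: "AE z in circle. f field_differentiable (at z within unit_circle)" using Suc.prems by auto
    have "AE z in circle. circle_deriv F z = G z" "AE z in circle. F field_differentiable (at z within unit_circle)"
      by (use ae AE_circle_unit_circle in eventually_elim, use d in blast)+
    moreover have "continuous_on unit_circle F" unfolding F_def
      using Suc.prems by (intro continuous_on_mult continuous_on_circle_powi) auto
    ultimately show "circle_regular (Suc n) F" using True circle_regular_circle_derivI[OF G] by auto
  next
    case False
    moreover have "continuous_on unit_circle F" unfolding F_def
      using Suc.prems by (intro continuous_on_mult continuous_on_circle_powi) auto
    moreover have "circle_regular n (circle_deriv F)"
      using False Suc.prems d by (intro circle_regular_circle_derivI[OF G]) auto
    ultimately show "circle_regular (Suc n) F" using Suc.prems d by auto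
  qed
qed

text \<open>Conjugating with \<open>z powr \<kappa>\<close>, \<open>\<kappa> = (N - 1) / 2\<close>, turns the derivation \<open>- z d/dz\<close> into \<open>shifted_deriv \<kappa>\<close>.\<close>

definition shifted_deriv :: "real \<Rightarrow> (complex \<Rightarrow> complex) \<Rightarrow> complex \<Rightarrow> complex" where
  "shifted_deriv \<kappa> f u = - u * circle_deriv f u - of_real \<kappa> * f u"

lemma circle_regular_shifted_deriv: "circle_regular (Suc n) f \<Longrightarrow> circle_regular n (shifted_deriv \<kappa> f)"
proof -
  assume f: "circle_regular (Suc n) f"
  have "circle_regular n f" "circle_regular n (circle_deriv f)" using circle_regular_SucD[OF f] f by simp_all
  then have "circle_regular n (\<lambda>z. (- 1) * z powi 1 * circle_deriv f z + (- of_real \<kappa>) * z powi 0 * f z)"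
    by (intro circle_regular_add circle_regular_powi)
  then show ?thesis by (rule circle_regular_cong) (simp add: shifted_deriv_def)
qed

lemma circle_regular_shifted_deriv_funpow: "circle_regular n f \<Longrightarrow> b \<le> n \<Longrightarrow> circle_regular (n - b) ((shifted_deriv \<kappa> ^^ b) f)"
proof (induction b)
  case (Suc b)
  then have "circle_regular (Suc (n - Suc b)) ((shifted_deriv \<kappa> ^^ b) f)" by (simp add: Suc_diff_Suc)
  then show ?case by (simp add: circle_regular_shifted_deriv)
qed simp

lemma
  assumes "circle_regular n f"
  shows shifted_deriv_continuous: "b < n \<Longrightarrow> continuous_on unit_circle ((shifted_deriv \<kappa> ^^ b) f)"
    and shifted_deriv_differentiable: "Suc b < n \<Longrightarrow> z \<in> unit_circle \<Longrightarrow>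
      (shifted_deriv \<kappa> ^^ b) f field_differentiable (at z within unit_circle)"
    and shifted_deriv_AE_differentiable: "b < n \<Longrightarrow>
      AE z in circle. (shifted_deriv \<kappa> ^^ b) f field_differentiable (at z within unit_circle)"
    and shifted_deriv_L1: "b \<le> n \<Longrightarrow> L1_circle ((shifted_deriv \<kappa> ^^ b) f)"
proof -
  have *: "circle_regular (Suc (n - Suc b)) ((shifted_deriv \<kappa> ^^ b) f)" if "b < n" for b
    using circle_regular_shifted_deriv_funpow[OF assms, of b] that by (simp add: Suc_diff_Suc)
  show "b < n \<Longrightarrow> continuous_on unit_circle ((shifted_deriv \<kappa> ^^ b) f)" using *[of b] by simp
  show "Suc b < n \<Longrightarrow> z \<in> unit_circle \<Longrightarrow>
      (shifted_deriv \<kappa> ^^ b) f field_differentiable (at z within unit_circle)" using *[of b] by simp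
  show "b < n \<Longrightarrow> AE z in circle. (shifted_deriv \<kappa> ^^ b) f field_differentiable (at z within unit_circle)"
    using *[of b] by (auto split: if_splits intro: AE_circleI)
  have "circle_regular (n - b) g \<Longrightarrow> L1_circle g" for g
    by (cases "n - b") (auto intro: continuous_on_L1_circle)
  then show "b \<le> n \<Longrightarrow> L1_circle ((shifted_deriv \<kappa> ^^ b) f)"
    using circle_regular_shifted_deriv_funpow[OF assms] by blast
qed

lemma shifted_deriv_cis_derivative:
  assumes "f field_differentiable (at (cis t) within unit_circle)"
  shows "((\<lambda>t. cis (\<kappa> * t) * f (cis t)) has_vector_derivative - \<i> * cis (\<kappa> * t) * shifted_deriv \<kappa> f (cis t)) (at t)"
proof -
  have "((\<lambda>t. cis (\<kappa> * t)) has_vector_derivative \<i> * \<kappa> * cis (\<kappa> * t)) (at t)"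
    by (rule has_vector_derivative_cis_mult)
  from has_vector_derivative_mult[OF this has_vector_derivative_comp_cis[OF has_field_derivative_circle_deriv[OF assms]]]
  show ?thesis by (simp add: shifted_deriv_def algebra_simps)
qed

text \<open>Coefficients of \<open>(X - \<kappa>) ^ b\<close>, built by the Pascal type
  recursion.\<close>

primrec shift_coeff :: "real \<Rightarrow> nat \<Rightarrow> nat \<Rightarrow> complex" where
  "shift_coeff \<kappa> 0 = (\<lambda>l. if l = 0 then 1 else 0)"
| "shift_coeff \<kappa> (Suc b) = (\<lambda>l. (if l = 0 then 0 else shift_coeff \<kappa> b (l - 1)) - of_real \<kappa> * shift_coeff \<kappa> b l)"

lemma shift_coeff_eq_0: "l > b \<Longrightarrow> shift_coeff \<kappa> b l = 0"
  by (induction b arbitrary: l) auto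

lemma shift_coeff_diag: "shift_coeff \<kappa> b b = 1"
  by (induction b) (auto simp: shift_coeff_eq_0)

text \<open>To differentiate the expansion of order \<open>b\<close> it must hold on the whole
  circle. This is so below the top order, where all derivatives involved exist everywhere; at the
  top order it holds at the points where the last one exists.\<close>

lemma shifted_deriv_funpow_expansion:
  assumes f: "circle_regular n f" and "b \<le> n" "z \<in> unit_circle"
    and "\<And>l. l < b \<Longrightarrow> (shifted_deriv 0 ^^ l) f field_differentiable (at z within unit_circle)"
  shows "(shifted_deriv \<kappa> ^^ b) f z = (\<Sum>l\<le>b. shift_coeff \<kappa> b l * (shifted_deriv 0 ^^ l) f z)"
  using assms(2-)
proof (induction b arbitrary: z)
  case 0
  then show ?case by simp
next
  case (Suc b)
  let ?D = "\<lambda>l. (shifted_deriv 0 ^^ l) f"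
  define S where "S z = (\<Sum>l\<le>b. shift_coeff \<kappa> b l * ?D l z)" for z
  have eq: "(shifted_deriv \<kappa> ^^ b) f w = S w" if "w \<in> unit_circle" for w
    unfolding S_def using Suc.prems(1) that
    by (intro Suc.IH shifted_deriv_differentiable[OF f]) auto
  have "(S has_field_derivative (\<Sum>l\<le>b. shift_coeff \<kappa> b l * circle_deriv (?D l) z)) (at z within unit_circle)"
    unfolding S_def
    by (intro DERIV_sum DERIV_cmult has_field_derivative_circle_deriv Suc.prems(3)) auto
  then have "circle_deriv S z = (\<Sum>l\<le>b. shift_coeff \<kappa> b l * circle_deriv (?D l) z)"
    using Suc.prems(2) by (rule circle_deriv_eqI)
  moreover have "circle_deriv ((shifted_deriv \<kappa> ^^ b) f) z = circle_deriv S z"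
    using eq Suc.prems(2) by (rule circle_deriv_cong)
  ultimately have "(shifted_deriv \<kappa> ^^ Suc b) f z
      = - z * (\<Sum>l\<le>b. shift_coeff \<kappa> b l * circle_deriv (?D l) z) - of_real \<kappa> * S z"
    using eq[OF Suc.prems(2)] by (simp add: shifted_deriv_def)
  also have "\<dots> = (\<Sum>l\<le>b. shift_coeff \<kappa> b l * ?D (Suc l) z) - of_real \<kappa> * S z"
    by (simp add: shifted_deriv_def sum_distrib_left sum_negf algebra_simps)
  also have "(\<Sum>l\<le>b. shift_coeff \<kappa> b l * ?D (Suc l) z) = (\<Sum>l\<le>Suc b. (if l = 0 then 0 else shift_coeff \<kappa> b (l - 1)) * ?D l z)"
    by (subst sum.atMost_Suc_shift) simp
  also have "of_real \<kappa> * S z = (\<Sum>l\<le>Suc b. of_real \<kappa> * shift_coeff \<kappa> b l * ?D l z)"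
    by (simp add: S_def shift_coeff_eq_0 sum_distrib_left mult.assoc)
  finally show ?case
    by (simp only: sum_subtractf[symmetric] left_diff_distrib[symmetric] shift_coeff.simps)
qed

section \<open>Integration by parts\<close>

text \<open>Over a partition into \<open>n\<close> equal parts the bounds sum to
  \<open>p * (\<Psi> p - \<Psi> 0) / n\<close>. This proves constancy without differentiating
  \<open>G\<close>.\<close>

lemma telescoping_square_bound:
  fixes G :: "real \<Rightarrow> complex" and \<Psi> :: "real \<Rightarrow> real"
  assumes "p \<ge> 0" and b: "\<And>x y. 0 \<le> x \<Longrightarrow> x \<le> y \<Longrightarrow> y \<le> p \<Longrightarrow> norm (G y - G x) \<le> (y - x) * (\<Psi> y - \<Psi> x)"
  shows "G p = G 0"
proof -
  have le: "norm (G p - G 0) \<le> p * (\<Psi> p - \<Psi> 0) / real (Suc n)" for n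
  proof -
    define x where "x i = p * real i / real (Suc n)" for i
    have x: "x 0 = 0" "x (Suc n) = p" by (simp_all add: x_def del: of_nat_Suc)
    have step: "x (Suc i) - x i = p / real (Suc n)" for i
      by (simp add: x_def diff_divide_distrib[symmetric] right_diff_distrib[symmetric])
    have mono: "x i \<le> x (Suc i)" for i
      using step[of i] assms(1) divide_nonneg_nonneg[of p "real (Suc n)"] by linarith
    have le: "x i \<le> p" if "i \<le> Suc n" for i
    proof -
      have "p * real i \<le> p * real (Suc n)" using that assms(1) by (intro mult_left_mono) auto
      then show ?thesis by (simp add: x_def divide_le_eq)
    qed
    have ge: "0 \<le> x i" for i using assms(1) by (simp add: x_def)
    have "G p - G 0 = (\<Sum>i<Suc n. G (x (Suc i)) - G (x i))" using sum_lessThan_telescope[of "\<lambda>i. G (x i)" "Suc n"] x by simp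
    also have "norm \<dots> \<le> (\<Sum>i<Suc n. norm (G (x (Suc i)) - G (x i)))" by (rule norm_sum)
    also have "\<dots> \<le> (\<Sum>i<Suc n. p / real (Suc n) * (\<Psi> (x (Suc i)) - \<Psi> (x i)))"
      using b[OF ge mono le] step by (intro sum_mono) auto
    also have "\<dots> = p / real (Suc n) * (\<Psi> p - \<Psi> 0)"
      using sum_lessThan_telescope[of "\<lambda>i. \<Psi> (x i)" "Suc n"] x by (simp only: sum_distrib_left[symmetric])
    finally show ?thesis by simp
  qed
  have "(\<lambda>n. p * (\<Psi> p - \<Psi> 0) * (1 / real (Suc n))) \<longlonglongrightarrow> p * (\<Psi> p - \<Psi> 0) * 0"
    by (intro tendsto_intros LIMSEQ_Suc[OF lim_1_over_n])
  then have "norm (G p - G 0) \<le> 0"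
    using le by (intro LIMSEQ_le_const[of "\<lambda>n. p * (\<Psi> p - \<Psi> 0) * (1 / real (Suc n))"]) auto
  then show ?thesis by simp
qed

text \<open>Let \<open>G\<close> be the defect of the formula on \<open>{0..x}\<close>. On a short
  interval its increment is at most the length times a constant times the integral of
  \<open>norm (f t)\<close>, since both \<open>g\<close> and \<open>H\<close> vary little there;
  \<open>telescoping_square_bound\<close> then makes it constant.\<close>

lemma integration_by_parts_indefinite:
  fixes g g' H f :: "real \<Rightarrow> complex"
  assumes p: "0 \<le> p" and g: "\<And>t. t \<in> {0..p} \<Longrightarrow> (g has_vector_derivative g' t) (at t within {0..p})"
    and g': "continuous_on {0..p} g'"
    and f: "f absolutely_integrable_on {0..p}"
    and H: "\<And>x y. 0 \<le> x \<Longrightarrow> x \<le> y \<Longrightarrow> y \<le> p \<Longrightarrow> integral {x..y} f = H y - H x"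
  shows "integral {0..p} (\<lambda>t. g' t * H t) + integral {0..p} (\<lambda>t. g t * f t) = g p * H p - g 0 * H 0"
    and "(\<lambda>t. g t * f t) integrable_on {0..p}"
proof -
  have fi: "f integrable_on {x..y}" "(\<lambda>t. norm (f t)) integrable_on {x..y}" if "0 \<le> x" "y \<le> p" for x y
    using f that unfolding absolutely_integrable_on_def by (auto intro: integrable_on_subinterval)
  have gc: "continuous_on {0..p} g" by (rule continuous_on_vector_derivative[OF g])
  have Hc: "continuous_on {0..p} H"
  proof -
    have "continuous_on {0..p} (\<lambda>x. H 0 + integral {0..x} f)"
      using fi[of 0 p] by (intro continuous_intros indefinite_integral_continuous_1) auto
    then show ?thesis by (rule continuous_on_eq) (use H[of 0] in auto)
  qed
  have gf: "(\<lambda>t. g t * f t) absolutely_integrable_on {0..p}"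
    using gc by (intro absolutely_integrable_bounded_measurable_product[of "\<lambda>x y. x * y"])
      (auto intro!: continuous_imp_measurable_on_sets_lebesgue f compact_imp_bounded compact_continuous_image
        simp: bilinear_conv_bounded_bilinear bounded_bilinear_mult)
  then show gfi: "(\<lambda>t. g t * f t) integrable_on {0..p}" by (auto simp: absolutely_integrable_on_def)
  have g'H: "(\<lambda>t. g' t * H t) integrable_on {x..y}" if "0 \<le> x" "y \<le> p" for x y
    using that by (intro integrable_continuous_real continuous_intros continuous_on_subset[OF g'] continuous_on_subset[OF Hc]) auto
  have gfxy: "(\<lambda>t. g t * f t) integrable_on {x..y}" if "0 \<le> x" "y \<le> p" for x y
    using that by (auto intro: integrable_on_subinterval[OF gfi])
  obtain C where C: "\<And>t. t \<in> {0..p} \<Longrightarrow> norm (g' t) \<le> C" and C0: "C \<ge> 0"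
  proof -
    have "bounded (g' ` {0..p})" using g' by (intro compact_imp_bounded compact_continuous_image) auto
    then obtain C where C: "\<forall>t\<in>{0..p}. norm (g' t) \<le> C" by (auto simp: bounded_iff)
    moreover have "0 \<le> C" using C p norm_ge_zero[of "g' 0"] by (meson atLeastAtMost_iff order.refl order_trans)
    ultimately show ?thesis using that by blast
  qed
  define \<Phi> where "\<Phi> x = integral {0..x} (\<lambda>t. norm (f t))" for x
  have \<Phi>: "\<Phi> y - \<Phi> x = integral {x..y} (\<lambda>t. norm (f t))" if "0 \<le> x" "x \<le> y" "y \<le> p" for x y
    using Henstock_Kurzweil_Integration.integral_combine[of 0 x y "\<lambda>t. norm (f t)"] fi(2)[of 0 y] that by (simp add: \<Phi>_def)
  define G where "G x = g x * H x - integral {0..x} (\<lambda>t. g' t * H t) - integral {0..x} (\<lambda>t. g t * f t)" for x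
  have "G p = G 0"
  proof (rule telescoping_square_bound[OF p])
    fix x y assume xy: "0 \<le> x" "x \<le> y" "y \<le> p"
    have gd: "(g has_vector_derivative g' t) (at t within {x..y})" if "t \<in> {x..y}" for t
      using g[of t] that xy by (auto intro: has_vector_derivative_within_subset)
    have g'i: "g' integrable_on {x..y}"
      using xy by (intro integrable_continuous_real continuous_on_subset[OF g']) auto
    have gint: "integral {x..y} g' = g y - g x"
      using gd xy by (intro integral_unique fundamental_theorem_of_calculus) auto
    have "G y - G x = g y * H y - g x * H x - integral {x..y} (\<lambda>t. g' t * H t) - integral {x..y} (\<lambda>t. g t * f t)"
      using Henstock_Kurzweil_Integration.integral_combine[of 0 x y "\<lambda>t. g' t * H t"] g'H[of 0 y]
        Henstock_Kurzweil_Integration.integral_combine[of 0 x y "\<lambda>t. g t * f t"] gfxy[of 0 y] xy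
      by (simp add: G_def algebra_simps)
    also have "g y * H y - g x * H x = g y * integral {x..y} f + integral {x..y} g' * H x"
      using xy by (simp add: H gint algebra_simps)
    also have "g y * integral {x..y} f = integral {x..y} (\<lambda>t. g y * f t)" by simp
    also have "integral {x..y} g' * H x = integral {x..y} (\<lambda>t. g' t * H x)" by simp
    also have "integral {x..y} (\<lambda>t. g y * f t) + integral {x..y} (\<lambda>t. g' t * H x) -
        integral {x..y} (\<lambda>t. g' t * H t) - integral {x..y} (\<lambda>t. g t * f t)
      = (integral {x..y} (\<lambda>t. g y * f t) - integral {x..y} (\<lambda>t. g t * f t)) +
        (integral {x..y} (\<lambda>t. g' t * H x) - integral {x..y} (\<lambda>t. g' t * H t))" by simp
    also have "integral {x..y} (\<lambda>t. g y * f t) - integral {x..y} (\<lambda>t. g t * f t) = integral {x..y} (\<lambda>t. (g y - g t) * f t)"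
      unfolding left_diff_distrib using xy by (intro integral_diff[symmetric] gfxy integrable_on_mult_right fi)
    also have "integral {x..y} (\<lambda>t. g' t * H x) - integral {x..y} (\<lambda>t. g' t * H t) = integral {x..y} (\<lambda>t. g' t * (H x - H t))"
      unfolding right_diff_distrib using xy by (intro integral_diff[symmetric] g'H integrable_on_mult_left g'i) auto
    finally have eq: "G y - G x = integral {x..y} (\<lambda>t. (g y - g t) * f t) + integral {x..y} (\<lambda>t. g' t * (H x - H t))" .
    have b1: "norm (integral {x..y} (\<lambda>t. (g y - g t) * f t)) \<le> integral {x..y} (\<lambda>t. (C * (y - x)) * norm (f t))"
    proof (rule integral_norm_bound_integral)
      show "(\<lambda>t. (g y - g t) * f t) integrable_on {x..y}"
        unfolding left_diff_distrib using xy by (intro integrable_diff gfxy integrable_on_mult_right fi)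
      show "(\<lambda>t. (C * (y - x)) * norm (f t)) integrable_on {x..y}"
        using xy by (intro integrable_on_mult_right fi)
      fix t assume t: "t \<in> {x..y}"
      have "norm (g y - g t) \<le> C * norm (y - t)"
      proof -
        have "(g' has_integral (g y - g t)) {t..y}"
          using t xy by (intro fundamental_theorem_of_calculus has_vector_derivative_within_subset[OF gd]) auto
        then have "norm (g y - g t) \<le> C * measure lborel {t..y}"
          by (rule has_integral_bound_real[OF C0 finite.emptyI]) (use t xy in \<open>auto intro!: C\<close>)
        then show ?thesis using t by simp
      qed
      also have "\<dots> \<le> C * (y - x)" using t C0 by (intro mult_left_mono) auto
      finally show "norm ((g y - g t) * f t) \<le> (C * (y - x)) * norm (f t)"
        by (simp add: norm_mult mult_right_mono)
    qed
    have b2: "norm (integral {x..y} (\<lambda>t. g' t * (H x - H t))) \<le> integral {x..y} (\<lambda>t. C * (\<Phi> y - \<Phi> x))"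
    proof (rule integral_norm_bound_integral)
      show "(\<lambda>t. g' t * (H x - H t)) integrable_on {x..y}"
        unfolding right_diff_distrib using xy by (intro integrable_diff g'H integrable_on_mult_left g'i) auto
      fix t assume t: "t \<in> {x..y}"
      have "norm (H t - H x) \<le> \<Phi> t - \<Phi> x"
      proof -
        have "norm (integral {x..t} f) \<le> integral {x..t} (\<lambda>t. norm (f t))"
          using t xy by (intro integral_norm_bound_integral fi) auto
        then show ?thesis using H[of x t] \<Phi>[of x t] t xy by simp
      qed
      also have "\<dots> \<le> \<Phi> y - \<Phi> x"
      proof -
        have "0 \<le> integral {t..y} (\<lambda>t. norm (f t))" using fi[of t y] t xy by (intro integral_nonneg) auto
        then show ?thesis using \<Phi>[of t y] t xy by auto
      qed
      finally show "norm (g' t * (H x - H t)) \<le> C * (\<Phi> y - \<Phi> x)"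
        unfolding norm_mult using C[of t] t xy C0 by (intro mult_mono) (auto simp: norm_minus_commute)
    qed auto
    have "norm (G y - G x) \<le> integral {x..y} (\<lambda>t. (C * (y - x)) * norm (f t)) + integral {x..y} (\<lambda>t. C * (\<Phi> y - \<Phi> x))"
      unfolding eq by (rule order_trans[OF norm_triangle_ineq add_mono[OF b1 b2]])
    also have "\<dots> = (y - x) * (2 * C * \<Phi> y - 2 * C * \<Phi> x)"
    proof -
      have "integral {x..y} (\<lambda>t. (C * (y - x)) * norm (f t)) = (C * (y - x)) * (\<Phi> y - \<Phi> x)"
        unfolding \<Phi>[OF xy] by (rule integral_mult_right)
      moreover have "integral {x..y} (\<lambda>t. C * (\<Phi> y - \<Phi> x)) = (y - x) * (C * (\<Phi> y - \<Phi> x))" using xy by simp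
      ultimately show ?thesis by (simp add: algebra_simps)
    qed
    finally show "norm (G y - G x) \<le> (y - x) * ((2 * C * \<Phi> y) - (2 * C * \<Phi> x))" .
  qed
  then show "integral {0..p} (\<lambda>t. g' t * H t) + integral {0..p} (\<lambda>t. g t * f t) = g p * H p - g 0 * H 0"
    by (simp add: G_def algebra_simps)
qed

text \<open>Translation from the completed Haar measure to the gauge integral over the angles, in
  which integration by parts is carried out.\<close>

lemma
  assumes "L1_circle f"
  shows L1_circle_absolutely_integrable: "(\<lambda>t. f (cis t)) absolutely_integrable_on {0..2 * pi}"
    and L1_circle_integral: "integral\<^sup>L (completion circle) f = integral {0..2 * pi} (\<lambda>t. f (cis t)) / (2 * pi)"
proof -
  obtain \<phi> where \<phi>: "integrable circle \<phi>" "AE z in circle. f z = \<phi> z"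
    using assms integrable_completion_representative unfolding L1_circle_def by blast
  have m: "\<phi> \<in> borel_measurable circle" using \<phi>(1) by auto
  have si: "set_integrable lborel {0..2 * pi} (\<lambda>t. \<phi> (cis t))" using \<phi>(1) integrable_circle[OF m] by simp
  have ai: "(\<lambda>t. \<phi> (cis t)) absolutely_integrable_on {0..2 * pi}"
    using si unfolding set_integrable_def by (subst integrable_completion) auto
  have ae: "AE t in lborel. t \<in> {0..2 * pi} \<longrightarrow> f (cis t) = \<phi> (cis t)" by (rule AE_circleD[OF \<phi>(2)])
  then have ae': "AE t in lborel. t \<in> {0..2 * pi} \<longrightarrow> norm (f (cis t)) = norm (\<phi> (cis t))" by eventually_elim auto
  have ai': "(\<lambda>t. \<phi> (cis t)) integrable_on {0..2 * pi}" "(\<lambda>t. norm (\<phi> (cis t))) integrable_on {0..2 * pi}"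
    using ai unfolding absolutely_integrable_on_def by auto
  show "(\<lambda>t. f (cis t)) absolutely_integrable_on {0..2 * pi}"
    using ai' has_integral_AE[OF ae] has_integral_AE[OF ae'] unfolding absolutely_integrable_on_def integrable_on_def by blast
  have "integral\<^sup>L (completion circle) f = integral\<^sup>L circle \<phi>"
    by (rule integral_completion_cong_AE[OF m \<phi>(2)])
  also have "\<dots> = (LINT t:{0..2 * pi}|lborel. \<phi> (cis t)) / (2 * pi)" by (rule integral_circle[OF m])
  also have "(LINT t:{0..2 * pi}|lborel. \<phi> (cis t)) = integral {0..2 * pi} (\<lambda>t. \<phi> (cis t))"
    by (rule set_borel_integral_eq_integral(2)[OF si])
  also have "\<dots> = integral {0..2 * pi} (\<lambda>t. f (cis t))"
    using has_integral_AE[OF ae] unfolding integral_def integrable_on_def by simp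
  finally show "integral\<^sup>L (completion circle) f = integral {0..2 * pi} (\<lambda>t. f (cis t)) / (2 * pi)" .
qed

section \<open>Vandermonde determinants of points on the circle\<close>

lemma cis_diff: "cis b - cis a = cis ((a + b) / 2) * (2 * \<i> * of_real (sin ((b - a) / 2)))"
proof -
  have "cis b = cis ((a + b) / 2) * cis ((b - a) / 2)" "cis a = cis ((a + b) / 2) * cis (- ((b - a) / 2))"
    unfolding cis_mult by (auto simp: field_simps)
  moreover have "cis x - cis (- x) = 2 * \<i> * of_real (sin x)" for x by (simp add: complex_eq_iff)
  ultimately show ?thesis by (metis right_diff_distrib)
qed

text \<open>Each difference is a half-angle phase times \<open>2 * \<i>\<close> times a sine. Every
  index lies in \<open>N - 1\<close> pairs, which produces the exponent
  \<open>(N - 1) / 2\<close>.\<close>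

lemma vandermonde_cis:
  "vandermonde N (\<lambda>a. cis (\<alpha> a)) = (\<Prod>a<N. cis ((real N - 1) / 2 * \<alpha> a)) * (\<Prod>b<N. \<Prod>a<b. 2 * \<i>) * of_real (sine_vandermonde N \<alpha>)"
proof -
  have ph: "(\<Prod>b<N. \<Prod>a<b. cis ((\<alpha> a + \<alpha> b) / 2)) = (\<Prod>a<N. cis ((real N - 1) / 2 * \<alpha> a))"
  proof (induction N)
    case (Suc n)
    have "(\<Prod>a<n. cis ((\<alpha> a + \<alpha> n) / 2)) = (\<Prod>a<n. cis (\<alpha> a / 2)) * cis (real n / 2 * \<alpha> n)"
    proof -
      have "cis ((\<alpha> a + \<alpha> n) / 2) = cis (\<alpha> a / 2) * cis (\<alpha> n / 2)" for a by (simp add: cis_mult add_divide_distrib)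
      moreover have "cis (\<alpha> n / 2) ^ n = cis (real n / 2 * \<alpha> n)"
        unfolding Complex.DeMoivre by (rule arg_cong[of _ _ cis]) simp
      ultimately show ?thesis by (simp add: prod.distrib)
    qed
    moreover have "cis ((real n - 1) / 2 * \<alpha> a) * cis (\<alpha> a / 2) = cis ((real (Suc n) - 1) / 2 * \<alpha> a)" for a
      by (simp add: cis_mult field_simps)
    ultimately show ?case using Suc by (simp add: prod.distrib[symmetric] mult.assoc[symmetric])
  qed simp
  show ?thesis
    unfolding vandermonde_def sine_vandermonde_def cis_diff prod.distrib of_real_prod by (simp add: ph prod.distrib mult.assoc)
qed

section \<open>The eigenvalue density of a Polya frequency function\<close>

lemma vandermonde_eq_fdet: "vandermonde N z = fdet N (\<lambda>a b. z a ^ b)"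
  by (simp add: vandermonde_def fdet_vandermonde)

lemma kernel_det_eq_fdet: "kernel_det N g x y = fdet N (\<lambda>a b. g (x a * inverse (y b)))"
  by (simp add: kernel_det_def fdet_def)

lemma inverse_eq_cnj: "z \<in> unit_circle \<Longrightarrow> inverse z = cnj z"
  by (simp add: inverse_complex_def complex_eq_iff cmod_def)

lemma inverse_unit_circle: "z \<in> unit_circle \<Longrightarrow> inverse z \<in> unit_circle"
  by (simp add: norm_inverse)

lemma vandermonde_inverse:
  assumes "\<And>a. a < N \<Longrightarrow> y a \<in> unit_circle"
  shows "vandermonde N (\<lambda>a. inverse (y a)) = cnj (vandermonde N y)"
  unfolding vandermonde_def cnj_prod using assms by (intro prod.cong refl) (simp add: inverse_eq_cnj)

lemma borel_measurable_circle_power: "(\<lambda>z::complex. z ^ j) \<in> borel_measurable circle"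
  by (intro continuous_on_borel_measurable_circle continuous_intros)

lemma integrable_circle_power_rotated:
  assumes "integrable circle \<phi>" "c \<in> unit_circle"
  shows "integrable circle (\<lambda>z. z ^ j * \<phi> (z * c))"
proof -
  have i: "integrable circle (\<lambda>z. \<phi> (z * c))"
    by (rule integrable_distr[OF circle_rotation_measurable[OF assms(2)]])
      (simp only: circle_rotation_invariant[OF assms(2)] assms(1))
  show ?thesis
  proof (rule Bochner_Integration.integrable_bound[OF i])
    show "(\<lambda>z. z ^ j * \<phi> (z * c)) \<in> borel_measurable circle"
      using i by (intro borel_measurable_times borel_measurable_circle_power) auto
    show "AE z in circle. norm (z ^ j * \<phi> (z * c)) \<le> norm (\<phi> (z * c))"
      by (rule AE_circleI) (simp add: norm_mult norm_power)
  qed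
qed

lemma AE_torus_space: "AE z in torus N. \<forall>a<N. z a \<in> unit_circle"
  using AE_space[of "torus N"] by eventually_elim (auto simp: space_torus PiE_iff)

lemma torus_quotient_measurable:
  assumes "a < N" "b < N"
  shows "(\<lambda>(x, y). x a * inverse (y b)) \<in> measurable (torus N \<Otimes>\<^sub>M torus N) circle"
proof -
  have m: "(\<lambda>z. z) \<in> borel_measurable circle" by (intro borel_measurable_circleI) simp
  have "(\<lambda>p. fst p a) \<in> borel_measurable (torus N \<Otimes>\<^sub>M torus N)"
    by (rule measurable_compose[OF measurable_compose[OF measurable_fst torus_component_measurable[OF assms(1)]] m])
  moreover have "(\<lambda>p. snd p b) \<in> borel_measurable (torus N \<Otimes>\<^sub>M torus N)"
    by (rule measurable_compose[OF measurable_compose[OF measurable_snd torus_component_measurable[OF assms(2)]] m])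
  ultimately have "(\<lambda>p. fst p a * inverse (snd p b)) \<in> borel_measurable (torus N \<Otimes>\<^sub>M torus N)"
    by measurable
  then have "(\<lambda>p. fst p a * inverse (snd p b)) \<in> measurable (torus N \<Otimes>\<^sub>M torus N) (restrict_space borel unit_circle)"
  proof (rule measurable_restrict_space2[rotated])
    show "(\<lambda>p. fst p a * inverse (snd p b)) \<in> space (torus N \<Otimes>\<^sub>M torus N) \<rightarrow> unit_circle"
    proof
      fix p assume "p \<in> space (torus N \<Otimes>\<^sub>M torus N)"
      then have "fst p \<in> space (torus N)" "snd p \<in> space (torus N)" by (auto simp: space_pair_measure)
      then have "fst p a \<in> unit_circle" "snd p b \<in> unit_circle"
        using assms unfolding space_torus by (auto simp only: PiE_iff lessThan_iff)
      then show "fst p a * inverse (snd p b) \<in> unit_circle" by (simp add: norm_mult norm_inverse)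
    qed
  qed
  then show ?thesis unfolding split_beta' by (subst measurable_cong_sets[OF refl sets_circle])
qed

text \<open>Odd and even order merge here: once the power of the determinant of
  \<open>x y^-1\<close> is absorbed into the weight, inequality and symmetry have the same form for
  every \<open>N\<close>.\<close>

locale pf_weight =
  fixes N :: nat and w :: "complex \<Rightarrow> complex"
  assumes N: "N \<ge> 1" and circle_regular: "circle_regular (N - 1) w"
    and sym: "z \<in> unit_circle \<Longrightarrow> cnj (w z) = z ^ (N - 1) * w z"
    and pf: "\<lbrakk>\<And>a. a < N \<Longrightarrow> x a \<in> unit_circle; \<And>a. a < N \<Longrightarrow> y a \<in> unit_circle\<rbrakk> \<Longrightarrow>
      vandermonde N x * vandermonde N (\<lambda>a. inverse (y a)) * kernel_det N w x y \<in> \<real>\<^sub>\<ge>\<^sub>0"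
    and nondeg: "\<not> (AE (x, y) in torus N \<Otimes>\<^sub>M torus N. kernel_det N w x y = 0)"
begin

abbreviation S :: "nat \<Rightarrow> complex" where "S j \<equiv> spherical_transform w (int j)"

lemma L1: "L1_circle w"
  using shifted_deriv_L1[OF circle_regular, of 0] by simp

text \<open>For fixed \<open>y\<close>, rotation by \<open>y b\<close> turns the moments into
  \<open>S j * y b ^ j\<close>, whose determinant contains the Vandermonde determinant of
  \<open>y\<close>; with the conjugate factor this leaves the product of moments times
  \<open>(norm (V y))\<^sup>2\<close>. If the product were 0, the nonnegative integrands would
  vanish almost everywhere for every \<open>y\<close>, and Fubini would contradict
  nondegeneracy.\<close>

lemma spherical_prod_pos: "\<exists>r>0. (\<Prod>j<N. S j) = complex_of_real r"
proof -
  obtain \<phi> where \<phi>: "integrable circle \<phi>" "AE z in circle. w z = \<phi> z"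
    using L1 integrable_completion_representative unfolding L1_circle_def by blast
  have m: "\<phi> \<in> borel_measurable circle" using \<phi>(1) by auto
  have S: "S j = (LINT z|circle. z ^ j * \<phi> z)" for j
    unfolding spherical_transform_def power_int_of_nat
  proof (rule integral_completion_cong_AE)
    show "(\<lambda>z. z ^ j * \<phi> z) \<in> borel_measurable circle"
      by (intro borel_measurable_times borel_measurable_circle_power m)
    show "AE z in circle. z ^ j * w z = z ^ j * \<phi> z" using \<phi>(2) by eventually_elim simp
  qed
  define V where "V = vandermonde N"
  define D where "D y z = fdet N (\<lambda>a b. \<phi> (z a * inverse (y b)))" for y z :: "nat \<Rightarrow> complex"
  define I where "I y z = V z * V (\<lambda>a. inverse (y a)) * D y z" for y z
  have rot: "(LINT z|circle. z ^ j * \<phi> (z * c)) = inverse c ^ j * S j" if c: "c \<in> unit_circle" for c j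
  proof -
    have "c \<noteq> 0" using c by auto
    then have "(LINT z|circle. z ^ j * \<phi> (z * c)) = (LINT z|circle. inverse c ^ j * ((z * c) ^ j * \<phi> (z * c)))"
      by (intro Bochner_Integration.integral_cong refl) (simp add: power_mult_distrib field_simps)
    also have "\<dots> = inverse c ^ j * (LINT z|circle. (z * c) ^ j * \<phi> (z * c))" by simp
    also have "(LINT z|circle. (z * c) ^ j * \<phi> (z * c)) = S j"
      unfolding S
      by (intro integral_circle_rotation[OF c, of "\<lambda>z. z ^ j * \<phi> z"] borel_measurable_times borel_measurable_circle_power m)
    finally show ?thesis .
  qed
  have I: "integrable (torus N) (I y) \<and> integral\<^sup>L (torus N) (I y) = fact N * (\<Prod>j<N. S j) * of_real ((norm (V y))\<^sup>2)"
    if y: "\<forall>a<N. y a \<in> unit_circle" for y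
  proof -
    have Ieq: "I y z = V (\<lambda>a. inverse (y a)) * (fdet N (\<lambda>a j. z a ^ j) * fdet N (\<lambda>a b. \<phi> (z a * inverse (y b))))" for z
      by (simp add: I_def D_def V_def vandermonde_eq_fdet)
    have int: "integrable circle (\<lambda>z. z ^ j * \<phi> (z * inverse (y b)))" if "j < N" "b < N" for j b
      using that y by (intro integrable_circle_power_rotated \<phi> inverse_unit_circle) auto
    note A = andreief_integrable[of N "\<lambda>j z. z ^ j" "\<lambda>b z. \<phi> (z * inverse (y b))", OF int]
      andreief[of N "\<lambda>j z. z ^ j" "\<lambda>b z. \<phi> (z * inverse (y b))", OF int]
    have "fdet N (\<lambda>j b. LINT z|circle. z ^ j * \<phi> (z * inverse (y b))) = fdet N (\<lambda>j b. S j * y b ^ j)"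
      using y inverse_unit_circle by (intro fdet_cong) (auto simp: rot)
    also have "\<dots> = (\<Prod>j<N. S j) * V y"
      unfolding fdet_scale_rows fdet_transpose[of N "\<lambda>a b. y a ^ b"] V_def vandermonde_eq_fdet ..
    finally have det: "fdet N (\<lambda>j b. LINT z|circle. z ^ j * \<phi> (z * inverse (y b))) = (\<Prod>j<N. S j) * V y" .
    have "V (\<lambda>a. inverse (y a)) = cnj (V y)"
      unfolding V_def by (rule vandermonde_inverse) (use y in blast)
    then have "V y * V (\<lambda>a. inverse (y a)) = of_real ((norm (V y))\<^sup>2)"
      by (simp only: complex_norm_square)
    then show ?thesis unfolding Ieq using A det
      by (simp add: mult_ac)
  qed
  have nonneg: "AE z in torus N. I y z \<in> \<real>\<^sub>\<ge>\<^sub>0" if y: "\<forall>a<N. y a \<in> unit_circle" for y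
  proof -
    have "AE z in torus N. w (z a * inverse (y b)) = \<phi> (z a * inverse (y b))" if "a < N" "b < N" for a b
      using y that by (intro AE_torus_component AE_circle_rotation \<phi>(2) inverse_unit_circle) auto
    then have "AE z in torus N. \<forall>a\<in>{..<N}. \<forall>b\<in>{..<N}. w (z a * inverse (y b)) = \<phi> (z a * inverse (y b))"
      by (intro AE_finite_allI) auto
    with AE_torus_space show ?thesis
    proof eventually_elim
      case (elim z)
      have "D y z = kernel_det N w z y" unfolding D_def kernel_det_eq_fdet
        by (rule fdet_cong) (use elim in auto)
      then show ?case unfolding I_def V_def using pf[of z y] elim y by auto
    qed
  qed
  have re: "0 \<le> Re (integral\<^sup>L (torus N) (I y))" "Im (integral\<^sup>L (torus N) (I y)) = 0"
    if y: "\<forall>a<N. y a \<in> unit_circle" for y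
  proof -
    have "0 \<le> (LINT z|torus N. Re (I y z))"
      using nonneg[of y, OF y] by (intro integral_nonneg_AE) (auto elim!: eventually_mono simp: complex_nonneg_Reals_iff)
    then show "0 \<le> Re (integral\<^sup>L (torus N) (I y))" using I[of y, OF y] by simp
    have "(LINT z|torus N. Im (I y z)) = 0"
      using nonneg[of y, OF y] I[of y, OF y] by (intro integral_eq_zero_AE) (auto elim!: eventually_mono simp: complex_nonneg_Reals_iff)
    then show "Im (integral\<^sup>L (torus N) (I y)) = 0" using I[of y, OF y] by simp
  qed
  \<comment> \<open>A vanishing Vandermonde factor means two coinciding arguments, and then
    \<open>D\<close> itself has equal rows or equal columns.\<close>
  have D0: "D y z = 0" if I0: "I y z = 0" for y z
  proof -
    consider "V z = 0" | "V (\<lambda>a. inverse (y a)) = 0" | "D y z = 0" using I0 by (auto simp: I_def)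
    then show ?thesis
    proof cases
      case 1
      then obtain a b where "b < N" "a < b" "z b = z a" by (auto simp: V_def vandermonde_def)
      then show ?thesis unfolding D_def by (intro fdet_proportional_rows[of b _ a _ 1]) auto
    next
      case 2
      then obtain a b where "b < N" "a < b" "inverse (y b) = inverse (y a)" by (auto simp: V_def vandermonde_def)
      then show ?thesis unfolding D_def
        by (subst fdet_transpose[symmetric], intro fdet_proportional_rows[of b _ a _ 1]) auto
    qed
  qed
  \<comment> \<open>A configuration of distinct points: the angles are equispaced in
    \<open>[0, 1)\<close>.\<close>
  define y0 where "y0 b = cis (real b * (1 / real N))" for b
  have "V y0 \<noteq> 0"
  proof -
    have "sine_vandermonde N (\<lambda>b. real b * (1 / real N)) > 0" using N pi_gt3 by (intro sine_vandermonde_equispaced_pos) auto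
    then show ?thesis unfolding V_def y0_def vandermonde_cis by simp
  qed
  then have Vp: "(norm (V y0))\<^sup>2 > 0" by simp
  have y0: "\<forall>a<N. y0 a \<in> unit_circle" by (simp add: y0_def)
  let ?P = "\<Prod>j<N. S j"
  have "?P = of_real (Re ?P)" "Re ?P \<ge> 0"
  proof -
    have eq: "integral\<^sup>L (torus N) (I y0) = of_real (fact N * (norm (V y0))\<^sup>2) * ?P" using I[of y0, OF y0] by (simp add: mult_ac)
    have "Im (of_real c * q) = c * Im q" "Re (of_real c * q) = c * Re q" for c and q :: complex by simp_all
    note reim = this[of "fact N * (norm (V y0))\<^sup>2" ?P]
    have "Im (integral\<^sup>L (torus N) (I y0)) = (fact N * (norm (V y0))\<^sup>2) * Im ?P"
      "Re (integral\<^sup>L (torus N) (I y0)) = (fact N * (norm (V y0))\<^sup>2) * Re ?P" unfolding eq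
      by (rule reim)+
    then have "fact N * (norm (V y0))\<^sup>2 * Im ?P = 0" "0 \<le> fact N * (norm (V y0))\<^sup>2 * Re ?P"
      using re[of y0, OF y0] by simp_all
    moreover have c: "fact N * (norm (V y0))\<^sup>2 > (0::real)" using Vp by simp
    ultimately have "Im ?P = 0" and "Re ?P \<ge> 0"
      by (metis less_irrefl mult_eq_0_iff, metis c mult_pos_neg not_le)
    then show "?P = of_real (Re ?P)" "Re ?P \<ge> 0" by (simp_all add: complex_eq_iff)
  qed
  moreover have "?P \<noteq> 0"
  proof
    assume P0: "?P = 0"
    interpret T: prob_space "torus N" by (rule prob_space_torus)
    interpret TT: pair_prob_space "torus N" "torus N" ..
    have zero: "AE z in torus N. D y z = 0" if y: "\<forall>a<N. y a \<in> unit_circle" for y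
    proof -
      have "(LINT z|torus N. Re (I y z)) = 0" using I[of y, OF y] P0 by simp
      moreover have "AE z in torus N. 0 \<le> Re (I y z)"
        using nonneg[of y, OF y] by (auto elim!: eventually_mono simp: complex_nonneg_Reals_iff)
      ultimately have "AE z in torus N. Re (I y z) = 0"
        using I[of y, OF y] by (subst (asm) integral_nonneg_eq_0_iff_AE) auto
      with nonneg[of y, OF y] show ?thesis
        by eventually_elim (rule D0, simp add: complex_nonneg_Reals_iff complex_eq_iff)
    qed
    have Dm: "(\<lambda>(z, y). D y z) \<in> borel_measurable (torus N \<Otimes>\<^sub>M torus N)"
      unfolding D_def split_beta'
      using measurable_compose[OF torus_quotient_measurable m] by (intro borel_measurable_fdet) (auto simp: split_beta')
    then have Ds: "{p \<in> space (torus N \<Otimes>\<^sub>M torus N). case p of (z, y) \<Rightarrow> D y z = 0} \<in> sets (torus N \<Otimes>\<^sub>M torus N)"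
    proof -
      have "(\<lambda>(z, y). D y z) -` {0} \<inter> space (torus N \<Otimes>\<^sub>M torus N) \<in> sets (torus N \<Otimes>\<^sub>M torus N)"
        by (rule measurable_sets[OF Dm]) simp
      also have "(\<lambda>(z, y). D y z) -` {0} \<inter> space (torus N \<Otimes>\<^sub>M torus N) =
          {p \<in> space (torus N \<Otimes>\<^sub>M torus N). case p of (z, y) \<Rightarrow> D y z = 0}" by auto
      finally show ?thesis .
    qed
    have "AE y in torus N. AE z in torus N. D y z = 0"
      using AE_torus_space by eventually_elim (rule zero)
    then have "AE z in torus N. AE y in torus N. D y z = 0"
      using TT.AE_commute[of "\<lambda>z y. D y z = 0"] Ds by (simp add: pred_def split_beta')
    then have ae1: "AE p in torus N \<Otimes>\<^sub>M torus N. case p of (z, y) \<Rightarrow> D y z = 0"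
      using TT.AE_pair_measure[OF Ds] by simp
    \<comment> \<open>The set where the weight differs from its Borel representative is enclosed in
      a Borel null set, whose preimage under every quotient \<open>z a * inverse (y b)\<close> is
      null by rotation invariance and Fubini.\<close>
    obtain Z where Z: "{z \<in> space circle. w z \<noteq> \<phi> z} \<subseteq> Z" "Z \<in> null_sets circle"
      using \<phi>(2) by (auto elim!: AE_E simp: null_sets_def)
    have ae2: "AE p in torus N \<Otimes>\<^sub>M torus N. case p of (z, y) \<Rightarrow> z a * inverse (y b) \<notin> Z" if ab: "a < N" "b < N" for a b
    proof -
      have Zs: "{p \<in> space (torus N \<Otimes>\<^sub>M torus N). case p of (z, y) \<Rightarrow> z a * inverse (y b) \<notin> Z} \<in> sets (torus N \<Otimes>\<^sub>M torus N)"
      proof -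
        have "Z \<in> sets circle" using Z(2) by auto
        from measurable_sets[OF torus_quotient_measurable[OF ab] sets.compl_sets[OF this]]
        have "(\<lambda>(x, y). x a * inverse (y b)) -` (space circle - Z) \<inter> space (torus N \<Otimes>\<^sub>M torus N) \<in> sets (torus N \<Otimes>\<^sub>M torus N)" .
        also have "(\<lambda>(x, y). x a * inverse (y b)) -` (space circle - Z) \<inter> space (torus N \<Otimes>\<^sub>M torus N) =
          {p \<in> space (torus N \<Otimes>\<^sub>M torus N). case p of (z, y) \<Rightarrow> z a * inverse (y b) \<notin> Z}"
          using measurable_space[OF torus_quotient_measurable[OF ab]] by auto
        finally show ?thesis .
      qed
      have "AE y in torus N. AE z in torus N. z a * inverse (y b) \<notin> Z"
        using AE_torus_space
        by eventually_elim (use ab Z(2) in \<open>intro AE_torus_component AE_circle_rotation inverse_unit_circle AE_not_in, auto\<close>)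
      then have "AE z in torus N. AE y in torus N. z a * inverse (y b) \<notin> Z"
        using TT.AE_commute[of "\<lambda>z y. z a * inverse (y b) \<notin> Z"] Zs by (simp add: pred_def split_beta')
      then show ?thesis using TT.AE_pair_measure[OF Zs] by simp
    qed
    have "AE p in torus N \<Otimes>\<^sub>M torus N. \<forall>a\<in>{..<N}. \<forall>b\<in>{..<N}. case p of (z, y) \<Rightarrow> z a * inverse (y b) \<notin> Z"
      by (intro AE_finite_allI ae2) auto
    with ae1 AE_space have "AE p in torus N \<Otimes>\<^sub>M torus N. case p of (z, y) \<Rightarrow> kernel_det N w z y = 0"
    proof eventually_elim
      case (elim p)
      obtain z y where p: "p = (z, y)" by fastforce
      have "w (z a * inverse (y b)) = \<phi> (z a * inverse (y b))" if "a < N" "b < N" for a b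
        using elim(2,3) that Z(1) measurable_space[OF torus_quotient_measurable[OF that], of p] by (auto simp: p)
      then have "kernel_det N w z y = D y z" unfolding D_def kernel_det_eq_fdet by (rule fdet_cong)
      then show ?case using elim(1) by (simp add: p)
    qed
    with nondeg show False by simp
  qed
  ultimately show ?thesis by (metis of_real_0 order_le_less)
qed

end

lemma prod_powers_i: "(\<Prod>b<N. \<i> ^ b) = (\<Prod>b<N. \<Prod>a<b. \<i>)"
  by (simp add: prod_constant)

section \<open>Real form of the weight, its derivatives and their moments\<close>

context pf_weight
begin

definition \<kappa> :: real where "\<kappa> = (real N - 1) / 2"

definition E :: "nat \<Rightarrow> complex \<Rightarrow> complex" where "E b = (shifted_deriv \<kappa> ^^ b) w"

text \<open>The factor \<open>(- \<i>) ^ b\<close> makes this the \<open>b\<close>-th derivative in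
  \<open>t\<close> of \<open>cis (\<kappa> * t) * w (cis t)\<close>, at the top order almost
  everywhere.\<close>

definition H :: "nat \<Rightarrow> real \<Rightarrow> complex" where "H b t = (- \<i>) ^ b * cis (\<kappa> * t) * E b (cis t)"

definition h :: "nat \<Rightarrow> real \<Rightarrow> real" where "h b t = Re (H b t)"

definition mom :: "nat \<Rightarrow> nat \<Rightarrow> complex" where
  "mom b j = (LINT z|completion circle. z ^ j * E b z)"

lemma E_L1: "b \<le> N - 1 \<Longrightarrow> L1_circle (E b)"
  unfolding E_def by (rule shifted_deriv_L1[OF circle_regular])

lemma E_continuous: "b < N - 1 \<Longrightarrow> continuous_on unit_circle (E b)"
  unfolding E_def by (rule shifted_deriv_continuous[OF circle_regular])

lemma E_differentiable: "Suc b < N - 1 \<Longrightarrow> z \<in> unit_circle \<Longrightarrow> E b field_differentiable (at z within unit_circle)"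
  unfolding E_def by (rule shifted_deriv_differentiable[OF circle_regular])

lemma E_AE_differentiable: "b < N - 1 \<Longrightarrow> AE z in circle. E b field_differentiable (at z within unit_circle)"
  unfolding E_def by (rule shifted_deriv_AE_differentiable[OF circle_regular])

lemma H_has_derivative:
  assumes "E b field_differentiable (at (cis t) within unit_circle)"
  shows "(H b has_vector_derivative H (Suc b) t) (at t)"
proof -
  have "((\<lambda>t. (- \<i>) ^ b * (cis (\<kappa> * t) * E b (cis t))) has_vector_derivative
      (- \<i>) ^ b * (- \<i> * cis (\<kappa> * t) * shifted_deriv \<kappa> (E b) (cis t))) (at t)"
    by (intro has_vector_derivative_mult_right shifted_deriv_cis_derivative assms)
  then show ?thesis unfolding H_def E_def by (simp add: mult_ac)
qed

lemma H_continuous: "b < N - 1 \<Longrightarrow> continuous_on UNIV (H b)"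
  unfolding H_def using continuous_on_circle_iff_cis[OF E_continuous] by (intro continuous_intros) auto

lemma H_absolutely_integrable:
  assumes "b \<le> N - 1"
  shows "H b absolutely_integrable_on {0..2 * pi}"
  unfolding H_def
proof (rule absolutely_integrable_bounded_measurable_product[of "\<lambda>x y. x * y"])
  have "continuous_on {0..2 * pi} (\<lambda>t. (- \<i>) ^ b * cis (\<kappa> * t))" by (intro continuous_intros)
  then show "(\<lambda>t. (- \<i>) ^ b * cis (\<kappa> * t)) \<in> borel_measurable (lebesgue_on {0..2 * pi})"
    "bounded ((\<lambda>t. (- \<i>) ^ b * cis (\<kappa> * t)) ` {0..2 * pi})"
    by (auto intro!: continuous_imp_measurable_on_sets_lebesgue compact_imp_bounded compact_continuous_image)
  show "(\<lambda>t. E b (cis t)) absolutely_integrable_on {0..2 * pi}"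
    by (rule L1_circle_absolutely_integrable[OF E_L1[OF assms]])
qed (auto simp: bilinear_conv_bounded_bilinear bounded_bilinear_mult)

lemma mom_0: "mom 0 j = S j"
  by (simp add: mom_def E_def spherical_transform_def power_int_of_nat)

lemma mom_eq_integral:
  assumes "b \<le> N - 1"
  shows "mom b j = integral {0..2 * pi} (\<lambda>t. cis (real j * t) * E b (cis t)) / (2 * pi)"
proof -
  have "L1_circle (\<lambda>z. 1 * z powi int j * E b z)" by (intro L1_circle_powi E_L1 assms)
  from L1_circle_integral[OF this] show ?thesis
    by (simp add: mom_def Complex.DeMoivre mult.assoc)
qed

text \<open>Integration by parts against \<open>cis ((j - \<kappa>) * t)\<close>. For even
  \<open>N\<close> both this function and \<open>H b\<close> are antiperiodic, but their product is
  periodic, so the boundary terms cancel.\<close>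

lemma mom_Suc:
  assumes b: "Suc b \<le> N - 1"
    and int: "\<And>x y. 0 \<le> x \<Longrightarrow> x \<le> y \<Longrightarrow> y \<le> 2 * pi \<Longrightarrow> integral {x..y} (H (Suc b)) = H b y - H b x"
  shows "mom (Suc b) j = of_real (real j - \<kappa>) * mom b j"
proof -
  define c where "c = real j - \<kappa>"
  define g where "g t = cis (c * t)" for t
  define g' where "g' t = \<i> * of_real c * cis (c * t)" for t
  have gH: "g t * H d t = (- \<i>) ^ d * (cis (real j * t) * E d (cis t))" for d t
  proof -
    have "cis (c * t) * cis (\<kappa> * t) = cis (real j * t)" by (simp add: cis_mult c_def algebra_simps)
    then show ?thesis by (simp add: g_def H_def mult.left_commute mult.assoc[symmetric])
  qed
  have g'H: "g' t * H d t = \<i> * of_real c * (- \<i>) ^ d * (cis (real j * t) * E d (cis t))" for d t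
    using gH[of t d] by (simp add: g_def g'_def mult.assoc)
  have ibp: "integral {0..2 * pi} (\<lambda>t. g' t * H b t) + integral {0..2 * pi} (\<lambda>t. g t * H (Suc b) t) = g (2 * pi) * H b (2 * pi) - g 0 * H b 0"
  proof (rule integration_by_parts_indefinite(1))
    show "(g has_vector_derivative g' t) (at t within {0..2 * pi})" for t
      unfolding g_def g'_def by (rule has_vector_derivative_cis_mult)
    show "continuous_on {0..2 * pi} g'" unfolding g'_def by (intro continuous_intros)
    show "H (Suc b) absolutely_integrable_on {0..2 * pi}" by (rule H_absolutely_integrable[OF b])
  qed (use int in auto)
  have "g (2 * pi) * H b (2 * pi) - g 0 * H b 0 = 0"
  proof -
    have c: "cis (real j * (2 * pi)) = 1"
      using cis_multiple_2pi[of "real j"] by (simp add: mult.commute mult.left_commute)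
    show ?thesis unfolding gH cis_2pi c by simp
  qed
  then have "\<i> * of_real c * (- \<i>) ^ b * (2 * pi * mom b j) + (- \<i>) ^ Suc b * (2 * pi * mom (Suc b) j) = 0"
    using ibp b unfolding gH g'H by (simp add: mom_eq_integral)
  then have "2 * pi * (- \<i>) ^ Suc b * (mom (Suc b) j - of_real c * mom b j) = 0" by (simp add: algebra_simps)
  then show ?thesis by (simp add: c_def)
qed

lemma H_ftc:
  assumes "Suc b < N - 1" "x \<le> y"
  shows "integral {x..y} (H (Suc b)) = H b y - H b x"
  using assms(2) H_has_derivative[OF E_differentiable[OF assms(1)]]
  by (intro integral_unique fundamental_theorem_of_calculus) (auto intro: has_vector_derivative_at_within)

lemma mom_lower: "b < N - 1 \<Longrightarrow> mom b j = of_real (real j - \<kappa>) ^ b * S j"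
proof (induction b)
  case (Suc b)
  then have "mom (Suc b) j = of_real (real j - \<kappa>) * mom b j"
    by (intro mom_Suc H_ftc) auto
  then show ?case using Suc by simp
qed (simp add: mom_0)

lemma S_nonzero: "j < N \<Longrightarrow> S j \<noteq> 0"
proof -
  assume j: "j < N"
  have "(\<Prod>j<N. S j) \<noteq> 0" using spherical_prod_pos by force
  then show "S j \<noteq> 0" using j by (auto simp: prod_zero_iff)
qed

text \<open>After the \<open>S j\<close> are taken out, a Vandermonde determinant in the nodes
  \<open>j - \<kappa>\<close> remains; the shift drops out of the differences \<open>b - a\<close>,
  whose products are factorials.\<close>

lemma fdet_mom:
  assumes "n \<le> N" "\<And>b j. b < n \<Longrightarrow> mom b j = of_real (real j - \<kappa>) ^ b * S j"
  shows "fdet n (\<lambda>j b. mom b j) = (\<Prod>j<n. S j) * (\<Prod>b<n. fact b)"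
proof -
  have "fdet n (\<lambda>j b. mom b j) = fdet n (\<lambda>j b. S j * of_real (real j - \<kappa>) ^ b)"
    by (rule fdet_cong) (simp add: assms(2) mult.commute)
  also have "\<dots> = (\<Prod>j<n. S j) * fdet n (\<lambda>j b. complex_of_real (real j - \<kappa>) ^ b)" by (rule fdet_scale_rows)
  also have "fdet n (\<lambda>j b. complex_of_real (real j - \<kappa>) ^ b) = (\<Prod>b<n. \<Prod>a<b. of_real (real b - \<kappa>) - of_real (real a - \<kappa>))"
    by (rule fdet_vandermonde)
  also have "(\<Prod>b<n. \<Prod>a<b. of_real (real b - \<kappa>) - of_real (real a - \<kappa>)) = (\<Prod>b<n. fact b :: complex)"
  proof (rule prod.cong[OF refl])
    fix b
    have "(\<Prod>a<b. of_real (real b - \<kappa>) - of_real (real a - \<kappa>) :: complex) = (\<Prod>a<b. of_nat (b - a))"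
      by (intro prod.cong refl) (auto simp: of_nat_diff)
    also have "\<dots> = fact b" by (simp add: fact_prod_rev lessThan_atLeast0)
    finally show "(\<Prod>a<b. of_real (real b - \<kappa>) - of_real (real a - \<kappa>)) = (fact b :: complex)" .
  qed
  finally show ?thesis .
qed

lemma H_0_real: "Im (H 0 t) = 0"
proof -
  have "cnj (w (cis t)) = cis (real (N - 1) * t) * w (cis t)"
    using sym[of "cis t"] by (simp add: Complex.DeMoivre)
  then have "cnj (H 0 t) = cis (- (\<kappa> * t)) * cis (real (N - 1) * t) * w (cis t)"
    by (simp add: H_def E_def cis_cnj)
  also have "cis (- (\<kappa> * t)) * cis (real (N - 1) * t) = cis (\<kappa> * t)"
    using N by (simp add: cis_mult \<kappa>_def of_nat_diff field_simps)
  finally have "cnj (H 0 t) = H 0 t" by (simp add: H_def E_def)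
  then show ?thesis by (metis Im_complex_of_real Reals_cases complex_cnj_cancel_iff Reals_cnj_iff)
qed

lemma H_real_step:
  assumes "\<And>t. Im (H b t) = 0" "E b field_differentiable (at (cis t) within unit_circle)"
  shows "Im (H (Suc b) t) = 0"
proof -
  have "((\<lambda>t. Im (H b t)) has_vector_derivative Im (H (Suc b) t)) (at t)"
    using bounded_linear.has_vector_derivative[OF bounded_linear_Im H_has_derivative[OF assms(2)]] .
  then have "((\<lambda>t. 0) has_real_derivative Im (H (Suc b) t)) (at t)"
    by (simp add: assms(1) has_real_derivative_iff_has_vector_derivative)
  then show ?thesis using DERIV_unique[OF _ DERIV_const] by blast
qed

lemma H_real: "b < N - 1 \<or> b = 0 \<Longrightarrow> Im (H b t) = 0"
proof (induction b arbitrary: t)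
  case 0
  show ?case by (rule H_0_real)
next
  case (Suc b)
  then show ?case by (intro H_real_step E_differentiable) auto
qed

lemma h_has_derivative:
  assumes "E b field_differentiable (at (cis t) within unit_circle)"
  shows "(h b has_real_derivative h (Suc b) t) (at t)"
  unfolding h_def has_real_derivative_iff_has_vector_derivative
  by (rule bounded_linear.has_vector_derivative[OF bounded_linear_Re H_has_derivative[OF assms]])

lemma E_cis: "Im (H b t) = 0 \<Longrightarrow> E b (cis t) = \<i> ^ b * cis (- (\<kappa> * t)) * of_real (h b t)"
proof -
  assume "Im (H b t) = 0"
  then have "of_real (h b t) = H b t" by (simp add: h_def complex_eq_iff)
  then have "\<i> ^ b * cis (- (\<kappa> * t)) * of_real (h b t) = (\<i> ^ b * (- \<i>) ^ b) * (cis (- (\<kappa> * t)) * cis (\<kappa> * t)) * E b (cis t)"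
    by (simp add: H_def mult_ac)
  then show ?thesis by (simp add: power_mult_distrib[symmetric] cis_mult)
qed

text \<open>The square of \<open>2 * \<i>\<close> for every pair of indices, one factor from the
  Vandermonde determinant of each argument.\<close>

definition sg :: real where "sg = (\<Prod>b<N. \<Prod>a<b. - 4)"

text \<open>With \<open>y b = cis (- \<tau> b)\<close> the quotients have angle
  \<open>\<alpha> a + \<tau> b\<close>. The phases of the two Vandermonde determinants cancel
  exactly those that separate \<open>w\<close> from the real function \<open>h 0\<close>.\<close>

lemma chain_pf: "sg * sine_vandermonde N \<alpha> * sine_vandermonde N \<tau> * fdet N (\<lambda>a b. h 0 (\<alpha> a + \<tau> b)) \<ge> 0"
proof -
  let ?x = "\<lambda>a. cis (\<alpha> a)" and ?y = "\<lambda>b. cis (- \<tau> b)"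
  let ?d = "fdet N (\<lambda>a b. h 0 (\<alpha> a + \<tau> b))"
  have "vandermonde N ?x * vandermonde N (\<lambda>a. inverse (?y a)) * kernel_det N w ?x ?y \<in> \<real>\<^sub>\<ge>\<^sub>0"
    by (rule pf) auto
  also have "kernel_det N w ?x ?y = fdet N (\<lambda>a b. cis (- (\<kappa> * \<alpha> a)) * (cis (- (\<kappa> * \<tau> b)) * of_real (h 0 (\<alpha> a + \<tau> b))))"
    unfolding kernel_det_eq_fdet
  proof (rule fdet_cong)
    fix a b
    have "w (cis (\<alpha> a + \<tau> b)) = cis (- (\<kappa> * (\<alpha> a + \<tau> b))) * of_real (h 0 (\<alpha> a + \<tau> b))"
      using E_cis[of 0 "\<alpha> a + \<tau> b"] H_0_real by (simp add: E_def)
    then show "w (?x a * inverse (?y b)) = cis (- (\<kappa> * \<alpha> a)) * (cis (- (\<kappa> * \<tau> b)) * of_real (h 0 (\<alpha> a + \<tau> b)))"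
      by (simp add: cis_mult mult.assoc[symmetric] algebra_simps)
  qed
  also have "\<dots> = (\<Prod>a<N. cis (- (\<kappa> * \<alpha> a))) * ((\<Prod>a<N. cis (- (\<kappa> * \<tau> a))) * of_real ?d)"
    by (simp only: fdet_scale_rows fdet_scale_cols of_real_fdet)
  also have "(\<lambda>a. inverse (?y a)) = (\<lambda>a. cis (\<tau> a))" by auto
  finally have "vandermonde N ?x * vandermonde N (\<lambda>a. cis (\<tau> a)) * ((\<Prod>a<N. cis (- (\<kappa> * \<alpha> a))) * ((\<Prod>a<N. cis (- (\<kappa> * \<tau> a))) * of_real ?d)) \<in> \<real>\<^sub>\<ge>\<^sub>0" .
  also have "vandermonde N ?x * vandermonde N (\<lambda>a. cis (\<tau> a)) * ((\<Prod>a<N. cis (- (\<kappa> * \<alpha> a))) * ((\<Prod>a<N. cis (- (\<kappa> * \<tau> a))) * of_real ?d)) =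
    ((\<Prod>a<N. cis (\<kappa> * \<alpha> a)) * (\<Prod>a<N. cis (- (\<kappa> * \<alpha> a)))) * ((\<Prod>a<N. cis (\<kappa> * \<tau> a)) * (\<Prod>a<N. cis (- (\<kappa> * \<tau> a)))) *
    ((\<Prod>b<N. \<Prod>a<b. 2 * \<i>) * (\<Prod>b<N. \<Prod>a<b. 2 * \<i>)) * of_real (sine_vandermonde N \<alpha> * sine_vandermonde N \<tau> * ?d)"
    unfolding vandermonde_cis \<kappa>_def[symmetric] of_real_mult by (simp only: mult_ac)
  also have "\<dots> = of_real (sg * sine_vandermonde N \<alpha> * sine_vandermonde N \<tau> * ?d)"
  proof -
    have ph: "(\<Prod>a<N. cis (\<kappa> * s a)) * (\<Prod>a<N. cis (- (\<kappa> * s a))) = 1" for s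
      by (simp add: prod.distrib[symmetric] cis_mult)
    have sgp: "(\<Prod>b<N. \<Prod>a<b. 2 * \<i>) * (\<Prod>b<N. \<Prod>a<b. 2 * \<i>) = of_real sg"
      unfolding sg_def of_real_prod prod.distrib[symmetric] by simp
    show ?thesis unfolding ph sgp of_real_mult by (simp only: mult_1_left mult.assoc)
  qed
  finally have "of_real (sg * sine_vandermonde N \<alpha> * sine_vandermonde N \<tau> * ?d) \<in> (\<real>\<^sub>\<ge>\<^sub>0 :: complex set)" .
  then show ?thesis by (simp only: nonneg_Reals_of_real_iff)
qed

lemma sg_nonzero: "sg \<noteq> 0"
  by (simp add: sg_def)

lemma polya_chain:
  assumes "N = m + 2"
  shows "polya_chain m h sg"
proof
  show "(h j has_real_derivative h (Suc j) t) (at t)" if "j < m" for j t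
    using that assms by (intro h_has_derivative E_differentiable) auto
  have "continuous_on UNIV (H m)" using assms by (intro H_continuous) auto
  then show "continuous_on UNIV (h m)" unfolding h_def by (intro continuous_intros)
  have "AE z in circle. E m field_differentiable (at z within unit_circle)"
    using assms by (intro E_AE_differentiable) auto
  from AE_circleD[OF this] show "AE t in lborel. t \<in> {0..2 * pi} \<longrightarrow> (h m has_real_derivative h (Suc m) t) (at t)"
    by eventually_elim (auto intro: h_has_derivative)
  show "h j (t + 2 * pi) = (- 1) ^ Suc m * h j t" for j t
  proof -
    have "cis (\<kappa> * (t + 2 * pi)) = cis (\<kappa> * t) * cis (real (Suc m) * pi)"
    proof -
      have "2 * \<kappa> = real N - 1" by (simp add: \<kappa>_def)
      also have "\<dots> = real (Suc m)" using assms by simp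
      finally have "2 * \<kappa> = real (Suc m)" .
      moreover have "\<kappa> * (t + 2 * pi) = \<kappa> * t + 2 * \<kappa> * pi" by (simp add: algebra_simps)
      ultimately show ?thesis by (simp only: cis_mult)
    qed
    also have "cis (real (Suc m) * pi) = of_real ((- 1) ^ Suc m)"
      unfolding Complex.DeMoivre[symmetric] by simp
    finally have k: "cis (\<kappa> * (t + 2 * pi)) = cis (\<kappa> * t) * of_real ((- 1) ^ Suc m)" .
    have "H j (t + 2 * pi) = of_real ((- 1) ^ Suc m) * H j t"
    proof -
      have c: "cis (t + 2 * pi) = cis t" by (simp add: cis_mult[symmetric])
      show ?thesis unfolding H_def k c by (simp only: mult_ac)
    qed
    then show ?thesis by (simp add: h_def del: of_real_power power_Suc)
  qed
  have "H (Suc m) integrable_on {0..2 * pi}"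
    using H_absolutely_integrable[of "Suc m"] assms by (auto simp: absolutely_integrable_on_def)
  then show "h (Suc m) integrable_on {0..2 * pi}"
    using integrable_linear[OF _ bounded_linear_Re] unfolding h_def o_def by blast
  show "sg \<noteq> 0" by (rule sg_nonzero)
  show "0 \<le> sg * sine_vandermonde (m + 2) \<alpha> * sine_vandermonde (m + 2) \<tau> * fdet (m + 2) (\<lambda>a b. h 0 (\<alpha> a + \<tau> b))" for \<alpha> \<tau>
    using chain_pf[of \<alpha> \<tau>] by (simp add: assms)
qed

lemma unit_circle_cis: "z \<in> unit_circle \<Longrightarrow> \<exists>t. z = cis t"
  by (metis Arg2pi_eq cis_conv_exp mem_sphere_0 mult_1 of_real_1)

text \<open>If all these Wronskians vanished, so would the torus integral of the determinant with
  rows multiplied by \<open>z a ^ a\<close>. That integral is the determinant of the moments below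
  the top order, a product of nonzero \<open>S j\<close> and factorials. Points without
  differentiability form a null set and do not affect it.\<close>

lemma exists_nonzero_wronskian:
  assumes "N = m + 2"
  shows "\<exists>x. (\<forall>a\<le>m. E m field_differentiable (at (cis (x a)) within unit_circle)) \<and> fdet (Suc m) (\<lambda>a j. h j (x a)) \<noteq> 0"
proof (rule ccontr)
  assume contra: "\<not> ?thesis"
  have Eint: "integrable circle (E b)" if "b < Suc m" for b
    using that assms by (intro continuous_on_integrable_circle E_continuous) auto
  have int: "integrable circle (\<lambda>z. z ^ j * E b z)" if "b < Suc m" for b j
    using integrable_circle_power_rotated[OF Eint[OF that], of 1 j] by simp
  have mom: "mom b j = (LINT z|circle. z ^ j * E b z)" if "b < Suc m" for b j
    unfolding mom_def using int[OF that] by (intro integral_completion) auto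
  have "AE z in torus (Suc m). E m field_differentiable (at (z a) within unit_circle)" if "a < Suc m" for a
    using that assms by (intro AE_torus_component E_AE_differentiable) auto
  then have "AE z in torus (Suc m). \<forall>a\<in>{..<Suc m}. E m field_differentiable (at (z a) within unit_circle)"
    by (intro AE_finite_allI) auto
  with AE_torus_space have "AE z in torus (Suc m). fdet (Suc m) (\<lambda>a b. z a ^ a * E b (z a)) = 0"
  proof eventually_elim
    case (elim z)
    then have "\<forall>a<Suc m. \<exists>t. z a = cis t" using unit_circle_cis by blast
    then obtain x where x: "\<And>a. a < Suc m \<Longrightarrow> z a = cis (x a)" by metis
    have "fdet (Suc m) (\<lambda>a b. E b (z a)) = fdet (Suc m) (\<lambda>a b. cis (- (\<kappa> * x a)) * (\<i> ^ b * of_real (h b (x a))))"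
    proof (rule fdet_cong)
      fix a b assume ab: "a < Suc m" "b < Suc m"
      have "Im (H b (x a)) = 0" by (rule H_real) (use ab assms in simp)
      then show "E b (z a) = cis (- (\<kappa> * x a)) * (\<i> ^ b * of_real (h b (x a)))"
        using x[OF ab(1)] by (simp add: E_cis mult_ac)
    qed
    also have "\<dots> = 0"
    proof -
      have "fdet (Suc m) (\<lambda>a j. h j (x a)) = 0" 
      proof -
        have "E m field_differentiable (at (cis (x a)) within unit_circle)" if "a \<le> m" for a
          using elim(2) x[of a] that by (metis le_imp_less_Suc lessThan_iff)
        then show ?thesis using contra by blast
      qed
      then show ?thesis unfolding fdet_scale_rows fdet_scale_cols of_real_fdet by simp
    qed
    finally show ?case unfolding fdet_scale_rows by simp
  qed
  then have "(LINT z|torus (Suc m). fdet (Suc m) (\<lambda>a b. z a ^ a * E b (z a))) = 0"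
    by (rule integral_eq_zero_AE)
  moreover have "(LINT z|torus (Suc m). fdet (Suc m) (\<lambda>a b. z a ^ a * E b (z a))) = fdet (Suc m) (\<lambda>j b. mom b j)"
    by (subst integral_torus_fdet[where G = "\<lambda>a b z. z ^ a * E b z"]) (auto intro!: int fdet_cong simp: mom)
  moreover have "fdet (Suc m) (\<lambda>j b. mom b j) = (\<Prod>j<Suc m. S j) * (\<Prod>b<Suc m. fact b)"
    using assms by (intro fdet_mom mom_lower) auto
  ultimately show False using S_nonzero assms by auto
qed

text \<open>Only the top order \<open>b = N - 1 > 0\<close> needs the absolute continuity obtained
  from total positivity; the remaining ones are classical.\<close>

lemma mom_eq: "b < N \<Longrightarrow> mom b j = of_real (real j - \<kappa>) ^ b * S j"
proof (cases "b < N - 1 \<or> b = 0")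
  case True
  then show ?thesis using mom_lower mom_0 by auto
next
  case False
  assume "b < N"
  with False obtain m where m: "N = m + 2" "b = Suc m" by (metis Suc_diff_1 Suc_lessI add_2_eq_Suc' not0_implies_Suc not_less_eq gr0I less_trans_Suc)
  interpret polya_chain m h sg by (rule polya_chain[OF m(1)])
  obtain x where x: "\<And>a. a \<le> m \<Longrightarrow> E m field_differentiable (at (cis (x a)) within unit_circle)"
    "fdet (Suc m) (\<lambda>a j. h j (x a)) \<noteq> 0"
    using exists_nonzero_wronskian[OF m(1)] by blast
  have "integral {u..v} (H (Suc m)) = H m v - H m u" if uv: "0 \<le> u" "u \<le> v" "v \<le> 2 * pi" for u v
  proof -
    have "integral {u..v} (h (Suc m)) = h m v - h m u"
      by (rule indefinite_integral[OF _ x(2) uv]) (use x(1) in \<open>auto simp: Diff_def intro: h_has_derivative\<close>)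
    moreover have "h (Suc m) integrable_on {u..v}" using uv by (auto intro: integrable_on_subinterval[OF int])
    ultimately have "(h (Suc m) has_integral (h m v - h m u)) {u..v}" by (simp add: has_integral_iff)
    then have "((\<lambda>t. of_real (h (Suc m) t)) has_integral (of_real (h m v - h m u) :: complex)) {u..v}"
      by (rule has_integral_of_real)
    moreover have "of_real (h m v - h m u) = H m v - H m u"
    proof -
      have "Im (H m t) = 0" for t by (rule H_real) (simp add: m(1))
      then show ?thesis by (simp add: h_def complex_eq_iff)
    qed
    \<comment> \<open>The top function \<open>H (Suc m)\<close> is known to be real only where
      \<open>E m\<close> is differentiable, so the real and the complex integrand agree merely
      almost everywhere.\<close>
    moreover have ae: "AE t in lborel. t \<in> {u..v} \<longrightarrow> of_real (h (Suc m) t) = H (Suc m) t"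
    proof -
      have "AE z in circle. E m field_differentiable (at z within unit_circle)"
        using m by (intro E_AE_differentiable) auto
      from AE_circleD[OF this] show ?thesis
      proof eventually_elim
        case (elim t)
        show ?case
        proof
          assume "t \<in> {u..v}"
          then have "Im (H (Suc m) t) = 0"
            using elim uv m by (intro H_real_step H_real) auto
          then show "of_real (h (Suc m) t) = H (Suc m) t" by (simp add: h_def complex_eq_iff)
        qed
      qed
    qed
    ultimately show ?thesis using has_integral_AE[OF ae] by (intro integral_unique) simp
  qed
  then have "mom (Suc m) j = of_real (real j - \<kappa>) * mom m j" using m by (intro mom_Suc) auto
  then show ?thesis using mom_lower[of m j] m by simp
qed

section \<open>Sign and total mass of the density\<close>

lemma density_AE_nonneg: "AE z in torus N. vandermonde N z * fdet N (\<lambda>a b. E b (z a)) \<in> \<real>\<^sub>\<ge>\<^sub>0"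
\<comment> \<open>For \<open>N = 1\<close> there is no penultimate derivative and the chain of size
  \<open>m + 2\<close> does not apply; the density is then the weight itself.\<close>
proof (cases "N = 1")
  case True
  then have lt: "{..<N} = {0}" by auto
  have det: "fdet N F = F 0 0" for F :: "nat \<Rightarrow> nat \<Rightarrow> complex"
    using fdet_upper_triangular[of N F] True by (simp add: lt)
  have vm: "vandermonde N z = 1" for z unfolding vandermonde_def lt by simp
  have "w z \<in> \<real>\<^sub>\<ge>\<^sub>0" if "z \<in> unit_circle" for z
    using pf[of "\<lambda>_. z" "\<lambda>_. 1"] that by (simp add: vm kernel_det_eq_fdet det)
  moreover have "E 0 = w" by (simp add: E_def)
  ultimately have "E 0 z \<in> \<real>\<^sub>\<ge>\<^sub>0" if "z \<in> unit_circle" for z using that by simp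
  moreover have "0 < N" using True by simp
  ultimately show ?thesis unfolding vm det mult_1_left
    by (intro eventually_mono[OF AE_torus_space[of N]]) blast
next
  case False
  then obtain m where m: "N = m + 2" using N by (metis One_nat_def Suc_1 add.commute le_Suc_eq less_eqE not_less_eq_eq)
  interpret polya_chain m h sg by (rule polya_chain[OF m(1)])
  have "AE z in torus N. E m field_differentiable (at (z a) within unit_circle)" if "a < N" for a
    using that m by (intro AE_torus_component E_AE_differentiable) auto
  then have "AE z in torus N. \<forall>a\<in>{..<N}. E m field_differentiable (at (z a) within unit_circle)"
    by (intro AE_finite_allI) auto
  with AE_torus_space show ?thesis
  proof eventually_elim
    case (elim z)
    then have "\<forall>a<N. \<exists>t. z a = cis t" using unit_circle_cis by blast
    then obtain x where x: "\<And>a. a < N \<Longrightarrow> z a = cis (x a)" by metis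
    have diff: "E m field_differentiable (at (cis (x a)) within unit_circle)" if "a < N" for a
      using elim(2) x that by auto
    have re: "Im (H b (x a)) = 0" if "a < N" "b < N" for a b
    proof (cases "b < N - 1")
      case False
      then have b: "b = Suc m" using that m by simp
      have "m < N - 1 \<or> m = 0" using m by simp
      then show ?thesis unfolding b by (intro H_real_step H_real diff that(1))
    qed (simp add: H_real)
    let ?d = "fdet N (\<lambda>a b. h b (x a))"
    have "fdet N (\<lambda>a b. E b (z a)) = fdet N (\<lambda>a b. cis (- (\<kappa> * x a)) * (\<i> ^ b * of_real (h b (x a))))"
      by (rule fdet_cong) (use x re in \<open>auto simp: E_cis mult_ac\<close>)
    also have "\<dots> = (\<Prod>a<N. cis (- (\<kappa> * x a))) * ((\<Prod>b<N. \<i> ^ b) * of_real ?d)"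
      by (simp only: fdet_scale_rows fdet_scale_cols of_real_fdet)
    finally have "vandermonde N z * fdet N (\<lambda>a b. E b (z a)) =
       vandermonde N (\<lambda>a. cis (x a)) * ((\<Prod>a<N. cis (- (\<kappa> * x a))) * ((\<Prod>b<N. \<i> ^ b) * of_real ?d))"
      using x by (simp add: vandermonde_def)
    also have "\<dots> = ((\<Prod>a<N. cis (\<kappa> * x a)) * (\<Prod>a<N. cis (- (\<kappa> * x a)))) * ((\<Prod>b<N. \<Prod>a<b. 2 * \<i>) * (\<Prod>b<N. \<Prod>a<b. \<i>)) * of_real (sine_vandermonde N x * ?d)"
      unfolding vandermonde_cis \<kappa>_def[symmetric] prod_powers_i of_real_mult by (simp only: mult_ac)
    also have "(\<Prod>a<N. cis (\<kappa> * x a)) * (\<Prod>a<N. cis (- (\<kappa> * x a))) = 1"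
      by (simp add: prod.distrib[symmetric] cis_mult)
    \<comment> \<open>Each pair contributes \<open>2 * \<i>\<close> from the Vandermonde determinant
      and \<open>\<i>\<close> from the columns, which is half of its factor \<open>- 4\<close> in
      \<open>sg\<close>. The phases therefore account exactly for the sign in
      \<open>density_nonneg\<close>.\<close>
    also have "(\<Prod>b<N. \<Prod>a<b. 2 * \<i>) * (\<Prod>b<N. \<Prod>a<b. \<i>) = of_real (sg * (\<Prod>b<N. \<Prod>a<b. 1 / 2))"
    proof -
      have "2 * \<i> * \<i> = of_real (- 4 * (1 / 2))" by simp
      then show ?thesis unfolding sg_def prod.distrib[symmetric] by (simp only: of_real_prod)
    qed
    finally have "vandermonde N z * fdet N (\<lambda>a b. E b (z a)) = of_real ((\<Prod>b<N. \<Prod>a<b. 1 / 2) * (sg * sine_vandermonde N x * ?d))"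
      by (simp add: mult_ac)
    moreover have "0 \<le> (\<Prod>b<N. \<Prod>a<b. 1 / 2) * (sg * sine_vandermonde N x * ?d)"
    proof (intro mult_nonneg_nonneg[OF prod_nonneg])
      show "0 \<le> sg * sine_vandermonde N x * ?d"
      proof -
        have mN: "m + 2 = N" using m by simp
        have "x a \<in> Diff" if "a < m + 2" for a
          unfolding Diff_def by (rule CollectI, rule h_has_derivative, rule diff) (use that mN in simp)
        from density_nonneg[of x, OF this] show ?thesis unfolding mN .
      qed
    qed (auto intro!: prod_nonneg)
    ultimately show ?case by (simp only: nonneg_Reals_of_real_iff)
  qed
qed

text \<open>\<open>E b\<close> is a monic polynomial of degree \<open>b\<close> in the derivation
  \<open>- z d/dz\<close> applied to \<open>w\<close>, so passing to the shifted derivation is a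
  unitriangular operation on the columns.\<close>

lemma polya_density_AE_eq:
  "AE z in torus N. polya_density N w z =
    1 / (fact N * polya_normalisation N w) * (vandermonde N z * fdet N (\<lambda>a b. E b (z a)))"
proof -
  have D: "(\<lambda>f u. - u * circle_deriv f u) = shifted_deriv 0"
    by (intro ext) (simp add: shifted_deriv_def)
  have "AE z in torus N. (shifted_deriv 0 ^^ b) w field_differentiable (at (z a) within unit_circle)"
    if "a < N" "b < N - 1" for a b
    using that by (intro AE_torus_component shifted_deriv_AE_differentiable[OF circle_regular])
  then have "AE z in torus N. \<forall>a\<in>{..<N}. \<forall>b\<in>{..<N - 1}. (shifted_deriv 0 ^^ b) w field_differentiable (at (z a) within unit_circle)"
    by (intro AE_finite_allI) auto
  with AE_torus_space show ?thesis
  proof eventually_elim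
    case (elim z)
    have "fdet N (\<lambda>a b. E b (z a)) = fdet N (\<lambda>a b. (shifted_deriv 0 ^^ b) w (z a))"
    proof (rule fdet_unitriangular_cols[where C = "\<lambda>l b. shift_coeff \<kappa> b l"])
      fix a b assume ab: "a < N" "b < N"
      have "E b (z a) = (\<Sum>l\<le>b. shift_coeff \<kappa> b l * (shifted_deriv 0 ^^ l) w (z a))"
        unfolding E_def using ab elim by (intro shifted_deriv_funpow_expansion[OF circle_regular]) auto
      then show "E b (z a) = (\<Sum>l\<le>b. (shifted_deriv 0 ^^ l) w (z a) * shift_coeff \<kappa> b l)"
        by (simp add: mult.commute)
    qed (rule shift_coeff_diag)
    then show ?case unfolding polya_density_def D fdet_def by (simp add: mult.assoc)
  qed
qed

lemma polya_normalisation_pos: "\<exists>r>0. polya_normalisation N w = complex_of_real r"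
proof -
  obtain r where r: "r > 0" "(\<Prod>j<N. S j) = complex_of_real r" using spherical_prod_pos by blast
  have "polya_normalisation N w = complex_of_real ((\<Prod>j<N. fact j) * r)"
    unfolding polya_normalisation_def prod.distrib r(2) by simp
  moreover have "(\<Prod>j<N. fact j) * r > 0" using r(1) by (intro mult_pos_pos prod_pos) auto
  ultimately show ?thesis by blast
qed

text \<open>By Andreief the total mass is \<open>fact N\<close> times the determinant of the
  moments, which is the normalisation. The function \<open>q\<close> is a Borel version of the
  density, which makes it usable as a density of a Borel measure on the torus.\<close>

theorem density_exists:
  obtains q :: "(nat \<Rightarrow> complex) \<Rightarrow> real" where "q \<in> borel_measurable (torus N)" "\<And>z. q z \<ge> 0"
    "AE z in torus N. polya_density N w z = of_real (q z)" "(\<integral>\<^sup>+z. ennreal (q z) \<partial>torus N) = 1"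
proof -
  have "\<exists>\<phi>. integrable circle \<phi> \<and> (AE z in circle. E b z = \<phi> z)" if "b < N" for b
  proof -
    have "L1_circle (E b)" using that by (intro E_L1) auto
    then show ?thesis unfolding L1_circle_def by (blast elim: integrable_completion_representative)
  qed
  then obtain \<phi> where \<phi>: "\<And>b. b < N \<Longrightarrow> integrable circle (\<phi> b)" "\<And>b. b < N \<Longrightarrow> AE z in circle. E b z = \<phi> b z"
    by metis
  define c where "c = 1 / (fact N * polya_normalisation N w)"
  obtain r where r: "r > 0" "polya_normalisation N w = complex_of_real r" using polya_normalisation_pos by blast
  have c: "c = of_real (1 / (fact N * r))" by (simp add: c_def r)
  define p where "p z = c * (fdet N (\<lambda>a j. z a ^ j) * fdet N (\<lambda>a b. \<phi> b (z a)))" for z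
  have int: "integrable circle (\<lambda>z. z ^ j * \<phi> b z)" if "b < N" for j b
    using integrable_circle_power_rotated[OF \<phi>(1)[OF that], of 1 j] by simp
  have mom: "(LINT z|circle. z ^ j * \<phi> b z) = of_real (real j - \<kappa>) ^ b * S j" if "b < N" for b j
  proof -
    have "AE z in circle. z ^ j * E b z = z ^ j * \<phi> b z" using \<phi>(2)[OF that] by eventually_elim simp
    then have "mom b j = (LINT z|circle. z ^ j * \<phi> b z)"
      unfolding mom_def using int[OF that, of j] by (intro integral_completion_cong_AE) auto
    then show ?thesis using mom_eq[OF that] by simp
  qed
  have "fdet N (\<lambda>j b. LINT z|circle. z ^ j * \<phi> b z) = fdet N (\<lambda>j b. mom b j)"
    by (rule fdet_cong) (simp add: mom mom_eq)
  also have "\<dots> = polya_normalisation N w"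
    by (subst fdet_mom) (auto simp: mom_eq polya_normalisation_def prod.distrib mult.commute)
  finally have det: "fdet N (\<lambda>j b. LINT z|circle. z ^ j * \<phi> b z) = polya_normalisation N w" .
  have pint: "integrable (torus N) p" unfolding p_def
    by (intro integrable_mult_right andreief_integrable[of N "\<lambda>j z. z ^ j" \<phi>] int)
  have "integral\<^sup>L (torus N) p = c * (fact N * polya_normalisation N w)"
    unfolding p_def using andreief[of N "\<lambda>j z. z ^ j" \<phi>] int by (simp add: det)
  then have p1: "integral\<^sup>L (torus N) p = 1" using r by (simp add: c_def)
  have "AE z in torus N. E b (z a) = \<phi> b (z a)" if "a < N" "b < N" for a b
    using that \<phi>(2) by (intro AE_torus_component) auto
  then have "AE z in torus N. \<forall>a\<in>{..<N}. \<forall>b\<in>{..<N}. E b (z a) = \<phi> b (z a)"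
    by (intro AE_finite_allI) auto
  with polya_density_AE_eq density_AE_nonneg
  have ae: "AE z in torus N. polya_density N w z = p z \<and> p z \<in> \<real>\<^sub>\<ge>\<^sub>0"
  proof eventually_elim
    case (elim z)
    have d: "fdet N (\<lambda>a b. E b (z a)) = fdet N (\<lambda>a b. \<phi> b (z a))" by (rule fdet_cong) (use elim(3) in auto)
    have eq: "polya_density N w z = p z"
      unfolding elim(1) p_def d c_def vandermonde_eq_fdet ..
    have "c \<in> \<real>\<^sub>\<ge>\<^sub>0" unfolding c nonneg_Reals_of_real_iff using r(1) by simp
    then have "p z \<in> \<real>\<^sub>\<ge>\<^sub>0"
      using elim(2) unfolding p_def d vandermonde_eq_fdet by (rule nonneg_Reals_mult_I)
    with eq show ?case by simp
  qed
  define q where "q z = max 0 (Re (p z))" for z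
  have pm: "p \<in> borel_measurable (torus N)" using pint by auto
  have qm: "q \<in> borel_measurable (torus N)" unfolding q_def using pm by measurable
  have aeq: "AE z in torus N. q z = Re (p z) \<and> p z = of_real (q z)"
    using ae by eventually_elim (auto simp: q_def complex_nonneg_Reals_iff complex_eq_iff)
  have "(\<integral>\<^sup>+z. ennreal (q z) \<partial>torus N) = (\<integral>\<^sup>+z. ennreal (Re (p z)) \<partial>torus N)"
    using aeq by (intro nn_integral_cong_AE) (auto elim: eventually_mono)
  also have "\<dots> = ennreal (LINT z|torus N. Re (p z))"
    using ae pint by (intro nn_integral_eq_integral) (auto elim!: eventually_mono simp: complex_nonneg_Reals_iff)
  also have "(LINT z|torus N. Re (p z)) = 1" using pint p1 by simp
  finally have "(\<integral>\<^sup>+z. ennreal (q z) \<partial>torus N) = 1" by simp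
  moreover have "AE z in torus N. polya_density N w z = of_real (q z)"
    using ae aeq by eventually_elim metis
  moreover have "q z \<ge> 0" for z by (simp add: q_def)
  ultimately show ?thesis using qm that by blast
qed

end

section \<open>Haar-distributed unitary matrices\<close>

abbreviation index_square :: "nat \<Rightarrow> (nat \<times> nat) set" where
  "index_square N \<equiv> {..<N} \<times> {..<N}"

definition mat_lborel :: "nat \<Rightarrow> (nat \<times> nat \<Rightarrow> complex) measure" where
  "mat_lborel N = Pi\<^sub>M (index_square N) (\<lambda>_. lborel)"

definition translate :: "'i set \<Rightarrow> ('i \<Rightarrow> complex) \<Rightarrow> ('i \<Rightarrow> complex) \<Rightarrow> 'i \<Rightarrow> complex" where
  "translate I T G = (\<lambda>p\<in>I. G p + T p)"

interpretation lborel_prod: product_sigma_finite "\<lambda>_. lborel :: complex measure"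
  by standard

lemma PiM_lborel_translate:
  assumes "finite I"
  shows "distr (Pi\<^sub>M I (\<lambda>_. lborel)) (Pi\<^sub>M I (\<lambda>_. lborel)) (translate I T) = Pi\<^sub>M I (\<lambda>_. lborel)"
proof (rule lborel_prod.PiM_eqI[OF assms])
  let ?M = "Pi\<^sub>M I (\<lambda>_. lborel :: complex measure)"
  have m: "translate I T \<in> measurable ?M ?M"
    unfolding translate_def by measurable
  fix A assume A: "\<And>i. i \<in> I \<Longrightarrow> A i \<in> sets (lborel :: complex measure)"
  have "emeasure (distr ?M ?M (translate I T)) (Pi\<^sub>E I A) = emeasure ?M (translate I T -` Pi\<^sub>E I A \<inter> space ?M)"
    using m A assms by (intro emeasure_distr) (auto intro!: sets_PiM_I_finite)
  also have "translate I T -` Pi\<^sub>E I A \<inter> space ?M = Pi\<^sub>E I (\<lambda>i. (+) (T i) -` A i)"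
    by (auto simp: translate_def space_PiM PiE_iff extensional_def add.commute)
  also have "emeasure ?M \<dots> = (\<Prod>i\<in>I. emeasure lborel ((+) (T i) -` A i))"
  proof (rule lborel_prod.emeasure_PiM[OF assms])
    fix i assume "i \<in> I"
    have "(+) (T i) \<in> borel_measurable borel" by simp
    from measurable_sets[OF this, of "A i"] show "(+) (T i) -` A i \<in> sets lborel"
      using A[OF \<open>i \<in> I\<close>] by simp
  qed
  also have "\<dots> = (\<Prod>i\<in>I. emeasure lborel (A i))"
  proof (rule prod.cong[OF refl])
    fix i assume "i \<in> I"
    have "emeasure lborel (A i) = emeasure (distr lborel borel ((+) (T i))) (A i)"
      by (simp only: lborel_distr_plus)
    also have "\<dots> = emeasure lborel ((+) (T i) -` A i)"
      using A[OF \<open>i \<in> I\<close>] by (subst emeasure_distr) auto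
    finally show "emeasure lborel ((+) (T i) -` A i) = emeasure lborel (A i)" ..
  qed
  finally show "emeasure (distr ?M ?M (translate I T)) (Pi\<^sub>E I A) = (\<Prod>i\<in>I. emeasure lborel (A i))" .
qed simp

section \<open>Inner products and maps that preserve them\<close>

definition ip :: "nat \<Rightarrow> (nat \<Rightarrow> complex) \<Rightarrow> (nat \<Rightarrow> complex) \<Rightarrow> complex" where
  "ip N u v = (\<Sum>i<N. cnj (u i) * v i)"

definition app :: "nat \<Rightarrow> (nat \<Rightarrow> nat \<Rightarrow> complex) \<Rightarrow> (nat \<Rightarrow> complex) \<Rightarrow> nat \<Rightarrow> complex" where
  "app N W u i = (\<Sum>k<N. W i k * u k)"

definition isometry :: "nat \<Rightarrow> (nat \<Rightarrow> nat \<Rightarrow> complex) \<Rightarrow> bool" where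
  "isometry N W \<longleftrightarrow> (\<forall>k<N. \<forall>l<N. (\<Sum>i<N. cnj (W i k) * W i l) = (if k = l then 1 else 0))"

lemma ip_app:
  assumes "isometry N W"
  shows "ip N (app N W u) (app N W v) = ip N u v"
proof -
  have "ip N (app N W u) (app N W v) = (\<Sum>i<N. \<Sum>k<N. \<Sum>l<N. cnj (u k) * v l * (cnj (W i k) * W i l))"
    unfolding ip_def app_def by (simp only: cnj_sum complex_cnj_mult sum_product) (simp only: mult_ac)
  also have "\<dots> = (\<Sum>k<N. \<Sum>i<N. \<Sum>l<N. cnj (u k) * v l * (cnj (W i k) * W i l))" by (rule sum.swap)
  also have "\<dots> = (\<Sum>k<N. \<Sum>l<N. \<Sum>i<N. cnj (u k) * v l * (cnj (W i k) * W i l))"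
    by (intro sum.cong refl sum.swap)
  also have "\<dots> = (\<Sum>k<N. \<Sum>l<N. cnj (u k) * v l * (if k = l then 1 else 0))"
    using assms unfolding isometry_def by (intro sum.cong refl) (simp add: sum_distrib_left[symmetric])
  also have "\<dots> = ip N u v" unfolding ip_def by (simp add: if_distrib[of "\<lambda>x. _ * x"] cong: if_cong)
  finally show ?thesis .
qed

lemma ip_self: "ip N u u = of_real (\<Sum>i<N. (norm (u i))\<^sup>2)"
  unfolding ip_def of_real_sum by (intro sum.cong refl) (simp only: complex_norm_square mult.commute)

definition left_mult :: "nat \<Rightarrow> (nat \<Rightarrow> nat \<Rightarrow> complex) \<Rightarrow> (nat \<times> nat \<Rightarrow> complex) \<Rightarrow> nat \<times> nat \<Rightarrow> complex" where
  "left_mult N W G = (\<lambda>(i, j)\<in>index_square N. app N W (\<lambda>k. G (k, j)) i)"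

definition frobenius :: "nat \<Rightarrow> (nat \<times> nat \<Rightarrow> complex) \<Rightarrow> real" where
  "frobenius N G = (\<Sum>j<N. \<Sum>i<N. (norm (G (i, j)))\<^sup>2)"

text \<open>A set of finite positive Lebesgue measure that is invariant under left multiplication by
  unitary matrices; conditioning on it keeps the invariance and gives a probability.\<close>

definition frobenius_ball :: "nat \<Rightarrow> (nat \<times> nat \<Rightarrow> complex) set" where
  "frobenius_ball N = {G \<in> space (mat_lborel N). frobenius N G \<le> 1}"

lemma frobenius_left_mult:
  assumes "isometry N W"
  shows "frobenius N (left_mult N W G) = frobenius N G"
  unfolding frobenius_def
proof (rule sum.cong[OF refl])
  fix j assume j: "j \<in> {..<N}"
  have "complex_of_real (\<Sum>i<N. (norm (left_mult N W G (i, j)))\<^sup>2) = ip N (app N W (\<lambda>k. G (k, j))) (app N W (\<lambda>k. G (k, j)))"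
    unfolding ip_self using j by (simp add: left_mult_def)
  also have "\<dots> = complex_of_real (\<Sum>i<N. (norm (G (i, j)))\<^sup>2)"
    by (simp only: ip_app[OF assms]) (simp only: ip_self)
  finally show "(\<Sum>i<N. (norm (left_mult N W G (i, j)))\<^sup>2) = (\<Sum>i<N. (norm (G (i, j)))\<^sup>2)"
    by (simp only: of_real_eq_iff)
qed

lemma mat_entry_measurable [measurable]:
  "p \<in> index_square N \<Longrightarrow> (\<lambda>G. G p) \<in> borel_measurable (mat_lborel N)"
  using measurable_component_singleton[of p "index_square N" "\<lambda>_. lborel :: complex measure"]
  unfolding mat_lborel_def by (simp add: measurable_lborel1)

lemma mat_lborel_measurableI:
  assumes "\<And>p. p \<in> index_square N \<Longrightarrow> (\<lambda>x. f x p) \<in> borel_measurable M"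
  shows "(\<lambda>x. \<lambda>p\<in>index_square N. f x p) \<in> measurable M (mat_lborel N)"
  unfolding mat_lborel_def using assms by (intro measurable_restrict) (auto simp: measurable_lborel1)

lemma left_mult_measurable: "left_mult N W \<in> measurable (mat_lborel N) (mat_lborel N)"
proof -
  have "left_mult N W = (\<lambda>G. \<lambda>p\<in>index_square N. \<Sum>k<N. W (fst p) k * G (k, snd p))"
    by (auto simp: left_mult_def app_def fun_eq_iff restrict_def)
  then show ?thesis by (simp only:) (intro mat_lborel_measurableI borel_measurable_sum borel_measurable_times mat_entry_measurable, auto)
qed

lemma frobenius_measurable: "frobenius N \<in> borel_measurable (mat_lborel N)"
  unfolding frobenius_def
  by (intro borel_measurable_sum borel_measurable_power borel_measurable_norm mat_entry_measurable) auto

lemma frobenius_ball_sets: "frobenius_ball N \<in> sets (mat_lborel N)"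
  unfolding frobenius_ball_def using frobenius_measurable by measurable

lemma frobenius_ball_emeasure: "emeasure (mat_lborel N) (frobenius_ball N) \<noteq> 0"
  "emeasure (mat_lborel N) (frobenius_ball N) \<noteq> \<infinity>"
proof -
  \<comment> \<open>The polydisc of this radius lies in the ball, because \<open>N * N\<close>
    squared entries sum to at most \<open>(N * e)\<^sup>2 \<le> 1\<close>.\<close>
  define e where "e = 1 / (real N + 1)"
  have e: "e > 0" by (simp add: e_def)
  have prod: "emeasure (mat_lborel N) (\<Pi>\<^sub>E p\<in>index_square N. cball 0 r) = (\<Prod>p\<in>index_square N. emeasure lborel (cball (0::complex) r))" for r
    unfolding mat_lborel_def by (rule lborel_prod.emeasure_PiM) auto
  have sets: "(\<Pi>\<^sub>E p\<in>index_square N. cball (0::complex) r) \<in> sets (mat_lborel N)" for r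
    unfolding mat_lborel_def by (intro sets_PiM_I_finite) auto
  have sub1: "(\<Pi>\<^sub>E p\<in>index_square N. cball 0 e) \<subseteq> frobenius_ball N"
  proof
    fix G :: "nat \<times> nat \<Rightarrow> complex" assume G: "G \<in> (\<Pi>\<^sub>E p\<in>index_square N. cball 0 e)"
    have "frobenius N G \<le> (\<Sum>j<N. \<Sum>i<N. e\<^sup>2)"
      unfolding frobenius_def using G by (intro sum_mono power_mono) (auto simp: PiE_iff)
    also have "\<dots> = (real N * e)\<^sup>2" by (simp add: power2_eq_square)
    also have "\<dots> \<le> 1" by (rule power_le_one) (auto simp: e_def divide_le_eq)
    finally show "G \<in> frobenius_ball N" using G by (auto simp: frobenius_ball_def mat_lborel_def space_PiM PiE_iff)
  qed
  have cball: "\<exists>v>0. emeasure lborel (cball (0::complex) r) = ennreal v" if "r > 0" for r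
    using that by (intro exI[of _ "unit_ball_vol (real DIM(complex)) * r ^ DIM(complex)"] conjI emeasure_cball mult_pos_pos) auto
  obtain v where v: "v > 0" "emeasure lborel (cball (0::complex) e) = ennreal v" using cball[OF e] by blast
  have "emeasure (mat_lborel N) (\<Pi>\<^sub>E p\<in>index_square N. cball 0 e) > 0"
    unfolding prod v(2) using v(1) by (subst prod_ennreal) (auto intro!: prod_pos)
  also have "\<dots> \<le> emeasure (mat_lborel N) (frobenius_ball N)"
    by (rule emeasure_mono[OF sub1 frobenius_ball_sets])
  finally show "emeasure (mat_lborel N) (frobenius_ball N) \<noteq> 0" by simp
  have sub2: "frobenius_ball N \<subseteq> (\<Pi>\<^sub>E p\<in>index_square N. cball 0 1)"
  proof
    fix G assume G: "G \<in> frobenius_ball N"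
    have "norm (G (i, j)) \<le> 1" if ij: "i < N" "j < N" for i j
    proof -
      have "(norm (G (i, j)))\<^sup>2 \<le> (\<Sum>i<N. (norm (G (i, j)))\<^sup>2)"
        using ij by (intro member_le_sum) auto
      also have "\<dots> \<le> frobenius N G" unfolding frobenius_def
        using ij by (intro member_le_sum[of j "{..<N}" "\<lambda>j. \<Sum>i<N. (norm (G (i, j)))\<^sup>2"]) (auto intro: sum_nonneg)
      also have "\<dots> \<le> 1" using G by (simp add: frobenius_ball_def)
      finally show ?thesis by (simp add: power_le_one_iff abs_square_le_1)
    qed
    then show "G \<in> (\<Pi>\<^sub>E p\<in>index_square N. cball 0 1)"
      using G by (auto simp: frobenius_ball_def mat_lborel_def space_PiM PiE_iff)
  qed
  have "emeasure (mat_lborel N) (frobenius_ball N) \<le> emeasure (mat_lborel N) (\<Pi>\<^sub>E p\<in>index_square N. cball 0 1)"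
    by (rule emeasure_mono[OF sub2 sets])
  also have "\<dots> < \<infinity>"
  proof -
    obtain v where v: "v > 0" "emeasure lborel (cball (0::complex) 1) = ennreal v" using cball[of 1] by auto
    show ?thesis unfolding prod v(2) using v(1) by (subst prod_ennreal) auto
  qed
  finally show "emeasure (mat_lborel N) (frobenius_ball N) \<noteq> \<infinity>" by simp
qed

lemma nn_integral_mat_translate:
  assumes "f \<in> borel_measurable (mat_lborel N)"
  shows "(\<integral>\<^sup>+G. f (translate (index_square N) T G) \<partial>mat_lborel N) = integral\<^sup>N (mat_lborel N) f"
proof -
  have m: "translate (index_square N) T \<in> measurable (mat_lborel N) (mat_lborel N)"
    unfolding translate_def by (intro mat_lborel_measurableI borel_measurable_add mat_entry_measurable) auto
  have "integral\<^sup>N (mat_lborel N) f = integral\<^sup>N (distr (mat_lborel N) (mat_lborel N) (translate (index_square N) T)) f"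
    unfolding mat_lborel_def by (subst PiM_lborel_translate) auto
  also have "\<dots> = (\<integral>\<^sup>+G. f (translate (index_square N) T G) \<partial>mat_lborel N)"
    by (rule nn_integral_distr[OF m]) (use assms in simp)
  finally show ?thesis ..
qed

definition inverse_isometry :: "(nat \<Rightarrow> nat \<Rightarrow> complex) \<Rightarrow> nat \<Rightarrow> nat \<Rightarrow> complex" where
  "inverse_isometry W i k = cnj (W k i)"

lemma app_inverse:
  assumes "isometry N (inverse_isometry W)" "i < N"
  shows "app N W (app N (inverse_isometry W) u) i = u i"
proof -
  have "app N W (app N (inverse_isometry W) u) i = (\<Sum>k<N. \<Sum>l<N. W i k * cnj (W l k) * u l)"
    by (simp add: app_def inverse_isometry_def sum_distrib_left mult.assoc)
  also have "\<dots> = (\<Sum>l<N. (\<Sum>k<N. W i k * cnj (W l k)) * u l)"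
    by (subst sum.swap) (simp add: sum_distrib_right)
  also have "\<dots> = (\<Sum>l<N. (if i = l then 1 else 0) * u l)"
    using assms unfolding isometry_def inverse_isometry_def by (intro sum.cong refl) simp
  also have "\<dots> = u i" using assms(2) by (simp add: if_distrib[of "\<lambda>x. x * _"] cong: if_cong)
  finally show ?thesis .
qed

lemma app_cong: "(\<And>k. k < N \<Longrightarrow> u k = v k) \<Longrightarrow> app N W u i = app N W v i"
  unfolding app_def by (intro sum.cong refl) simp

lemma app_add: "app N W (\<lambda>k. u k + v k) i = app N W u i + app N W v i"
  by (simp add: app_def distrib_left sum.distrib)

lemma app_minus: "app N W (\<lambda>k. - u k) i = - app N W u i"
  by (simp add: app_def sum_negf)

text \<open>Up to the factor \<open>emeasure (frobenius_ball N)\<close>, both sides of the claim are obtained from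
  \<open>\<integral>\<integral> 1\<^sub>B(x) 1\<^sub>F(W y) dx dy\<close> by translations, first of \<open>y\<close> and then of \<open>x\<close>.\<close>

lemma emeasure_left_mult:
  assumes W: "isometry N W" and W': "isometry N (inverse_isometry W)" and F: "F \<in> sets (mat_lborel N)"
  shows "emeasure (mat_lborel N) (left_mult N W -` F \<inter> space (mat_lborel N)) = emeasure (mat_lborel N) F"
proof -
  let ?M = "mat_lborel N" and ?L = "left_mult N W" and ?L' = "left_mult N (inverse_isometry W)"
  let ?t = "translate (index_square N)" and ?B = "frobenius_ball N"
  interpret M: sigma_finite_measure ?M unfolding mat_lborel_def by (rule lborel_prod.sigma_finite) simp
  interpret MM: pair_sigma_finite ?M ?M ..
  define n where "n G = (\<lambda>p. - G p)" for G :: "nat \<times> nat \<Rightarrow> complex"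
  have tm: "(\<lambda>(x, y). ?t (?L y) x) \<in> measurable (?M \<Otimes>\<^sub>M ?M) ?M"
    "(\<lambda>(x, y). ?t (n (?L y)) x) \<in> measurable (?M \<Otimes>\<^sub>M ?M) ?M"
    "(\<lambda>(x, y). ?t x (?L y)) \<in> measurable (?M \<Otimes>\<^sub>M ?M) ?M"
    unfolding translate_def split_beta' n_def
    using measurable_compose[OF measurable_fst mat_entry_measurable]
      measurable_compose[OF measurable_compose[OF measurable_snd left_mult_measurable] mat_entry_measurable]
    by (intro mat_lborel_measurableI borel_measurable_add borel_measurable_uminus; blast)+
  have Bm: "(indicator ?B :: _ \<Rightarrow> ennreal) \<in> borel_measurable ?M" using frobenius_ball_sets by simp
  have Fm: "(indicator F :: _ \<Rightarrow> ennreal) \<in> borel_measurable ?M" using F by simp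
  have f: "(\<lambda>p. fst p) \<in> measurable (?M \<Otimes>\<^sub>M ?M) ?M" by simp
  have sq: "(\<lambda>p. indicator ?B (fst p) * indicator F ((\<lambda>(x, y). ?t x (?L y)) p) :: ennreal) \<in> borel_measurable (?M \<Otimes>\<^sub>M ?M)"
    by (intro borel_measurable_times_ennreal measurable_compose[OF tm(3) Fm] measurable_compose[OF f Bm])
  have sq2: "(\<lambda>p. indicator ?B ((\<lambda>(x, y). ?t (n (?L y)) x) p) * indicator F (fst p) :: ennreal) \<in> borel_measurable (?M \<Otimes>\<^sub>M ?M)"
    by (intro borel_measurable_times_ennreal measurable_compose[OF tm(2) Bm] measurable_compose[OF f Fm])
  define c where "c = emeasure ?M ?B"
  have space_t: "?t T G \<in> space ?M" for T G by (simp add: translate_def mat_lborel_def space_PiM)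
  have undef: "x \<in> space ?M \<Longrightarrow> p \<notin> index_square N \<Longrightarrow> x p = undefined" for x p
    unfolding mat_lborel_def space_PiM PiE_def extensional_def by blast
  have e1: "?L (?t (?L' x) y) = ?t x (?L y)" for x y
  proof (rule ext)
    fix p :: "nat \<times> nat" obtain i j where p: "p = (i, j)" by fastforce
    show "?L (?t (?L' x) y) p = ?t x (?L y) p"
    proof (cases "p \<in> index_square N")
      case True
      then have "?L (?t (?L' x) y) p = app N W (\<lambda>k. y (k, j) + app N (inverse_isometry W) (\<lambda>l. x (l, j)) k) i"
        by (auto simp: p left_mult_def translate_def intro!: app_cong)
      also have "\<dots> = app N W (\<lambda>k. y (k, j)) i + x (i, j)"
        using True by (simp add: app_add app_inverse[OF W'] p)
      finally show ?thesis using True by (simp add: p left_mult_def translate_def)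
    qed (auto simp: p left_mult_def translate_def restrict_def)
  qed
  have "(\<integral>\<^sup>+x. indicator ?B x * emeasure ?M (?L -` F \<inter> space ?M) \<partial>?M) =
      (\<integral>\<^sup>+x. (\<integral>\<^sup>+y. indicator ?B x * indicator F (?t x (?L y)) \<partial>?M) \<partial>?M)"
  proof (rule nn_integral_cong)
    fix x assume "x \<in> space ?M"
    have LFm: "(\<lambda>y. indicator F (?L y) :: ennreal) \<in> borel_measurable ?M"
      by (rule measurable_compose[OF left_mult_measurable Fm])
    have "emeasure ?M (?L -` F \<inter> space ?M) = (\<integral>\<^sup>+y. indicator (?L -` F \<inter> space ?M) y \<partial>?M)"
      using measurable_sets[OF left_mult_measurable F] by simp
    also have "\<dots> = (\<integral>\<^sup>+y. indicator F (?L y) \<partial>?M)"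
      by (intro nn_integral_cong) (auto simp: indicator_def)
    also have "\<dots> = (\<integral>\<^sup>+y. indicator F (?L (?t (?L' x) y)) \<partial>?M)"
      by (rule nn_integral_mat_translate[OF LFm, symmetric])
    finally have "emeasure ?M (?L -` F \<inter> space ?M) = (\<integral>\<^sup>+y. indicator F (?t x (?L y)) \<partial>?M)" by (simp only: e1)
    then show "indicator ?B x * emeasure ?M (?L -` F \<inter> space ?M) = (\<integral>\<^sup>+y. indicator ?B x * indicator F (?t x (?L y)) \<partial>?M)"
      using measurable_compose[OF measurable_compose[OF _ tm(3)] Fm, of "\<lambda>y. (x, y)" ?M] \<open>x \<in> space ?M\<close>
      by (simp add: nn_integral_cmult)
  qed
  also have "\<dots> = (\<integral>\<^sup>+y. (\<integral>\<^sup>+x. indicator ?B x * indicator F (?t x (?L y)) \<partial>?M) \<partial>?M)"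
    by (rule MM.Fubini'[symmetric]) (use sq in \<open>simp add: split_beta'\<close>)
  also have "\<dots> = (\<integral>\<^sup>+y. (\<integral>\<^sup>+x. indicator ?B (?t (n (?L y)) x) * indicator F x \<partial>?M) \<partial>?M)"
  proof (rule nn_integral_cong)
    fix y assume y: "y \<in> space ?M"
    have m1: "(\<lambda>x. ?t x (?L y)) \<in> measurable ?M ?M"
      using measurable_compose[OF measurable_Pair2'[OF y] tm(3)] by simp
    have "(\<integral>\<^sup>+x. indicator ?B x * indicator F (?t x (?L y)) \<partial>?M)
      = (\<integral>\<^sup>+x. indicator ?B (?t (n (?L y)) x) * indicator F (?t (?t (n (?L y)) x) (?L y)) \<partial>?M)"
      using nn_integral_mat_translate[of "\<lambda>x. indicator ?B x * indicator F (?t x (?L y))" N "n (?L y)"]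
        measurable_compose[OF m1 Fm] Bm by simp
    also have "\<dots> = (\<integral>\<^sup>+x. indicator ?B (?t (n (?L y)) x) * indicator F x \<partial>?M)"
    proof (rule nn_integral_cong)
      fix x assume "x \<in> space ?M"
      then have "?t (?t (n (?L y)) x) (?L y) = x"
        by (auto simp: translate_def n_def fun_eq_iff restrict_def undef)
      then show "indicator ?B (?t (n (?L y)) x) * indicator F (?t (?t (n (?L y)) x) (?L y)) = (indicator ?B (?t (n (?L y)) x) * indicator F x :: ennreal)"
        by simp
    qed
    finally show "(\<integral>\<^sup>+x. indicator ?B x * indicator F (?t x (?L y)) \<partial>?M) = (\<integral>\<^sup>+x. indicator ?B (?t (n (?L y)) x) * indicator F x \<partial>?M)" .
  qed
  also have "\<dots> = (\<integral>\<^sup>+x. (\<integral>\<^sup>+y. indicator ?B (?t (n (?L y)) x) * indicator F x \<partial>?M) \<partial>?M)"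
    by (rule MM.Fubini') (use sq2 in \<open>simp add: split_beta'\<close>)
  also have "\<dots> = (\<integral>\<^sup>+x. c * indicator F x \<partial>?M)"
  proof (rule nn_integral_cong)
    fix x assume x: "x \<in> space ?M"
    \<comment> \<open>The Frobenius norm of \<open>x - W y\<close> is that of
      \<open>W (y - W* x)\<close>, hence that of \<open>y - W* x\<close> because \<open>W\<close> is
      an isometry. A translation in \<open>y\<close> then removes the dependence on
      \<open>x\<close>.\<close>
    have eq: "indicator ?B (?t (n (?L y)) x) = (indicator ?B (?t (n (?L' x)) y) :: ennreal)" for y
    proof -
      have "frobenius N (?t (n (?L y)) x) = frobenius N (?L (?t (n (?L' x)) y))"
        unfolding frobenius_def
      proof (intro sum.cong refl arg_cong[where f = "\<lambda>x. x\<^sup>2"])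
        fix i j assume ij: "i \<in> {..<N}" "j \<in> {..<N}"
        have "?L (?t (n (?L' x)) y) (i, j) = app N W (\<lambda>k. y (k, j) + - app N (inverse_isometry W) (\<lambda>l. x (l, j)) k) i"
          using ij by (auto simp: left_mult_def translate_def n_def intro!: app_cong)
        also have "\<dots> = app N W (\<lambda>k. y (k, j)) i - x (i, j)"
          using ij app_inverse[OF W', of i "\<lambda>l. x (l, j)"] by (simp only: app_add app_minus lessThan_iff) simp
        finally show "norm (?t (n (?L y)) x (i, j)) = norm (?L (?t (n (?L' x)) y) (i, j))"
          using ij by (simp add: translate_def n_def left_mult_def norm_minus_commute)
      qed
      then show ?thesis using space_t by (simp add: frobenius_ball_def frobenius_left_mult[OF W] indicator_def)
    qed
    have "(\<integral>\<^sup>+y. indicator ?B (?t (n (?L y)) x) \<partial>?M) = c"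
      unfolding eq c_def using nn_integral_mat_translate[OF Bm] frobenius_ball_sets by simp
    moreover have "(\<lambda>y. indicator ?B (?t (n (?L y)) x) :: ennreal) \<in> borel_measurable ?M"
      using measurable_compose[OF measurable_compose[OF measurable_Pair1'[OF x] tm(2)] Bm] by simp
    ultimately show "(\<integral>\<^sup>+y. indicator ?B (?t (n (?L y)) x) * indicator F x \<partial>?M) = c * indicator F x"
      by (simp add: nn_integral_multc)
  qed
  also have "\<dots> = c * emeasure ?M F" using F by (simp add: nn_integral_cmult)
  finally have "c * emeasure ?M (?L -` F \<inter> space ?M) = c * emeasure ?M F"
    using Bm frobenius_ball_sets by (simp add: nn_integral_multc c_def)
  then show ?thesis
    using frobenius_ball_emeasure[of N] unfolding c_def by (simp add: ennreal_mult_cancel_left)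
qed

section \<open>Almost every matrix is invertible\<close>

lemma borel_measurable_cnj:
  assumes "f \<in> borel_measurable M"
  shows "(\<lambda>x. cnj (f x)) \<in> borel_measurable M"
  using measurable_compose[OF assms borel_measurable_continuous_onI[of cnj]] by (simp add: continuous_on_cnj)

lemma finite_det_shift_zeros:
  "finite {t::real. fdet N (\<lambda>i j. G (i, j) + (if i = j then - of_real t else 0)) = (0::complex)}"
proof -
  define A where "A = Matrix.mat N N (\<lambda>(i, j). G (i, j))"
  have A: "A \<in> carrier_mat N N" by (simp add: A_def)
  have "fdet N (\<lambda>i j. G (i, j) + (if i = j then - of_real t else 0)) = Determinant.det (char_matrix A (of_real t))" for t :: real
    unfolding fdet_def by (rule arg_cong[of _ _ Determinant.det]) (auto simp: char_matrix_def A_def)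
  then have "{t::real. fdet N (\<lambda>i j. G (i, j) + (if i = j then - of_real t else 0)) = (0::complex)}
      = of_real -` {e. poly (char_poly A) e = 0}"
    by (auto simp: eigenvalue_det[OF A, symmetric] eigenvalue_root_char_poly[OF A])
  moreover have "char_poly A \<noteq> 0" using degree_monic_char_poly[OF A] by auto
  then have "finite {e. poly (char_poly A) e = 0}" by (rule poly_roots_finite)
  then have "finite (complex_of_real -` {e. poly (char_poly A) e = 0})" by (rule finite_vimageI) (rule inj_of_real)
  ultimately show ?thesis by simp
qed

text \<open>On every line in the direction of the identity matrix there are only finitely many
  singular matrices, the roots of a characteristic polynomial. Translation invariance and Fubini
  spread this over the whole space.\<close>

lemma AE_det_nonzero: "AE G in mat_lborel N. fdet N (\<lambda>i j. G (i, j)) \<noteq> 0"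
proof -
  let ?M = "mat_lborel N" and ?t = "translate (index_square N)"
  interpret M: sigma_finite_measure ?M unfolding mat_lborel_def by (rule lborel_prod.sigma_finite) simp
  interpret RM: pair_sigma_finite "lborel :: real measure" ?M by standard
  define Z where "Z = {G \<in> space ?M. fdet N (\<lambda>i j. G (i, j)) = 0}"
  have dm: "(\<lambda>G. fdet N (\<lambda>i j. G (i, j))) \<in> borel_measurable ?M"
    by (intro borel_measurable_fdet mat_entry_measurable) auto
  have Z: "Z \<in> sets ?M"
  proof -
    have "(\<lambda>G. fdet N (\<lambda>i j. G (i, j))) -` {0} \<inter> space ?M \<in> sets ?M" by (rule measurable_sets[OF dm]) simp
    moreover have "(\<lambda>G. fdet N (\<lambda>i j. G (i, j))) -` {0} \<inter> space ?M = Z" by (auto simp: Z_def)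
    ultimately show ?thesis by simp
  qed
  define T where "T t = (\<lambda>(i::nat, j::nat). if i = j then - complex_of_real t else 0)" for t
  have Zm: "(indicator Z :: _ \<Rightarrow> ennreal) \<in> borel_measurable ?M" using Z by simp
  have "(\<lambda>p. ?t (T (fst p)) (snd p)) \<in> measurable (lborel \<Otimes>\<^sub>M ?M) ?M"
    unfolding translate_def T_def split_beta'
    using measurable_compose[OF measurable_snd mat_entry_measurable]
    by (intro mat_lborel_measurableI borel_measurable_add measurable_If_set) auto
  note tZ = measurable_compose[OF this Zm]
  have fm: "(\<lambda>(t, G). indicator {0..1} t * indicator Z (?t (T t) G) :: ennreal) \<in> borel_measurable (lborel \<Otimes>\<^sub>M ?M)"
    unfolding split_beta' by (intro borel_measurable_times_ennreal tZ) measurable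
  \<comment> \<open>The weight \<open>indicator {0..1}\<close> has integral 1: the measure of
    \<open>Z\<close> is written as an average over its translates.\<close>
  have "emeasure ?M Z = (\<integral>\<^sup>+t. indicator {0..1} t * emeasure ?M Z \<partial>(lborel :: real measure))"
    by (simp add: nn_integral_multc)
  also have "\<dots> = (\<integral>\<^sup>+t. (\<integral>\<^sup>+G. indicator {0..1} t * indicator Z (?t (T t) G) \<partial>?M) \<partial>(lborel :: real measure))"
  proof (rule nn_integral_cong)
    fix t :: real
    have m: "(\<lambda>G. indicator Z (?t (T t) G) :: ennreal) \<in> borel_measurable ?M"
      unfolding translate_def
      by (intro measurable_compose[OF _ Zm] mat_lborel_measurableI borel_measurable_add mat_entry_measurable) auto
    have "(\<integral>\<^sup>+G. indicator Z (?t (T t) G) \<partial>?M) = emeasure ?M Z"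
      using nn_integral_mat_translate[OF Zm] Z by simp
    then show "indicator {0..1} t * emeasure ?M Z = (\<integral>\<^sup>+G. indicator {0..1} t * indicator Z (?t (T t) G) \<partial>?M)"
      using m by (simp add: nn_integral_cmult)
  qed
  also have "\<dots> = (\<integral>\<^sup>+G. (\<integral>\<^sup>+t. indicator {0..1} t * indicator Z (?t (T t) G) \<partial>(lborel :: real measure)) \<partial>?M)"
    by (rule RM.Fubini'[OF fm, symmetric])
  also have "\<dots> = (\<integral>\<^sup>+G. 0 \<partial>?M)"
  proof (rule nn_integral_cong)
    fix G
    let ?Z = "{t::real. fdet N (\<lambda>i j. G (i, j) + (if i = j then - of_real t else 0)) = (0::complex)}"
    have "?Z \<in> null_sets lborel" by (rule finite_imp_null_set_lborel[OF finite_det_shift_zeros])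
    then have "AE t in lborel. t \<notin> ?Z" by (rule AE_not_in)
    then have "AE t in lborel. indicator {0..1} t * indicator Z (?t (T t) G) = (0::ennreal)"
    proof eventually_elim
      case (elim t)
      have "fdet N (\<lambda>i j. ?t (T t) G (i, j)) = fdet N (\<lambda>i j. G (i, j) + (if i = j then - of_real t else 0))"
        by (rule fdet_cong) (auto simp: translate_def T_def)
      then have "?t (T t) G \<notin> Z" using elim by (simp add: Z_def)
      then show ?case by simp
    qed
    then show "(\<integral>\<^sup>+t. indicator {0..1} t * indicator Z (?t (T t) G) \<partial>lborel) = 0"
      by (subst nn_integral_cong_AE[of _ "\<lambda>_. 0"]) auto
  qed
  finally have "emeasure ?M Z = 0" by simp
  with Z have "Z \<in> null_sets ?M" by auto
  then have "AE G in ?M. G \<notin> Z" by (rule AE_not_in)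
  with AE_space show ?thesis by eventually_elim (simp add: Z_def)
qed

section \<open>The uniform distribution on the Frobenius ball\<close>

definition ball_measure :: "nat \<Rightarrow> (nat \<times> nat \<Rightarrow> complex) measure" where
  "ball_measure N = uniform_measure (mat_lborel N) (frobenius_ball N)"

lemma prob_space_ball_measure: "prob_space (ball_measure N)"
  unfolding ball_measure_def using frobenius_ball_emeasure by (rule prob_space_uniform_measure)

lemma sets_ball_measure [measurable_cong, simp]: "sets (ball_measure N) = sets (mat_lborel N)"
  by (simp add: ball_measure_def)

lemma space_ball_measure [simp]: "space (ball_measure N) = space (mat_lborel N)"
  by (simp add: ball_measure_def)

lemma AE_ball_measure_det_nonzero: "AE G in ball_measure N. fdet N (\<lambda>i j. G (i, j)) \<noteq> 0"
  unfolding ball_measure_def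
  by (rule AE_uniform_measureI[OF frobenius_ball_sets]) (use AE_det_nonzero in eventually_elim, simp)

lemma left_mult_space: "left_mult N W G \<in> space (mat_lborel N)"
  by (auto simp: left_mult_def mat_lborel_def space_PiM)

lemma ball_measure_left_mult:
  assumes "isometry N W" "isometry N (inverse_isometry W)"
  shows "distr (ball_measure N) (ball_measure N) (left_mult N W) = ball_measure N"
proof (rule measure_eqI)
  fix A assume "A \<in> sets (distr (ball_measure N) (ball_measure N) (left_mult N W))"
  then have A: "A \<in> sets (mat_lborel N)" by simp
  let ?M = "mat_lborel N" and ?B = "frobenius_ball N" and ?L = "left_mult N W"
  have LA: "?L -` A \<inter> space ?M \<in> sets ?M" by (rule measurable_sets[OF left_mult_measurable A])
  have "emeasure (distr (ball_measure N) (ball_measure N) ?L) A = emeasure (ball_measure N) (?L -` A \<inter> space ?M)"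
    using left_mult_measurable A by (subst emeasure_distr) (auto cong: measurable_cong_sets)
  also have "\<dots> = emeasure ?M (?B \<inter> (?L -` A \<inter> space ?M)) / emeasure ?M ?B"
    unfolding ball_measure_def by (rule emeasure_uniform_measure[OF frobenius_ball_sets LA])
  also have "?B \<inter> (?L -` A \<inter> space ?M) = ?L -` (?B \<inter> A) \<inter> space ?M"
    using left_mult_space by (auto simp: frobenius_ball_def frobenius_left_mult[OF assms(1)])
  also have "emeasure ?M \<dots> = emeasure ?M (?B \<inter> A)"
    by (rule emeasure_left_mult[OF assms]) (use A frobenius_ball_sets in auto)
  also have "\<dots> / emeasure ?M ?B = emeasure (ball_measure N) A"
    unfolding ball_measure_def by (rule emeasure_uniform_measure[OF frobenius_ball_sets A, symmetric])
  finally show "emeasure (distr (ball_measure N) (ball_measure N) ?L) A = emeasure (ball_measure N) A" .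
qed simp

section \<open>The Gram-Schmidt process and its equivariance\<close>

fun gram_schmidt_col :: "nat \<Rightarrow> (nat \<Rightarrow> nat \<Rightarrow> complex) \<Rightarrow> nat \<Rightarrow> nat \<Rightarrow> complex" where
  "gram_schmidt_col N g k = (\<lambda>i. g k i - (\<Sum>j<k. ip N (gram_schmidt_col N g j) (g k) /
    ip N (gram_schmidt_col N g j) (gram_schmidt_col N g j) * gram_schmidt_col N g j i))"

declare gram_schmidt_col.simps [simp del]

abbreviation "gs \<equiv> gram_schmidt_col"

lemma ip_cong: "(\<And>i. i < N \<Longrightarrow> u i = u' i) \<Longrightarrow> (\<And>i. i < N \<Longrightarrow> v i = v' i) \<Longrightarrow> ip N u v = ip N u' v'"
  unfolding ip_def by (intro sum.cong refl) simp

lemma ip_cnj: "cnj (ip N u v) = ip N v u"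
  by (simp add: ip_def mult.commute)

lemma ip_diff_sum: "ip N u (\<lambda>i. v i - (\<Sum>j\<in>J. c j * q j i)) = ip N u v - (\<Sum>j\<in>J. c j * ip N u (q j))"
proof -
  have "ip N u (\<lambda>i. v i - (\<Sum>j\<in>J. c j * q j i)) = ip N u v - (\<Sum>i<N. \<Sum>j\<in>J. c j * (cnj (u i) * q j i))"
    by (simp add: ip_def right_diff_distrib sum_subtractf sum_distrib_left mult_ac)
  also have "(\<Sum>i<N. \<Sum>j\<in>J. c j * (cnj (u i) * q j i)) = (\<Sum>j\<in>J. c j * ip N u (q j))"
    by (subst sum.swap) (simp add: ip_def sum_distrib_left)
  finally show ?thesis .
qed

lemma ip_self_eq_0: "ip N u u = 0 \<Longrightarrow> i < N \<Longrightarrow> u i = 0"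
  by (simp add: ip_self sum_nonneg_eq_0_iff flip: of_real_sum)

lemma gs_orthogonal: "j < k \<Longrightarrow> ip N (gs N g j) (gs N g k) = 0"
proof (induction k arbitrary: j rule: less_induct)
  case (less k)
  let ?q = "gs N g"
  define c where "c l = ip N (?q l) (g k) / ip N (?q l) (?q l)" for l
  have orth: "ip N (?q j) (?q l) = 0" if l: "l < k" "l \<noteq> j" for l
  proof (cases "j < l")
    case True
    then show ?thesis using less.IH[OF l(1)] by simp
  next
    case False
    then have "ip N (?q l) (?q j) = 0" using less.IH[OF less.prems, of l] l by simp
    then show ?thesis using ip_cnj[of N "?q l" "?q j"] by simp
  qed
  have "ip N (?q j) (?q k) = ip N (?q j) (\<lambda>i. g k i - (\<Sum>l<k. c l * ?q l i))"
    by (subst (2) gram_schmidt_col.simps) (simp add: c_def)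
  also have "\<dots> = ip N (?q j) (g k) - (\<Sum>l<k. c l * ip N (?q j) (?q l))" by (rule ip_diff_sum)
  also have "(\<Sum>l<k. c l * ip N (?q j) (?q l)) = (\<Sum>l<k. if l = j then c j * ip N (?q j) (?q j) else 0)"
    using orth by (intro sum.cong refl) auto
  also have "\<dots> = c j * ip N (?q j) (?q j)" using less.prems by simp
  also have "\<dots> = ip N (?q j) (g k)"
  \<comment> \<open>A vanishing column makes the quotient 0 by the default value of division, and
    both sides are 0. Orthogonality thus holds for all matrices, singular ones included.\<close>
  proof (cases "ip N (?q j) (?q j) = 0")
    case True
    then have "?q j i = 0" if "i < N" for i using ip_self_eq_0 that by blast
    then have "ip N (?q j) (g k) = 0" by (simp add: ip_def)
    then show ?thesis using True by simp
  qed (simp add: c_def)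
  finally show ?case by simp
qed

lemma fdet_gs: "fdet N (\<lambda>i k. g k i) = fdet N (\<lambda>i k. gs N g k i)"
proof (rule fdet_unitriangular_cols[where C = "\<lambda>l b. if l = b then 1 else ip N (gs N g l) (g b) / ip N (gs N g l) (gs N g l)"])
  fix a b assume "a < N" "b < N"
  have "g b a = gs N g b a + (\<Sum>l<b. ip N (gs N g l) (g b) / ip N (gs N g l) (gs N g l) * gs N g l a)"
    by (subst gram_schmidt_col.simps) simp
  also have "\<dots> = (\<Sum>l\<le>b. gs N g l a * (if l = b then 1 else ip N (gs N g l) (g b) / ip N (gs N g l) (gs N g l)))"
    by (simp add: lessThan_Suc_atMost[symmetric] mult.commute)
  finally show "g b a = (\<Sum>l\<le>b. gs N g l a * (if l = b then 1 else ip N (gs N g l) (g b) / ip N (gs N g l) (gs N g l)))" .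
qed simp

lemma gs_nonzero:
  assumes "fdet N (\<lambda>i k. g k i) \<noteq> 0" "k < N"
  shows "ip N (gs N g k) (gs N g k) \<noteq> 0"
proof
  assume "ip N (gs N g k) (gs N g k) = 0"
  then have z: "gs N g k i = 0" if "i < N" for i using ip_self_eq_0 that by blast
  have "fdet N (\<lambda>i k. gs N g k i) = fdet N (\<lambda>i l. (if l = k then 0 else 1) * gs N g l i)"
    by (rule fdet_cong) (auto simp: z)
  also have "\<dots> = (\<Prod>l<N. if l = k then 0 else 1) * fdet N (\<lambda>i k. gs N g k i)"
    by (rule fdet_scale_cols)
  also have "(\<Prod>l<N. if l = k then 0 else 1) = (0::complex)" using assms(2) by (intro prod_zero) auto
  finally show False using assms(1) fdet_gs[of N g] by simp
qed

lemma gs_cong: "(\<And>j i. j \<le> k \<Longrightarrow> i < N \<Longrightarrow> g j i = g' j i) \<Longrightarrow> i < N \<Longrightarrow> gs N g k i = gs N g' k i"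
proof (induction k arbitrary: i rule: less_induct)
  case (less k)
  have q: "gs N g j i = gs N g' j i" if "j < k" "i < N" for j i
    using that less.prems(1) by (intro less.IH) auto
  have "ip N (gs N g j) (g k) = ip N (gs N g' j) (g' k)" "ip N (gs N g j) (gs N g j) = ip N (gs N g' j) (gs N g' j)" if "j < k" for j
    using q[OF that] less.prems(1)[of k] by (auto intro!: ip_cong)
  then show ?case
    using less.prems q by (subst (1 2) gram_schmidt_col.simps) simp
qed

text \<open>The process uses only inner products and linear combinations, and an isometry respects
  both. Through this the left invariance of the matrix distribution passes to the unitary
  factor.\<close>

lemma gs_app:
  assumes "isometry N W"
  shows "gs N (\<lambda>k. app N W (g k)) k = app N W (gs N g k)"
proof (induction k rule: less_induct)
  case (less k)
  define c where "c j = ip N (gs N g j) (g k) / ip N (gs N g j) (gs N g j)" for j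
  have "gs N (\<lambda>k. app N W (g k)) k = (\<lambda>i. app N W (g k) i - (\<Sum>j<k. c j * app N W (gs N g j) i))"
    unfolding c_def by (subst gram_schmidt_col.simps) (simp add: less.IH ip_app[OF assms])
  also have "\<dots> = app N W (\<lambda>i. g k i - (\<Sum>j<k. c j * gs N g j i))"
  proof
    fix i
    have "(\<Sum>j<k. c j * app N W (gs N g j) i) = (\<Sum>l<N. W i l * (\<Sum>j<k. c j * gs N g j l))"
      unfolding app_def sum_distrib_left by (subst sum.swap) (simp add: mult_ac)
    then show "app N W (g k) i - (\<Sum>j<k. c j * app N W (gs N g j) i) = app N W (\<lambda>i. g k i - (\<Sum>j<k. c j * gs N g j i)) i"
      by (simp add: app_def right_diff_distrib sum_subtractf)
  qed
  also have "\<dots> = app N W (gs N g k)" by (subst (2) gram_schmidt_col.simps) (simp add: c_def)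
  finally show ?case .
qed

definition gs_unit :: "nat \<Rightarrow> (nat \<times> nat \<Rightarrow> complex) \<Rightarrow> nat \<Rightarrow> nat \<Rightarrow> complex" where
  "gs_unit N G i k = (let q = gs N (\<lambda>k i. G (i, k)) k in q i / of_real (sqrt (Re (ip N q q))))"

lemma gs_unit_orthonormal:
  assumes "fdet N (\<lambda>i k. G (i, k)) \<noteq> 0"
  shows "isometry N (gs_unit N G)"
  unfolding isometry_def
proof (intro allI impI)
  fix k l assume kl: "k < N" "l < N"
  let ?q = "gs N (\<lambda>k i. G (i, k))"
  let ?s = "\<lambda>k. sqrt (Re (ip N (?q k) (?q k)))"
  have "(\<Sum>i<N. cnj (gs_unit N G i k) * gs_unit N G i l) = ip N (?q k) (?q l) / of_real (?s k * ?s l)"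
  proof -
    have "(\<Sum>i<N. cnj (u i / of_real s) * (v i / of_real t)) = ip N u v / of_real (s * t)" for u v s t
      by (simp add: ip_def sum_divide_distrib)
    then show ?thesis unfolding gs_unit_def Let_def .
  qed
  also have "\<dots> = (if k = l then 1 else 0)"
  proof (cases "k = l")
    case True
    have nz: "ip N (?q k) (?q k) \<noteq> 0" using gs_nonzero[of N "\<lambda>k i. G (i, k)"] assms kl by simp
    define r where "r = (\<Sum>i<N. (norm (?q k i))\<^sup>2)"
    have r: "ip N (?q k) (?q k) = of_real r" "r \<ge> 0" unfolding r_def by (rule ip_self) (simp add: sum_nonneg)
    then have ss: "?s k * ?s k = r" by simp
    have "ip N (?q k) (?q k) / of_real (?s k * ?s k) = 1"
      using nz r(2) unfolding ss r(1) by simp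
    then show ?thesis using True by (simp only: refl if_True)
  next
    case False
    then consider "k < l" | "l < k" by linarith
    then have "ip N (?q k) (?q l) = 0"
      using gs_orthogonal ip_cnj[of N "?q l" "?q k"] by cases auto
    then show ?thesis using False by simp
  qed
  finally show "(\<Sum>i<N. cnj (gs_unit N G i k) * gs_unit N G i l) = (if k = l then 1 else 0)" .
qed

lemma gs_unit_left_mult:
  assumes "isometry N W" "i < N" "k < N"
  shows "gs_unit N (left_mult N W G) i k = app N W (\<lambda>i. gs_unit N G i k) i"
proof -
  let ?q = "gs N (\<lambda>k i. G (i, k))" and ?q' = "gs N (\<lambda>k i. left_mult N W G (i, k))"
  have q: "?q' k i = app N W (?q k) i" if "i < N" for i
  proof -
    have "?q' k i = gs N (\<lambda>k. app N W (\<lambda>l. G (l, k))) k i"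
      using that assms(3) by (intro gs_cong) (auto simp: left_mult_def)
    then show ?thesis using gs_app[OF assms(1), of "\<lambda>k l. G (l, k)" k] by simp
  qed
  have "ip N (?q' k) (?q' k) = ip N (app N W (?q k)) (app N W (?q k))" using q by (intro ip_cong)
  then show ?thesis
    using q[OF assms(2)] by (simp add: gs_unit_def Let_def ip_app[OF assms(1)] app_def sum_divide_distrib)
qed

lemma gs_measurable: "k < N \<Longrightarrow> i < N \<Longrightarrow> (\<lambda>G. gs N (\<lambda>k i. G (i, k)) k i) \<in> borel_measurable (mat_lborel N)"
proof (induction k arbitrary: i rule: less_induct)
  case (less k)
  have q: "(\<lambda>G. gs N (\<lambda>k i. G (i, k)) j i) \<in> borel_measurable (mat_lborel N)" if "j < k" "i < N" for j i
    using that less by auto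
  have e: "(\<lambda>G. G (i, k)) \<in> borel_measurable (mat_lborel N)" if "i < N" for i
    using that less.prems by (intro mat_entry_measurable) auto
  have "(\<lambda>G. G (i, k) - (\<Sum>j<k. ip N (gs N (\<lambda>k i. G (i, k)) j) (\<lambda>i. G (i, k)) /
      ip N (gs N (\<lambda>k i. G (i, k)) j) (gs N (\<lambda>k i. G (i, k)) j) * gs N (\<lambda>k i. G (i, k)) j i)) \<in> borel_measurable (mat_lborel N)"
    unfolding ip_def
    by (intro borel_measurable_diff borel_measurable_sum borel_measurable_times borel_measurable_divide
        borel_measurable_cnj q e) (use less.prems in auto)
  then show ?case by (subst gram_schmidt_col.simps)
qed

lemma gs_unit_measurable: "k < N \<Longrightarrow> i < N \<Longrightarrow> (\<lambda>G. gs_unit N G i k) \<in> borel_measurable (mat_lborel N)"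
proof -
  assume ki: "k < N" "i < N"
  have "(\<lambda>G. ip N (gs N (\<lambda>k i. G (i, k)) k) (gs N (\<lambda>k i. G (i, k)) k)) \<in> borel_measurable (mat_lborel N)"
    unfolding ip_def using ki
    by (intro borel_measurable_sum borel_measurable_times borel_measurable_cnj gs_measurable) auto
  from measurable_compose[OF this, of "\<lambda>x. complex_of_real (sqrt (Re x))" borel]
  show "(\<lambda>G. gs_unit N G i k) \<in> borel_measurable (mat_lborel N)"
    unfolding gs_unit_def Let_def using ki
    by (intro borel_measurable_divide gs_measurable) (auto intro!: borel_measurable_continuous_onI continuous_intros)
qed

section \<open>The unitary group and its measurable structure\<close>

lemma mat_adjoint_carrier [simp]: "A \<in> carrier_mat n m \<Longrightarrow> mat_adjoint A \<in> carrier_mat m n"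
  by (auto simp: mat_adjoint_def)

lemma mat_adjoint_dim [simp]: "dim_row (mat_adjoint A) = dim_col A" "dim_col (mat_adjoint A) = dim_row A"
  by (auto simp: mat_adjoint_def)

lemma mat_adjoint_index [simp]:
  fixes A :: "complex mat"
  shows "i < dim_col A \<Longrightarrow> j < dim_row A \<Longrightarrow> mat_adjoint A $$ (i, j) = cnj (A $$ (j, i))"
  by (simp add: mat_adjoint_def mat_of_rows_def)

lemma mat_adjoint_mult:
  fixes A B :: "complex mat"
  assumes "A \<in> carrier_mat n m" "B \<in> carrier_mat m l"
  shows "mat_adjoint (A * B) = mat_adjoint B * mat_adjoint A"
  using assms by (intro eq_matI) (auto simp: scalar_prod_def mult.commute)

lemma mat_adjoint_mat_adjoint: "mat_adjoint (mat_adjoint A) = (A :: complex mat)"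
  by (intro eq_matI) auto

lemma unitary_matsD:
  assumes "U \<in> unitary_mats N"
  shows "U \<in> carrier_mat N N" "U * mat_adjoint U = 1\<^sub>m N" "mat_adjoint U * U = 1\<^sub>m N"
  using assms mat_mult_left_right_inverse[of U N "mat_adjoint U"] by (auto simp: unitary_mats_def)

lemma unitary_matsI: "U \<in> carrier_mat N N \<Longrightarrow> mat_adjoint U * U = 1\<^sub>m N \<Longrightarrow> U \<in> unitary_mats N"
  using mat_mult_left_right_inverse[of "mat_adjoint U" N U] by (auto simp: unitary_mats_def)

lemma unitary_mats_adjoint: "U \<in> unitary_mats N \<Longrightarrow> mat_adjoint U \<in> unitary_mats N"
  unfolding unitary_mats_def mem_Collect_eq mat_adjoint_mat_adjoint
  using unitary_matsD(1,3)[of U N, unfolded unitary_mats_def mem_Collect_eq] mat_adjoint_carrier by blast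

lemma unitary_mats_mult:
  assumes "U \<in> unitary_mats N" "V \<in> unitary_mats N"
  shows "U * V \<in> unitary_mats N"
proof -
  note U = unitary_matsD[OF assms(1)] and V = unitary_matsD[OF assms(2)]
  have "U * V * mat_adjoint (U * V) = U * V * (mat_adjoint V * mat_adjoint U)"
    using U V by (simp add: mat_adjoint_mult[of U N N V N])
  also have "\<dots> = U * (V * (mat_adjoint V * mat_adjoint U))"
    by (rule assoc_mult_mat[of _ N N _ N _ N]) (use U V in auto)
  also have "V * (mat_adjoint V * mat_adjoint U) = V * mat_adjoint V * mat_adjoint U"
    by (rule assoc_mult_mat[of _ N N _ N _ N, symmetric]) (use U V in auto)
  also have "U * (V * mat_adjoint V * mat_adjoint U) = 1\<^sub>m N" using U V by simp
  finally show ?thesis using U V by (auto simp: unitary_mats_def)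
qed

lemma unitary_isometry:
  assumes "U \<in> unitary_mats N"
  shows "isometry N (\<lambda>i k. U $$ (i, k))" "isometry N (inverse_isometry (\<lambda>i k. U $$ (i, k)))"
proof -
  note U = unitary_matsD[OF assms]
  have "(\<Sum>i<N. cnj (U $$ (i, k)) * U $$ (i, l)) = (mat_adjoint U * U) $$ (k, l)" if "k < N" "l < N" for k l
    using that U(1) by (simp add: scalar_prod_def lessThan_atLeast0)
  then show "isometry N (\<lambda>i k. U $$ (i, k))" unfolding isometry_def U(3) by auto
  have "(\<Sum>i<N. U $$ (k, i) * cnj (U $$ (l, i))) = (U * mat_adjoint U) $$ (k, l)" if "k < N" "l < N" for k l
    using that U(1) by (simp add: scalar_prod_def lessThan_atLeast0)
  then show "isometry N (inverse_isometry (\<lambda>i k. U $$ (i, k)))"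
    unfolding isometry_def inverse_isometry_def U(2) by auto
qed

lemma isometry_imp_unitary: "isometry N W \<Longrightarrow> Matrix.mat N N (\<lambda>(i, k). W i k) \<in> unitary_mats N"
  by (rule unitary_matsI) (auto intro!: eq_matI simp: scalar_prod_def isometry_def lessThan_atLeast0)

lemma space_unitary_space [simp]: "space (unitary_space N) = unitary_mats N"
  by (simp add: unitary_space_def)

lemma unitary_space_measurableI:
  assumes "f \<in> space M \<rightarrow> unitary_mats N"
    and "\<And>i j. i < N \<Longrightarrow> j < N \<Longrightarrow> (\<lambda>x. f x $$ (i, j)) \<in> borel_measurable M"
  shows "f \<in> measurable M (unitary_space N)"
  unfolding unitary_space_def
  by (intro measurable_vimage_algebra2 assms(1) measurable_restrict) (auto intro: assms(2))

lemma unitary_entry_measurable: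
  assumes "i < N" "j < N"
  shows "(\<lambda>U. U $$ (i, j)) \<in> borel_measurable (unitary_space N)"
proof -
  let ?h = "\<lambda>U. \<lambda>(i, j)\<in>{..<N} \<times> {..<N}. U $$ (i, j) :: complex"
  have "?h \<in> measurable (unitary_space N) (Pi\<^sub>M ({..<N} \<times> {..<N}) (\<lambda>_. borel))"
    unfolding unitary_space_def by (rule measurable_vimage_algebra1) (auto simp: space_PiM)
  from measurable_compose[OF this measurable_component_singleton[of "(i, j)"]] assms show ?thesis by simp
qed

text \<open>The identity as default on singular matrices gives a map into the unitary group
  everywhere; singular matrices form a null set.\<close>

definition unitary_of :: "nat \<Rightarrow> (nat \<times> nat \<Rightarrow> complex) \<Rightarrow> complex mat" where
  "unitary_of N G = (if fdet N (\<lambda>i k. G (i, k)) = 0 then 1\<^sub>m N else Matrix.mat N N (\<lambda>(i, k). gs_unit N G i k))"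

lemma one_unitary: "1\<^sub>m N \<in> unitary_mats N"
  by (rule unitary_matsI) (auto intro!: eq_matI simp: scalar_prod_def if_distrib cong: if_cong)

lemma unitary_of_unitary: "unitary_of N G \<in> unitary_mats N"
  unfolding unitary_of_def using isometry_imp_unitary[OF gs_unit_orthonormal] one_unitary by auto

lemma unitary_of_left_mult:
  assumes U: "U \<in> unitary_mats N" and G: "fdet N (\<lambda>i k. G (i, k)) \<noteq> 0"
  shows "unitary_of N (left_mult N (\<lambda>i k. U $$ (i, k)) G) = U * unitary_of N G"
proof -
  let ?W = "\<lambda>i k. U $$ (i, k)"
  have "fdet N (\<lambda>i k. left_mult N ?W G (i, k)) = fdet N (\<lambda>i k. \<Sum>l<N. U $$ (i, l) * G (l, k))"
    by (rule fdet_cong) (auto simp: left_mult_def app_def)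
  also have "\<dots> = fdet N ?W * fdet N (\<lambda>i k. G (i, k))" by (rule fdet_mult)
  finally have d: "fdet N (\<lambda>i k. left_mult N ?W G (i, k)) = fdet N ?W * fdet N (\<lambda>i k. G (i, k))" .
  have "Determinant.det U * Determinant.det (mat_adjoint U) = 1"
    using det_mult[of U N "mat_adjoint U"] unitary_matsD[OF U] by simp
  moreover have "fdet N ?W = Determinant.det U"
    unfolding fdet_def using unitary_matsD(1)[OF U] by (intro arg_cong[of _ _ Determinant.det] eq_matI) auto
  ultimately have "fdet N ?W \<noteq> 0" by auto
  with d G have nz: "fdet N (\<lambda>i k. left_mult N ?W G (i, k)) \<noteq> 0" by simp
  show ?thesis
    using G nz unitary_matsD(1)[OF U] gs_unit_left_mult[OF unitary_isometry(1)[OF U]]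
    by (intro eq_matI) (auto simp: unitary_of_def scalar_prod_def app_def lessThan_atLeast0)
qed

lemma unitary_of_measurable: "unitary_of N \<in> measurable (mat_lborel N) (unitary_space N)"
proof (rule unitary_space_measurableI)
  fix i j assume ij: "i < N" "j < N"
  have dm: "(\<lambda>G. fdet N (\<lambda>i j. G (i, j))) \<in> borel_measurable (mat_lborel N)"
    by (intro borel_measurable_fdet mat_entry_measurable) auto
  have "(\<lambda>G. fdet N (\<lambda>i j. G (i, j))) -` {0} \<inter> space (mat_lborel N) \<in> sets (mat_lborel N)"
    by (rule measurable_sets[OF dm]) simp
  then have s: "{G \<in> space (mat_lborel N). fdet N (\<lambda>i j. G (i, j)) = 0} \<in> sets (mat_lborel N)"
    by (simp add: vimage_def Int_def conj_commute)
  have "(\<lambda>G. if fdet N (\<lambda>i j. G (i, j)) = 0 then 1\<^sub>m N $$ (i, j) else gs_unit N G i j) \<in> borel_measurable (mat_lborel N)"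
    using s gs_unit_measurable[OF ij(2,1)] by (intro measurable_If) auto
  moreover have "unitary_of N G $$ (i, j) = (if fdet N (\<lambda>i j. G (i, j)) = 0 then 1\<^sub>m N $$ (i, j) else gs_unit N G i j)" for G
    using ij by (simp add: unitary_of_def)
  ultimately show "(\<lambda>G. unitary_of N G $$ (i, j)) \<in> borel_measurable (mat_lborel N)" by simp
qed (use unitary_of_unitary in auto)

section \<open>Diagonal matrices conjugated by a random unitary matrix\<close>

definition diag_of :: "nat \<Rightarrow> (nat \<Rightarrow> complex) \<Rightarrow> complex mat" where
  "diag_of N z = Matrix.mat N N (\<lambda>(i, j). if i = j then z i else 0)"

lemma diag_of_unitary:
  assumes "z \<in> space (torus N)"
  shows "diag_of N z \<in> unitary_mats N"
  unfolding diag_of_def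
proof (rule isometry_imp_unitary[where W = "\<lambda>i j. if i = j then z i else 0"], unfold isometry_def, intro allI impI)
  fix k l assume kl: "k < N" "l < N"
  then have "cnj (z k) * z k = 1"
    using assms by (auto simp: space_torus PiE_iff complex_norm_square[symmetric] mult.commute)
  moreover have "(\<Sum>i<N. cnj (if i = k then z i else 0) * (if i = l then z i else 0)) = (\<Sum>i<N. if i = k then (if k = l then cnj (z k) * z k else 0) else 0)"
    by (intro sum.cong refl) auto
  ultimately show "(\<Sum>i<N. cnj (if i = k then z i else 0) * (if i = l then z i else 0)) = (if k = l then 1 else 0)"
    using kl by (cases "k = l") auto
qed

definition conjugated_diag :: "nat \<Rightarrow> (nat \<times> nat \<Rightarrow> complex) \<times> (nat \<Rightarrow> complex) \<Rightarrow> complex mat" where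
  "conjugated_diag N = (\<lambda>(G, z). unitary_of N G * diag_of N z * mat_adjoint (unitary_of N G))"

lemma conjugated_diag_unitary: "z \<in> space (torus N) \<Longrightarrow> conjugated_diag N (G, z) \<in> unitary_mats N"
  unfolding conjugated_diag_def
  by (auto intro!: unitary_mats_mult unitary_of_unitary diag_of_unitary unitary_mats_adjoint)

lemma mult_index:
  fixes A B :: "complex mat"
  assumes "A \<in> carrier_mat N N" "B \<in> carrier_mat N N" "i < N" "j < N"
  shows "(A * B) $$ (i, j) = (\<Sum>k<N. A $$ (i, k) * B $$ (k, j))"
  using assms by (simp add: scalar_prod_def lessThan_atLeast0)

lemma triple_mult_index:
  fixes A D B :: "complex mat"
  assumes "A \<in> carrier_mat N N" "D \<in> carrier_mat N N" "B \<in> carrier_mat N N" "i < N" "j < N"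
  shows "(A * D * B) $$ (i, j) = (\<Sum>l<N. (\<Sum>k<N. A $$ (i, k) * D $$ (k, l)) * B $$ (l, j))"
proof -
  have "(A * D * B) $$ (i, j) = (\<Sum>l<N. (A * D) $$ (i, l) * B $$ (l, j))"
    by (rule mult_index) (use assms in auto)
  also have "\<dots> = (\<Sum>l<N. (\<Sum>k<N. A $$ (i, k) * D $$ (k, l)) * B $$ (l, j))"
    using assms by (intro sum.cong refl arg_cong2[where f = "(*)"] mult_index) auto
  finally show ?thesis .
qed

lemma torus_component_borel: "a < N \<Longrightarrow> (\<lambda>z. z a) \<in> borel_measurable (torus N)"
  by (rule measurable_compose[OF torus_component_measurable borel_measurable_circleI]) auto

lemma conjugated_diag_measurable:
  "conjugated_diag N \<in> measurable (mat_lborel N \<Otimes>\<^sub>M torus N) (unitary_space N)"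
proof (rule unitary_space_measurableI)
  show "conjugated_diag N \<in> space (mat_lborel N \<Otimes>\<^sub>M torus N) \<rightarrow> unitary_mats N"
    by (auto simp: space_pair_measure conjugated_diag_unitary)
  fix i j assume ij: "i < N" "j < N"
  have u: "(\<lambda>p. unitary_of N (fst p) $$ (a, b)) \<in> borel_measurable (mat_lborel N \<Otimes>\<^sub>M torus N)" if "a < N" "b < N" for a b
    using measurable_compose[OF measurable_compose[OF measurable_fst unitary_of_measurable] unitary_entry_measurable[OF that]] .
  have z: "(\<lambda>p. diag_of N (snd p) $$ (k, l)) \<in> borel_measurable (mat_lborel N \<Otimes>\<^sub>M torus N)" if "k < N" "l < N" for k l
    using that measurable_compose[OF measurable_snd torus_component_borel[OF that(1)]]
    by (cases "k = l") (simp_all add: diag_of_def)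
  have "(\<lambda>p. \<Sum>l<N. (\<Sum>k<N. unitary_of N (fst p) $$ (i, k) * diag_of N (snd p) $$ (k, l)) * cnj (unitary_of N (fst p) $$ (j, l)))
      \<in> borel_measurable (mat_lborel N \<Otimes>\<^sub>M torus N)"
    using ij by (intro borel_measurable_sum borel_measurable_times borel_measurable_cnj u z) auto
  moreover have "conjugated_diag N p $$ (i, j) = (\<Sum>l<N. (\<Sum>k<N. unitary_of N (fst p) $$ (i, k) * diag_of N (snd p) $$ (k, l)) * cnj (unitary_of N (fst p) $$ (j, l)))" for p
  proof -
    have c: "unitary_of N (fst p) \<in> carrier_mat N N" using unitary_matsD(1)[OF unitary_of_unitary] .
    have "diag_of N (snd p) \<in> carrier_mat N N" by (simp add: diag_of_def)
    then have "conjugated_diag N p $$ (i, j) = (\<Sum>l<N. (\<Sum>k<N. unitary_of N (fst p) $$ (i, k) * diag_of N (snd p) $$ (k, l)) * mat_adjoint (unitary_of N (fst p)) $$ (l, j))"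
      unfolding conjugated_diag_def split_beta using c ij by (intro triple_mult_index) auto
    also have "\<dots> = (\<Sum>l<N. (\<Sum>k<N. unitary_of N (fst p) $$ (i, k) * diag_of N (snd p) $$ (k, l)) * cnj (unitary_of N (fst p) $$ (j, l)))"
      using c ij by (intro sum.cong refl arg_cong2[where f = "(*)"]) auto
    finally show ?thesis .
  qed
  ultimately show "(\<lambda>p. conjugated_diag N p $$ (i, j)) \<in> borel_measurable (mat_lborel N \<Otimes>\<^sub>M torus N)" by simp
qed

lemma conjugation_measurable:
  assumes "V \<in> unitary_mats N"
  shows "(\<lambda>U. V * U * mat_adjoint V) \<in> measurable (unitary_space N) (unitary_space N)"
proof (rule unitary_space_measurableI)
  show "(\<lambda>U. V * U * mat_adjoint V) \<in> space (unitary_space N) \<rightarrow> unitary_mats N"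
    using assms by (auto intro!: unitary_mats_mult unitary_mats_adjoint)
  fix i j assume ij: "i < N" "j < N"
  have "(\<lambda>U. \<Sum>l<N. (\<Sum>k<N. V $$ (i, k) * U $$ (k, l)) * mat_adjoint V $$ (l, j)) \<in> borel_measurable (unitary_space N)"
    by (intro borel_measurable_sum borel_measurable_times unitary_entry_measurable) auto
  then show "(\<lambda>U. (V * U * mat_adjoint V) $$ (i, j)) \<in> borel_measurable (unitary_space N)"
    by (rule measurable_cong[THEN iffD1, rotated])
      (use unitary_matsD(1) assms ij in \<open>auto intro!: triple_mult_index[symmetric]\<close>)
qed

lemma sandwich_assoc:
  fixes V B D C E :: "complex mat"
  assumes "V \<in> carrier_mat N N" "B \<in> carrier_mat N N" "D \<in> carrier_mat N N" "C \<in> carrier_mat N N" "E \<in> carrier_mat N N"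
  shows "V * (B * D * C) * E = V * B * D * (C * E)"
proof -
  have "V * (B * D * C) = V * (B * D) * C"
    by (rule assoc_mult_mat[of _ N N _ N _ N, symmetric]) (use assms in auto)
  also have "V * (B * D) = V * B * D"
    by (rule assoc_mult_mat[of _ N N _ N _ N, symmetric]) (use assms in auto)
  finally have "V * (B * D * C) * E = V * B * D * C * E" by simp
  also have "\<dots> = V * B * D * (C * E)"
    by (rule assoc_mult_mat[of _ N N _ N _ N]) (use assms in auto)
  finally show ?thesis .
qed

definition random_unitary :: "nat \<Rightarrow> (nat \<Rightarrow> complex) measure \<Rightarrow> complex mat measure" where
  "random_unitary N P = distr (ball_measure N \<Otimes>\<^sub>M P) (unitary_space N) (conjugated_diag N)"

lemma conjugated_diag_measurable':
  "sets P = sets (torus N) \<Longrightarrow> conjugated_diag N \<in> measurable (ball_measure N \<Otimes>\<^sub>M P) (unitary_space N)"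
  using conjugated_diag_measurable measurable_cong_sets[OF sets_pair_measure_cong[OF sets_ball_measure] refl] by blast

text \<open>Conjugation by \<open>V\<close> replaces \<open>G\<close> by \<open>V G\<close> whenever
  \<open>G\<close> is invertible, by the equivariance of the Gram-Schmidt process. As
  \<open>V G\<close> has the distribution of \<open>G\<close> and is again independent of
  \<open>z\<close>, the law does not change.\<close>

lemma unitarily_invariant_random_unitary:
  assumes "prob_space P" and sets: "sets P = sets (torus N)"
  shows "unitarily_invariant N (random_unitary N P)"
  unfolding unitarily_invariant_def
proof (intro conjI ballI)
  interpret P: prob_space P by fact
  interpret B: prob_space "ball_measure N" by (rule prob_space_ball_measure)
  interpret BP: pair_prob_space "ball_measure N" P ..
  note m = conjugated_diag_measurable'[OF sets]
  show "prob_space (random_unitary N P)"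
    unfolding random_unitary_def by (rule BP.prob_space_distr[OF m])
  show "Sigma_Algebra.sets (random_unitary N P) = Sigma_Algebra.sets (unitary_space N)"
    by (simp add: random_unitary_def)
  fix V assume V: "V \<in> unitary_mats N"
  let ?c = "\<lambda>U. V * U * mat_adjoint V" and ?L = "left_mult N (\<lambda>i k. V $$ (i, k))"
  have Lm: "?L \<in> measurable (ball_measure N) (ball_measure N)"
    using left_mult_measurable measurable_cong_sets[OF sets_ball_measure sets_ball_measure] by blast
  have LIm: "(\<lambda>(G, z). (?L G, z)) \<in> measurable (ball_measure N \<Otimes>\<^sub>M P) (ball_measure N \<Otimes>\<^sub>M P)"
    using Lm by measurable
  have "distr (random_unitary N P) (unitary_space N) ?c = distr (ball_measure N \<Otimes>\<^sub>M P) (unitary_space N) (?c \<circ> conjugated_diag N)"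
    unfolding random_unitary_def by (rule distr_distr[OF conjugation_measurable[OF V] m])
  also have "\<dots> = distr (ball_measure N \<Otimes>\<^sub>M P) (unitary_space N) (conjugated_diag N \<circ> (\<lambda>(G, z). (?L G, z)))"
  proof (rule distr_cong_AE)
    have ae: "AE G in ball_measure N. V * unitary_of N G = unitary_of N (?L G)"
      using AE_ball_measure_det_nonzero by eventually_elim (simp add: unitary_of_left_mult[OF V])
    then have "AE G in distr (ball_measure N \<Otimes>\<^sub>M P) (ball_measure N) fst. V * unitary_of N G = unitary_of N (?L G)"
      by (simp only: P.distr_pair_fst)
    from AE_distrD[OF measurable_fst this]
    have "AE p in ball_measure N \<Otimes>\<^sub>M P. V * unitary_of N (fst p) = unitary_of N (?L (fst p))" .
    then show "AE p in ball_measure N \<Otimes>\<^sub>M P. (?c \<circ> conjugated_diag N) p = (conjugated_diag N \<circ> (\<lambda>(G, z). (?L G, z))) p"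
    proof eventually_elim
      case (elim p)
      obtain G z where p: "p = (G, z)" by fastforce
      note c = unitary_matsD(1)[OF V] unitary_matsD(1)[OF unitary_of_unitary[of N G]]
      have d: "diag_of N z \<in> carrier_mat N N" by (simp add: diag_of_def)
      have "V * (unitary_of N G * diag_of N z * mat_adjoint (unitary_of N G)) * mat_adjoint V
        = (V * unitary_of N G) * diag_of N z * (mat_adjoint (unitary_of N G) * mat_adjoint V)"
        by (rule sandwich_assoc) (use c d in auto)
      also have "mat_adjoint (unitary_of N G) * mat_adjoint V = mat_adjoint (V * unitary_of N G)"
        using c by (simp add: mat_adjoint_mult[of _ N N _ N])
      finally show ?case using elim by (simp add: p conjugated_diag_def)
    qed
  qed (use m LIm conjugation_measurable[OF V] in \<open>auto intro: measurable_comp\<close>)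
  also have "\<dots> = distr (distr (ball_measure N \<Otimes>\<^sub>M P) (ball_measure N \<Otimes>\<^sub>M P) (\<lambda>(G, z). (?L G, z))) (unitary_space N) (conjugated_diag N)"
    by (rule distr_distr[OF m LIm, symmetric])
  also have "distr (ball_measure N \<Otimes>\<^sub>M P) (ball_measure N \<Otimes>\<^sub>M P) (\<lambda>(G, z). (?L G, z)) = ball_measure N \<Otimes>\<^sub>M P"
  proof -
    have idP: "distr P P (\<lambda>z. z) = P" by simp
    have "distr (ball_measure N) (ball_measure N) ?L \<Otimes>\<^sub>M distr P P (\<lambda>z. z) = distr (ball_measure N \<Otimes>\<^sub>M P) (ball_measure N \<Otimes>\<^sub>M P) (\<lambda>(G, z). (?L G, z))"
      by (rule pair_measure_distr[OF Lm]) (use P.sigma_finite_measure_axioms in \<open>auto simp: idP\<close>)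
    then show ?thesis by (simp only: idP ball_measure_left_mult[OF unitary_isometry[OF V]])
  qed
  finally show "distr (random_unitary N P) (unitary_space N) ?c = random_unitary N P"
    by (simp add: random_unitary_def)
qed

section \<open>Eigenvalues of a random unitary matrix\<close>

definition linear_product :: "nat \<Rightarrow> (nat \<Rightarrow> complex) \<Rightarrow> complex poly" where
  "linear_product N z = (\<Prod>a<N. [:- z a, 1:])"

lemma proots_linear_product: "proots (linear_product N z) = mset (map z [0..<N])"
proof -
  have "proots (linear_product N z) = (\<Sum>a<N. {#z a#})"
    unfolding linear_product_def by (subst proots_prod) auto
  also have "\<dots> = mset (map z [0..<N])"
    by (induction N) (auto simp: lessThan_Suc)
  finally show ?thesis .
qed

lemma linear_product_conv_list: "linear_product N (\<lambda>a. xs ! a) = (\<Prod>a\<leftarrow>xs. [:- a, 1:])" if "length xs = N"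
  using that unfolding linear_product_def by (simp add: prod.list_conv_set_nth lessThan_atLeast0)

lemma continuous_on_linear_product_coeff:
  "continuous_on UNIV (\<lambda>z. coeff (linear_product N z) i)"
proof (induction N arbitrary: i)
  case 0
  then show ?case by (simp add: linear_product_def)
next
  case (Suc N)
  have "coeff (linear_product (Suc N) z) i = - z N * coeff (linear_product N z) i + (if i = 0 then 0 else coeff (linear_product N z) (i - 1))" for z
    by (cases i) (simp_all add: linear_product_def)
  then show ?case
    by (simp only:) (cases "i = 0", auto intro!: continuous_intros Suc)
qed

section \<open>Eigenvalues of a unitary matrix, ordered by angle\<close>

lemma unitary_eigenvalue_norm:
  assumes U: "U \<in> unitary_mats N" and ev: "eigenvalue U k"
  shows "k \<in> unit_circle"
proof -
  note UD = unitary_matsD[OF U]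
  obtain v where v: "v \<in> carrier_vec N" "v \<noteq> 0\<^sub>v N" "U *\<^sub>v v = k \<cdot>\<^sub>v v"
    using ev UD(1) unfolding eigenvalue_def eigenvector_def by auto
  define u where "u i = v $ i" for i
  have "app N (\<lambda>i k. U $$ (i, k)) u i = k * u i" if "i < N" for i
  proof -
    have "(U *\<^sub>v v) $ i = (\<Sum>l<N. U $$ (i, l) * v $ l)"
      using that UD(1) v(1) by (simp add: scalar_prod_def lessThan_atLeast0)
    then show ?thesis using that v by (simp add: app_def u_def)
  qed
  then have "ip N (app N (\<lambda>i k. U $$ (i, k)) u) (app N (\<lambda>i k. U $$ (i, k)) u) = ip N (\<lambda>i. k * u i) (\<lambda>i. k * u i)"
    by (intro ip_cong)
  also have "\<dots> = of_real ((norm k)\<^sup>2) * ip N u u"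
    unfolding ip_def complex_norm_square by (simp add: sum_distrib_left mult_ac)
  finally have eq: "ip N u u = of_real ((norm k)\<^sup>2) * ip N u u" by (simp only: ip_app[OF unitary_isometry(1)[OF U]])
  have "ip N u u \<noteq> 0"
  proof
    assume "ip N u u = 0"
    then have "v $ i = 0" if "i < N" for i using ip_self_eq_0[of N u i] that by (simp add: u_def)
    then have "v = 0\<^sub>v N" using v(1) by (intro eq_vecI) auto
    then show False using v(2) by simp
  qed
  then have "complex_of_real ((norm k)\<^sup>2) = 1" using eq by (metis mult_cancel_right1)
  then have "(norm k)\<^sup>2 = 1" by (simp only: of_real_eq_1_iff)
  then have "norm k = 1 \<or> norm k = - 1" by (simp only: power2_eq_1_iff)
  then show ?thesis using norm_ge_zero[of k] by auto
qed

lemma cis_Arg2pi: "z \<in> unit_circle \<Longrightarrow> cis (Arg2pi z) = z"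
  using Arg2pi_eq[of z] by (simp add: cis_conv_exp)

lemma Arg2pi_cis: "0 \<le> t \<Longrightarrow> t < 2 * pi \<Longrightarrow> Arg2pi (cis t) = t"
  by (rule Arg2pi_unique[of 1]) (auto simp: cis_conv_exp)

text \<open>The characteristic polynomial fixes the roots as a multiset, and sorting their angles in
  \<open>[0, 2 * pi)\<close> removes the dependence on the chosen list.\<close>

definition eigenangles :: "complex mat \<Rightarrow> real list" where
  "eigenangles U = sort (map Arg2pi (SOME as. char_poly U = (\<Prod>a\<leftarrow>as. [:- a, 1:]) \<and> length as = dim_row U))"

lemma eigenangles:
  assumes U: "U \<in> unitary_mats N"
  shows "length (eigenangles U) = N" "sorted (eigenangles U)"
    "char_poly U = linear_product N (\<lambda>a. cis (eigenangles U ! a))"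
proof -
  have UN: "U \<in> carrier_mat N N" using U by (rule unitary_matsD)
  define as where "as = (SOME as. char_poly U = (\<Prod>a\<leftarrow>as. [:- a, 1:]) \<and> length as = dim_row U)"
  have "\<exists>as. char_poly U = (\<Prod>a\<leftarrow>as. [:- a, 1:]) \<and> length as = dim_row U"
    using char_poly_factorized[OF UN] UN by auto
  from someI_ex[OF this] have as: "char_poly U = (\<Prod>a\<leftarrow>as. [:- a, 1:])" "length as = N"
    using UN by (simp_all add: as_def)
  have e: "eigenangles U = sort (map Arg2pi as)" by (simp add: eigenangles_def as_def)
  show "length (eigenangles U) = N" "sorted (eigenangles U)" using as by (simp_all add: e)
  have circ: "a \<in> unit_circle" if "a \<in> set as" for a
  proof -
    have "poly (char_poly U) a = 0"
      using that unfolding as(1) by (auto simp: poly_prod_list prod_list_zero_iff)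
    then have "eigenvalue U a" by (simp add: eigenvalue_root_char_poly[OF UN])
    then show ?thesis by (rule unitary_eigenvalue_norm[OF U])
  qed
  have "linear_product N (\<lambda>a. cis (eigenangles U ! a)) = linear_product N (\<lambda>a. map cis (eigenangles U) ! a)"
    unfolding linear_product_def using as(2) by (intro prod.cong refl) (simp add: e)
  also have "\<dots> = (\<Prod>a\<leftarrow>map cis (eigenangles U). [:- a, 1:])"
    by (rule linear_product_conv_list) (simp add: e as(2))
  also have "\<dots> = prod_mset (image_mset (\<lambda>a. [:- a, 1:]) (image_mset cis (mset (eigenangles U))))"
    by (simp add: prod_mset_prod_list[symmetric] multiset.map_comp)
  also have "image_mset cis (mset (eigenangles U)) = mset (map (\<lambda>a. cis (Arg2pi a)) as)"
    by (simp add: e image_mset.compositionality o_def)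
  also have "map (\<lambda>a. cis (Arg2pi a)) as = as"
    by (rule map_idI) (rule cis_Arg2pi, rule circ)
  also have "prod_mset (image_mset (\<lambda>a. [:- a, 1:]) (mset as)) = char_poly U"
    by (simp add: as(1) prod_mset_prod_list[symmetric])
  finally show "char_poly U = linear_product N (\<lambda>a. cis (eigenangles U ! a))" ..
qed

lemma eigenangles_range:
  assumes U: "U \<in> unitary_mats N" and k: "k < N"
  shows "0 \<le> eigenangles U ! k" "eigenangles U ! k < 2 * pi"
proof -
  have "eigenangles U ! k \<in> set (eigenangles U)" using k eigenangles(1)[OF U] by simp
  then have "eigenangles U ! k \<in> range Arg2pi" unfolding eigenangles_def by auto
  then show "0 \<le> eigenangles U ! k" "eigenangles U ! k < 2 * pi"
    using Arg2pi_ge_0 Arg2pi_lt_2pi by auto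
qed

lemma sorted_nth_le_if_count:
  assumes "sorted xs" "k < length xs" "length (filter (\<lambda>x. x \<le> t) xs) \<ge> Suc k"
  shows "xs ! k \<le> (t::real)"
proof (rule ccontr)
  assume "\<not> xs ! k \<le> t"
  then have "\<not> xs ! (k + i) \<le> t" if "i < length xs - k" for i
  proof -
    have "k + i < length xs" using that by simp
    then have "xs ! k \<le> xs ! (k + i)" using assms(1) by (intro sorted_nth_mono) auto
    then show ?thesis using \<open>\<not> xs ! k \<le> t\<close> by simp
  qed
  then have "filter (\<lambda>x. x \<le> t) (drop k xs) = []"
    using assms(2) by (auto simp: filter_empty_conv in_set_conv_nth)
  then have "filter (\<lambda>x. x \<le> t) xs = filter (\<lambda>x. x \<le> t) (take k xs)"
    by (metis append_Nil2 append_take_drop_id filter_append)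
  then have "length (filter (\<lambda>x. x \<le> t) xs) \<le> k"
    using length_filter_le[of "\<lambda>x. x \<le> t" "take k xs"] by simp
  then show False using assms(3) by simp
qed

lemma eigenangles_mset:
  assumes U: "U \<in> unitary_mats N" and "char_poly U = linear_product N z"
  shows "mset (map cis (eigenangles U)) = mset (map z [0..<N])"
proof -
  have "mset (map (\<lambda>a. cis (eigenangles U ! a)) [0..<N]) = mset (map z [0..<N])"
    using eigenangles(3)[OF U] assms(2) by (metis proots_linear_product)
  moreover have "map (\<lambda>a. cis (eigenangles U ! a)) [0..<N] = map cis (eigenangles U)"
    using eigenangles(1)[OF U] by (intro nth_equalityI) auto
  ultimately show ?thesis by simp
qed

text \<open>Both sides say that at least \<open>k + 1\<close> roots, with multiplicity, lie on the
  arc of angles from 0 to \<open>t\<close>. The existential form presents the sublevel set through a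
  product of compact sets, which is what measurability needs.\<close>

lemma eigenangle_le_iff:
  assumes U: "U \<in> unitary_mats N" and k: "k < N" and t: "t < 2 * pi"
  shows "eigenangles U ! k \<le> t \<longleftrightarrow>
    (\<exists>z\<in>(\<Pi>\<^sub>E a\<in>{..<N}. if a \<le> k then cis ` {0..t} else unit_circle). char_poly U = linear_product N z)"
proof
  assume le: "eigenangles U ! k \<le> t"
  define z where "z = (\<lambda>a\<in>{..<N}. cis (eigenangles U ! a))"
  have "eigenangles U ! a \<in> {0..t}" if "a \<le> k" for a
    using that k le eigenangles_range[OF U, of a] sorted_nth_mono[OF eigenangles(2)[OF U] that] eigenangles(1)[OF U] by auto
  then have "z \<in> (\<Pi>\<^sub>E a\<in>{..<N}. if a \<le> k then cis ` {0..t} else unit_circle)"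
    by (auto simp: z_def)
  moreover have "char_poly U = linear_product N z"
    unfolding eigenangles(3)[OF U] linear_product_def by (intro prod.cong refl) (simp add: z_def)
  ultimately show "\<exists>z\<in>(\<Pi>\<^sub>E a\<in>{..<N}. if a \<le> k then cis ` {0..t} else unit_circle). char_poly U = linear_product N z"
    by blast
next
  assume "\<exists>z\<in>(\<Pi>\<^sub>E a\<in>{..<N}. if a \<le> k then cis ` {0..t} else unit_circle). char_poly U = linear_product N z"
  then obtain z where z: "z \<in> (\<Pi>\<^sub>E a\<in>{..<N}. if a \<le> k then cis ` {0..t} else unit_circle)" "char_poly U = linear_product N z"
    by blast
  let ?P = "\<lambda>w. Arg2pi w \<le> t"
  have "length (filter (\<lambda>x. x \<le> t) (eigenangles U)) = length (filter ?P (map cis (eigenangles U)))"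
  proof -
    have "Arg2pi (cis x) = x" if "x \<in> set (eigenangles U)" for x
      using that eigenangles_range[OF U] eigenangles(1)[OF U] by (auto simp: in_set_conv_nth intro!: Arg2pi_cis)
    then show ?thesis by (simp add: filter_map o_def cong: filter_cong)
  qed
  also have "\<dots> = size (filter_mset ?P (mset (map cis (eigenangles U))))" by (simp only: mset_filter[symmetric] size_mset)
  also have "\<dots> = size (filter_mset ?P (mset (map z [0..<N])))" by (simp only: eigenangles_mset[OF U z(2)])
  also have "\<dots> = length (filter ?P (map z [0..<N]))" by (simp only: mset_filter[symmetric] size_mset)
  also have "\<dots> \<ge> Suc k"
  proof -
    have "[0..<N] = [0..<Suc k] @ [Suc k..<N]" using k by (metis Suc_leI le0 upt_add_eq_append le_add_diff_inverse)
    then have "filter ?P (map z [0..<N]) = filter ?P (map z [0..<Suc k]) @ filter ?P (map z [Suc k..<N])"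
      by (simp only: map_append filter_append)
    moreover have "filter ?P (map z [0..<Suc k]) = map z [0..<Suc k]"
    proof (rule filter_True, rule ballI)
      fix w assume "w \<in> set (map z [0..<Suc k])"
      then obtain a where a: "a \<le> k" "w = z a" by (auto simp: less_Suc_eq_le simp del: upt_Suc)
      then have "z a \<in> cis ` {0..t}" using z(1) k by (auto simp: PiE_iff split: if_splits)
      then obtain s where "w = cis s" "0 \<le> s" "s \<le> t" using a by auto
      then show "Arg2pi w \<le> t" using t by (simp add: Arg2pi_cis)
    qed
    ultimately have "filter ?P (map z [0..<N]) = map z [0..<Suc k] @ filter ?P (map z [Suc k..<N])" by (simp only:)
    then show ?thesis by (simp only: length_append length_map length_upt)
  qed
  finally show "eigenangles U ! k \<le> t"
    using eigenangles(1,2)[OF U] k by (intro sorted_nth_le_if_count) auto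
qed

section \<open>Measurability of the ordered eigenvalues\<close>

lemma char_poly_coeff_measurable:
  "(\<lambda>U. coeff (char_poly U) i) \<in> borel_measurable (unitary_space N)"
proof -
  have prod: "(\<lambda>U. coeff (\<Prod>a\<in>A. f a U) i) \<in> borel_measurable (unitary_space N)"
    if "finite A" "\<And>a i. a \<in> A \<Longrightarrow> (\<lambda>U. coeff (f a U) i) \<in> borel_measurable (unitary_space N)"
    for A :: "nat set" and f :: "nat \<Rightarrow> complex mat \<Rightarrow> complex poly" and i
    using that
  proof (induction A arbitrary: i rule: finite_induct)
    case (insert a A)
    have "(\<lambda>U. \<Sum>j\<le>i. coeff (f a U) j * coeff (\<Prod>a\<in>A. f a U) (i - j)) \<in> borel_measurable (unitary_space N)"
      using insert by (intro borel_measurable_sum borel_measurable_times) auto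
    then show ?case using insert.hyps by (simp add: coeff_mult)
  qed simp
  define F where "F U a b = (if a = b then [:0, 1:] else 0) + [:- (U $$ (a, b)):]" for U :: "complex mat" and a b
  have F: "(\<lambda>U. coeff (F U a b) i) \<in> borel_measurable (unitary_space N)" if "a < N" "b < N" for a b i
    using unitary_entry_measurable[OF that] by (cases i) (auto simp: F_def)
  have "coeff (char_poly U) i = (\<Sum>\<sigma> | \<sigma> permutes {..<N}. of_int (sign \<sigma>) * coeff (\<Prod>a<N. F U a (\<sigma> a)) i)"
    if U: "U \<in> space (unitary_space N)" for U
  proof -
    have UN: "U \<in> carrier_mat N N" using U unitary_matsD(1) by auto
    have "char_poly U = fdet N (F U)"
      unfolding char_poly_defs fdet_def using UN
      by (intro arg_cong[of _ _ Determinant.det] eq_matI) (auto simp: F_def)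
    also have "\<dots> = (\<Sum>\<sigma> | \<sigma> permutes {..<N}. of_int (sign \<sigma>) * (\<Prod>a<N. F U a (\<sigma> a)))" by (rule fdet_leibniz)
    finally show ?thesis by (simp add: coeff_sum of_int_poly)
  qed
  moreover have "(\<lambda>U. \<Sum>\<sigma> | \<sigma> permutes {..<N}. of_int (sign \<sigma>) * coeff (\<Prod>a<N. F U a (\<sigma> a)) i) \<in> borel_measurable (unitary_space N)"
  proof (intro borel_measurable_sum borel_measurable_times borel_measurable_const prod F)
    fix \<sigma> a assume "\<sigma> \<in> {\<sigma>. \<sigma> permutes {..<N}}" "a \<in> {..<N}"
    then show "a < N" "\<sigma> a < N" using permutes_in_image[of \<sigma> "{..<N}" a] by auto
  qed simp
  ultimately show ?thesis by (rule measurable_cong[THEN iffD2])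
qed

text \<open>The coordinates outside \<open>{..<N}\<close> are frozen at \<open>undefined\<close>.
  With the compact singleton as their factor, the set becomes a full product to which Tychonoff's
  theorem applies.\<close>

lemma compact_PiE_lessThan:
  fixes X :: "nat \<Rightarrow> complex set"
  assumes "\<And>a. compact (X a)"
  shows "compact (PiE {..<N} X)"
proof -
  define Y where "Y a = (if a < N then X a else {undefined})" for a
  have "compactin (product_topology (\<lambda>_::nat. euclidean) UNIV) (PiE UNIV Y)"
    using assms by (simp add: compactin_PiE Y_def)
  moreover have "PiE {..<N} X = PiE UNIV Y"
  proof (rule equalityI; rule subsetI; rule PiE_I)
    fix z a assume z: "z \<in> PiE {..<N} X"
    show "z a \<in> Y a"
      using PiE_mem[OF z, of a] PiE_arb[OF z, of a] by (simp add: Y_def)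
  next
    fix z a assume z: "z \<in> PiE UNIV Y" and "a \<in> {..<N}"
    then show "z a \<in> X a" using PiE_mem[OF z, of a] by (simp add: Y_def)
  next
    fix z a assume z: "z \<in> PiE UNIV Y" and "a \<notin> {..<N}"
    then show "z a = undefined" using PiE_mem[OF z, of a] by (simp add: Y_def)
  qed simp
  ultimately show ?thesis by (simp add: euclidean_product_topology)
qed

text \<open>The set of all coordinates with the first \<open>k + 1\<close> in a closed arc is compact, hence so is
  its image under the map to the coefficients of the characteristic polynomial.\<close>

lemma eigenangle_measurable:
  assumes k: "k < N"
  shows "(\<lambda>U. eigenangles U ! k) \<in> borel_measurable (unitary_space N)"
  unfolding borel_measurable_iff_le
proof
  fix t
  show "{U \<in> space (unitary_space N). eigenangles U ! k \<le> t} \<in> sets (unitary_space N)"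
  proof (cases "t < 2 * pi")
    case False
    then have "eigenangles U ! k \<le> t" if "U \<in> unitary_mats N" for U
      using eigenangles_range(2)[OF that k] by linarith
    then have "{U \<in> space (unitary_space N). eigenangles U ! k \<le> t} = space (unitary_space N)" by auto
    then show ?thesis by (simp only: sets.top)
  next
    case True
    define X where "X a = (if a \<le> k then cis ` {0..t} else unit_circle)" for a
    define C where "C = PiE {..<N} X"
    define c where "c z = (\<lambda>i. coeff (linear_product N z) i)" for z
    have X: "compact (X a)" for a
      unfolding X_def by (auto intro!: compact_continuous_image continuous_intros)
    have "compact C" unfolding C_def using X by (rule compact_PiE_lessThan)
    moreover have "continuous_on C c" unfolding c_def
      by (intro continuous_on_coordinatewise_then_product continuous_on_subset[OF continuous_on_linear_product_coeff]) auto
    ultimately have "compact (c ` C)" by (intro compact_continuous_image)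
    then have cC: "c ` C \<in> sets borel" by (intro borel_closed compact_imp_closed)
    have m: "(\<lambda>U. \<lambda>i. coeff (char_poly U) i) \<in> borel_measurable (unitary_space N)"
      by (intro measurable_coordinatewise_then_product char_poly_coeff_measurable)
    have "{U \<in> space (unitary_space N). eigenangles U ! k \<le> t} = (\<lambda>U. \<lambda>i. coeff (char_poly U) i) -` (c ` C) \<inter> space (unitary_space N)"
    proof -
      have "eigenangles U ! k \<le> t \<longleftrightarrow> (\<lambda>i. coeff (char_poly U) i) \<in> c ` C" if "U \<in> unitary_mats N" for U
        unfolding eigenangle_le_iff[OF that k True] X_def[symmetric] C_def[symmetric] c_def image_iff
        by (simp add: coeff_inject eq_commute)
      then show ?thesis by auto
    qed
    then show ?thesis using measurable_sets[OF m cC] by simp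
  qed
qed

definition eigenvalue_vector :: "nat \<Rightarrow> complex mat \<Rightarrow> nat \<Rightarrow> complex" where
  "eigenvalue_vector N U = (\<lambda>a\<in>{..<N}. cis (eigenangles U ! a))"

lemma eigenvalue_vector_measurable: "eigenvalue_vector N \<in> measurable (unitary_space N) (torus N)"
  unfolding eigenvalue_vector_def torus_def
proof (rule measurable_restrict)
  fix a assume "a \<in> {..<N}"
  then have "(\<lambda>U. cis (eigenangles U ! a)) \<in> measurable (unitary_space N) (restrict_space borel unit_circle)"
    by (intro measurable_compose[OF eigenangle_measurable cis_measurable]) auto
  then show "(\<lambda>U. cis (eigenangles U ! a)) \<in> measurable (unitary_space N) circle"
    by (subst measurable_cong_sets[OF refl sets_circle])
qed

lemma char_poly_eigenvalue_vector:
  assumes "U \<in> unitary_mats N"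
  shows "char_poly U = linear_product N (eigenvalue_vector N U)"
  unfolding eigenangles(3)[OF assms] linear_product_def
  by (intro prod.cong refl) (simp add: eigenvalue_vector_def)

section \<open>The eigenvalue distribution of the constructed matrix\<close>

lemma linear_product_eq_imp_permutation:
  assumes "linear_product N z = linear_product N y" "z \<in> space (torus N)" "y \<in> space (torus N)"
  obtains \<sigma> where "\<sigma> permutes {..<N}" "z = y \<circ> \<sigma>"
proof -
  have "mset (map z [0..<N]) = mset (map y [0..<N])"
    using assms(1) by (metis proots_linear_product)
  then obtain \<sigma> where \<sigma>: "\<sigma> permutes {..<length (map y [0..<N])}" "permute_list \<sigma> (map y [0..<N]) = map z [0..<N]"
    by (rule mset_eq_permutation)
  then have p: "\<sigma> permutes {..<N}" by simp
  have "z a = (y \<circ> \<sigma>) a" for a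
  proof (cases "a < N")
    case True
    have "\<sigma> a < N" using permutes_in_image[OF p, of a] True by simp
    have "map z [0..<N] ! a = map y [0..<N] ! \<sigma> a"
      unfolding \<sigma>(2)[symmetric] using True \<sigma>(1) by (subst permute_list_nth) auto
    then show ?thesis using True \<open>\<sigma> a < N\<close> by simp
  next
    case False
    then have "\<sigma> a = a" using p by (auto simp: permutes_def)
    then show ?thesis using False assms(2,3) by (auto simp: space_torus PiE_iff extensional_def)
  qed
  then have "z = y \<circ> \<sigma>" by auto
  with p that show ?thesis by blast
qed

text \<open>For a permutation invariant set the event does not depend on the order of the
  eigenvalues. Taking them sorted shows that it is measurable, and taking them in the order of the
  diagonal entries computes its probability.\<close>

lemma joint_eigenvalue_density_random_unitary:
  assumes q: "q \<in> borel_measurable (torus N)" and q1: "(\<integral>\<^sup>+z. ennreal (q z) \<partial>torus N) = 1"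
    and p: "AE z in torus N. p z = q z"
  shows "joint_eigenvalue_density N (random_unitary N (density (torus N) (\<lambda>z. ennreal (q z)))) p"
  unfolding joint_eigenvalue_density_def Let_def
proof (intro ballI impI)
  let ?P = "density (torus N) (\<lambda>z. ennreal (q z))"
  let ?\<mu> = "random_unitary N ?P"
  interpret B: prob_space "ball_measure N" by (rule prob_space_ball_measure)
  have P: "prob_space ?P" using q q1 by (intro prob_spaceI) (simp add: emeasure_density cong: nn_integral_cong)
  interpret P: prob_space ?P by (rule P)
  interpret BP: pair_prob_space "ball_measure N" ?P ..
  fix B assume B: "B \<in> sets (torus N)" and sym: "\<forall>z\<in>B. \<forall>\<sigma>. \<sigma> permutes {..<N} \<longrightarrow> z \<circ> \<sigma> \<in> B"
  have Bs: "B \<subseteq> space (torus N)" using B by (rule sets.sets_into_space)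
  define E where "E = {U \<in> space ?\<mu>. \<exists>z\<in>B. char_poly U = (\<Prod>a<N. [:- z a, 1:])}"
  have space: "space ?\<mu> = unitary_mats N" by (simp add: random_unitary_def)
  have inB: "(\<exists>y\<in>B. linear_product N z = linear_product N y) \<longleftrightarrow> z \<in> B" if z: "z \<in> space (torus N)" for z
  proof
    assume "\<exists>y\<in>B. linear_product N z = linear_product N y"
    then obtain y where y: "y \<in> B" "linear_product N z = linear_product N y" by blast
    obtain \<sigma> where "\<sigma> permutes {..<N}" "z = y \<circ> \<sigma>"
      using linear_product_eq_imp_permutation[OF y(2) z] y(1) Bs by blast
    then show "z \<in> B" using sym y(1) by blast
  qed blast
  have E: "E = eigenvalue_vector N -` B \<inter> space (unitary_space N)"
  proof -
    have "(\<exists>z\<in>B. char_poly U = linear_product N z) \<longleftrightarrow> eigenvalue_vector N U \<in> B" if U: "U \<in> unitary_mats N" for U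
      unfolding char_poly_eigenvalue_vector[OF U]
      by (rule inB) (use measurable_space[OF eigenvalue_vector_measurable] U in simp)
    then show ?thesis unfolding E_def space linear_product_def[symmetric] by auto
  qed
  have Es: "E \<in> sets (unitary_space N)"
    unfolding E by (rule measurable_sets[OF eigenvalue_vector_measurable B])
  have m: "conjugated_diag N \<in> measurable (ball_measure N \<Otimes>\<^sub>M ?P) (unitary_space N)"
    by (rule conjugated_diag_measurable') simp
  \<comment> \<open>The constructed matrix is similar to the diagonal matrix of \<open>z\<close>, so
    the event constrains only \<open>z\<close> and its preimage is a product set.\<close>
  have pre: "conjugated_diag N -` E \<inter> space (ball_measure N \<Otimes>\<^sub>M ?P) = space (ball_measure N) \<times> B"
  proof -
    have "conjugated_diag N (G, z) \<in> E \<longleftrightarrow> z \<in> B" if z: "z \<in> space (torus N)" for G z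
    proof -
      have V: "unitary_of N G \<in> unitary_mats N" by (rule unitary_of_unitary)
      have d: "diag_of N z \<in> carrier_mat N N" by (simp add: diag_of_def)
      have "similar_mat (conjugated_diag N (G, z)) (diag_of N z)"
        unfolding conjugated_diag_def
        by (rule similar_matI[of _ _ "unitary_of N G" "mat_adjoint (unitary_of N G)" N])
          (use unitary_matsD[OF V] d in auto)
      then have "char_poly (conjugated_diag N (G, z)) = char_poly (diag_of N z)" by (rule char_poly_similar)
      also have "\<dots> = (\<Prod>a\<leftarrow>diag_mat (diag_of N z). [:- a, 1:])"
        by (rule char_poly_upper_triangular[OF d]) (auto simp: diag_of_def upper_triangular_def)
      also have "diag_mat (diag_of N z) = map z [0..<N]" by (auto simp: diag_mat_def diag_of_def)
      also have "(\<Prod>a\<leftarrow>map z [0..<N]. [:- a, 1:]) = linear_product N z"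
        unfolding linear_product_def by (simp add: prod.list_conv_set_nth lessThan_atLeast0)
      finally have "char_poly (conjugated_diag N (G, z)) = linear_product N z" .
      then show ?thesis
        using inB[OF z] conjugated_diag_unitary[OF z, of G] unfolding E_def space linear_product_def[symmetric] by simp
    qed
    then show ?thesis using Bs by (auto simp: space_pair_measure)
  qed
  have "emeasure ?\<mu> E = emeasure (ball_measure N \<Otimes>\<^sub>M ?P) (space (ball_measure N) \<times> B)"
    unfolding random_unitary_def pre[symmetric] by (rule emeasure_distr[OF m Es])
  also have "\<dots> = emeasure (ball_measure N) (space (ball_measure N)) * emeasure ?P B"
    by (rule P.emeasure_pair_measure_Times) (use B in auto)
  also have "\<dots> = emeasure ?P B" by (simp only: B.emeasure_space_1 mult_1_left)
  also have "\<dots> = (\<integral>\<^sup>+z. ennreal (q z) * indicator B z \<partial>torus N)" using B q by (intro emeasure_density) auto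
  also have "\<dots> = (\<integral>\<^sup>+z. ennreal (p z) * indicator B z \<partial>torus N)"
    using p by (intro nn_integral_cong_AE) (auto elim!: eventually_mono)
  also have "\<dots> = (\<integral>\<^sup>+z. ennreal (p z) * indicator B z \<partial>completion (torus N))"
    by (rule nn_integral_completion[symmetric])
  finally have "emeasure ?\<mu> E = (\<integral>\<^sup>+z. ennreal (p z) * indicator B z \<partial>completion (torus N))" .
  moreover have "E \<in> sets ?\<mu>" using Es by (simp add: random_unitary_def)
  ultimately show "{U \<in> space ?\<mu>. \<exists>z\<in>B. char_poly U = (\<Prod>a<N. [:- z a, 1:])} \<in> sets ?\<mu> \<and>
      emeasure ?\<mu> {U \<in> space ?\<mu>. \<exists>z\<in>B. char_poly U = (\<Prod>a<N. [:- z a, 1:])} =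
      (\<integral>\<^sup>+z. ennreal (p z) * indicator B z \<partial>completion (torus N))"
    unfolding E_def by blast
qed

context pf_weight
begin

theorem cyclic_polya_weight: "cyclic_polya_weight N w"
proof -
  obtain q where q: "q \<in> borel_measurable (torus N)" "\<And>z. q z \<ge> 0"
    "AE z in torus N. polya_density N w z = of_real (q z)" "(\<integral>\<^sup>+z. ennreal (q z) \<partial>torus N) = 1"
    using density_exists by blast
  obtain r where r: "r > 0" "polya_normalisation N w = complex_of_real r" using polya_normalisation_pos by blast
  let ?P = "density (torus N) (\<lambda>z. ennreal (q z))"
  have "w \<in> L1N_tilde N"
    using circle_regular sym L1 unfolding L1N_tilde_def L1N_def circle_regular_iff by auto
  moreover have "AE z in torus N. polya_density N w z \<in> \<real>\<^sub>\<ge>\<^sub>0"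
    using q(3) by eventually_elim (simp add: q(2))
  moreover have "prob_space ?P" using q(1,4) by (intro prob_spaceI) (simp add: emeasure_density cong: nn_integral_cong)
  then have "unitarily_invariant N (random_unitary N ?P)" by (rule unitarily_invariant_random_unitary) simp
  moreover have "AE z in torus N. Re (polya_density N w z) = q z" using q(3) by eventually_elim simp
  then have "joint_eigenvalue_density N (random_unitary N ?P) (\<lambda>z. Re (polya_density N w z))"
    by (rule joint_eigenvalue_density_random_unitary[OF q(1,4)])
  ultimately have "cyclic_polya_ensemble N w (random_unitary N ?P)"
    unfolding cyclic_polya_ensemble_def using r by simp
  then show ?thesis unfolding cyclic_polya_weight_def by blast
qed

end

section \<open>From the Polya frequency function to its weight\<close>

theorem theorem18:
  fixes chi M :: nat and g :: "complex \<Rightarrow> complex"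
  assumes "chi \<in> {0, 1}" and "2 * M + chi \<ge> 1"
    and "chi = 1 \<Longrightarrow> cyclic_pff_odd M g"
    and "chi = 0 \<Longrightarrow> cyclic_pff_even M g"
    and "times_differentiable (2 * M + chi - 1) g"
    and "\<forall>j\<le>2 * M + chi - 1. L1_circle ((circle_deriv ^^ j) g)"
    and nondegenerate: "\<not> (AE (x, y) in torus (2 * M + chi) \<Otimes>\<^sub>M torus (2 * M + chi).
      kernel_det (2 * M + chi) g x y = 0)"
  shows "cyclic_polya_weight (2 * M + chi) (\<lambda>z. z powi (- int M - int chi + 1) * g z)"
proof -
  define N where "N = 2 * M + chi"
  \<comment> \<open>The exponent in the inequality of full size \<open>N\<close>: \<open>M\<close>
    for odd order and \<open>M - 1\<close> for even order. It is also minus the exponent of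
    \<open>z\<close> in the weight.\<close>
  define k where "k = M + chi - 1"
  have k: "- int M - int chi + 1 = - int k" using assms(1,2) by (auto simp: k_def)
  define w where "w z = z powi (- int k) * g z" for z
  have w: "w z = inverse (z ^ k) * g z" for z
    by (simp add: w_def power_int_minus power_int_of_nat)
  have pfi: "pf_inequality N k g"
  proof (cases "chi = 1")
    case True
    then show ?thesis using assms(3) by (auto simp: cyclic_pff_odd_def N_def k_def)
  next
    case False
    then have "chi = 0" "M \<ge> 1" using assms(1,2) by auto
    then show ?thesis using assms(4) by (auto simp: cyclic_pff_even_def N_def k_def)
  qed
  \<comment> \<open>The powers of \<open>x a\<close> leave the determinant through the rows and
    those of \<open>y b\<close> through the columns; together they form the denominator of the
    inequality.\<close>
  have kernel: "kernel_det N w x y = kernel_det N g x y / (\<Prod>a<N. x a * inverse (y a)) ^ k" for x y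
  proof -
    have "kernel_det N w x y = fdet N (\<lambda>a b. inverse (x a ^ k) * (y b ^ k * g (x a * inverse (y b))))"
      unfolding kernel_det_eq_fdet w by (rule fdet_cong) (simp add: power_mult_distrib power_inverse field_simps)
    also have "\<dots> = (\<Prod>a<N. inverse (x a ^ k)) * ((\<Prod>a<N. y a ^ k) * kernel_det N g x y)"
      unfolding fdet_scale_rows fdet_scale_cols kernel_det_eq_fdet ..
    also have "(\<Prod>a<N. inverse (x a ^ k)) = inverse ((\<Prod>a<N. x a) ^ k)"
      unfolding prod_power_distrib by (rule prod_inversef[unfolded o_def])
    also have "(\<Prod>a<N. y a ^ k) = (\<Prod>a<N. y a) ^ k" by (rule prod_power_distrib[symmetric])
    also have "inverse ((\<Prod>a<N. x a) ^ k) * ((\<Prod>a<N. y a) ^ k * kernel_det N g x y) =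
        kernel_det N g x y / ((\<Prod>a<N. x a) * inverse (\<Prod>a<N. y a)) ^ k"
      by (simp add: divide_inverse power_mult_distrib power_inverse)
    also have "(\<Prod>a<N. x a) * inverse (\<Prod>a<N. y a) = (\<Prod>a<N. x a * inverse (y a))"
      unfolding prod.distrib prod_inversef[unfolded o_def] ..
    finally show ?thesis .
  qed
  interpret pf_weight N w
  proof
    show "N \<ge> 1" using assms(2) by (simp add: N_def)
    have "circle_regular (N - 1) g" using assms(5,6) by (simp add: circle_regular_iff N_def)
    from circle_regular_powi[OF this, of 1 "- int k"] show "circle_regular (N - 1) w" by (simp add: w_def[abs_def])
    show "cnj (w z) = z ^ (N - 1) * w z" if z: "z \<in> unit_circle" for z
    proof -
      have nz: "z \<noteq> 0" using z by auto
      have ci: "cnj z = inverse z" using inverse_eq_cnj[OF z] by simp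
      show ?thesis
      \<comment> \<open>For odd order \<open>g\<close> is real and \<open>N - 1 = 2 * k\<close>; for
        even order \<open>cnj (g z) = z * g z\<close> and \<open>N - 1 = 2 * k + 1\<close>. The
        extra factor \<open>z\<close> makes up the difference, so the weight has the same symmetry
        in both cases.\<close>
      proof (cases "chi = 1")
        case True
        then have "g z \<in> \<real>\<^sub>\<ge>\<^sub>0" using assms(3) z by (auto simp: cyclic_pff_odd_def)
        then have "cnj (g z) = g z" by (auto simp: complex_nonneg_Reals_iff complex_eq_iff)
        moreover have "N - 1 = k + k" using True by (simp add: N_def k_def)
        ultimately show ?thesis using nz by (simp add: w ci power_add power_inverse)
      next
        case False
        then have c: "chi = 0" "M \<ge> 1" using assms(1,2) by auto
        then have "cnj (g z) = z * g z" using assms(4) z by (auto simp: cyclic_pff_even_def)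
        moreover have "N - 1 = Suc (k + k)" using c by (simp add: N_def k_def)
        ultimately show ?thesis using nz by (simp add: w ci power_add power_inverse)
      qed
    qed
    show "vandermonde N x * vandermonde N (\<lambda>a. inverse (y a)) * kernel_det N w x y \<in> \<real>\<^sub>\<ge>\<^sub>0"
      if "\<And>a. a < N \<Longrightarrow> x a \<in> unit_circle" "\<And>a. a < N \<Longrightarrow> y a \<in> unit_circle" for x y
      using pfi that unfolding pf_inequality_def kernel by (simp add: mult.assoc)
    show "\<not> (AE (x, y) in torus N \<Otimes>\<^sub>M torus N. kernel_det N w x y = 0)"
    proof
      assume "AE (x, y) in torus N \<Otimes>\<^sub>M torus N. kernel_det N w x y = 0"
      with AE_space have "AE (x, y) in torus N \<Otimes>\<^sub>M torus N. kernel_det N g x y = 0"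
      proof eventually_elim
        case (elim p)
        obtain x y where p: "p = (x, y)" by fastforce
        have "x \<in> space (torus N)" "y \<in> space (torus N)" using elim(1) by (auto simp: p space_pair_measure)
        then have "x a \<in> unit_circle" "y a \<in> unit_circle" if "a < N" for a
          using that unfolding space_torus by (auto simp only: PiE_iff lessThan_iff)
        then have "x a \<noteq> 0" "y a \<noteq> 0" if "a < N" for a using that by fastforce+
        then have nz: "(\<Prod>a<N. x a * inverse (y a)) ^ k \<noteq> 0" by auto
        have "kernel_det N g x y / (\<Prod>a<N. x a * inverse (y a)) ^ k = 0"
          using elim(2) by (simp only: p prod.case kernel)
        then have "kernel_det N g x y = 0" using nz by (simp only: divide_eq_0_iff simp_thms)
        then show ?case by (simp add: p)
      qed
      with nondegenerate show False unfolding N_def[symmetric] by (rule notE)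
    qed
  qed
  show ?thesis using cyclic_polya_weight unfolding k N_def w_def[abs_def] .
qed

end
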